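(* Let $\mathcal{D}_F,\mathcal{D},\mathcal{D}_U$ be triangulated categories with coproducts and let there be a recollement of $\mathcal{D}$ relative to $\mathcal{D}_F$ and $\mathcal{D}_U$, with functors $i^*, i_*, i^!, j_!, j^*, j_*$. Suppose $\mathcal{D}_U$ is weakly approximable, and $\mathcal{D}$ has a compact generator $G$ such that $\operatorname{Hom}_{\mathcal{D}}(\Sigma^{-n}G,G)=0$ for $n\gg 0$. For $\mathcal{C}$ any of $\mathcal{D}_U,\mathcal{D},\mathcal{D}_F$, let $\mathcal{C}^-_c$, $\mathcal{C}^b_c$, $\mathcal{C}^+$ be the subcategories defined by the preferred equivalence class of t-structures on $\mathcal{C}$. If $j^*G\in(\mathcal{D}_U)^-_c$, then $$\mathcal{D}^-_c=\{X\in\mathcal{D}\mid i^*X\in(\mathcal{D}_F)^-_c \text{ and } j^*X\in(\mathcal{D}_U)^-_c\},$$ $$\mathcal{D}^b_c=\{X\in\mathcal{D}\mid i^*X\in(\mathcal{D}_F)^-_c,\ j^*X\in(\mathcal{D}_U)^b_c \text{ and } i^!X\in(\mathcal{D}_F)^+\}.$$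
   Context: All triangulated categories have (small) coproducts; $\Sigma=[1]$ is the suspension. A compact object $G$ is a compact generator if $\operatorname{Hom}(\Sigma^nG,X)=0$ for all $n\in\mathbb{Z}$ implies $X=0$. For a t-structure $(\mathcal{D}^{\le 0},\mathcal{D}^{\ge 0})$ put $\mathcal{D}^{\le n}=\Sigma^{-n}\mathcal{D}^{\le 0}$, $\mathcal{D}^{\ge n}=\Sigma^{-n}\mathcal{D}^{\ge 0}$. Notation. For full subcategories $\mathcal{A},\mathcal{B}$, $\mathcal{A}\ast\mathcal{B}$ is the full subcategory of those $x$ admitting an exact triangle $a\to x\to b$ with $a\in\mathcal{A}$, $b\in\mathcal{B}$; $\operatorname{smd}(\mathcal{A})$ consists of all direct summands of objects of $\mathcal{A}$. For an object $G$ and $A\le B$ in $\mathbb{Z}\cup\{\pm\infty\}$, $G[A,B]=\{\Sigma^{-i}G\mid i\in\mathbb{Z},\ A\le i\le B\}$ (written $G(-\infty,B]$ if $A=-\infty$). $\operatorname{Coprod}(G[A,B])$ is the smallest full subcategory $\mathcal{S}$ closed under coproducts with $\mathcal{S}\ast\mathcal{S}\subset\mathcal{S}$ and $G[A,B]\subset\mathcal{S}$, and $\overline{\langle G\rangle}^{[A,B]}=\operatorname{smd}(\operatorname{Coprod}(G[A,B]))$. $\mathcal{D}$ is weakly approximable if there exist a compact generator $G$, a t-structure and an integer $A>0$ such that: (1) $\Sigma^A G\in\mathcal{D}^{\le 0}$ and $\operatorname{Hom}_{\mathcal{D}}(\Sigma^{-A}G,X)=0$ for all $X\in\mathcal{D}^{\le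 0}$; (2) every $X\in\mathcal{D}^{\le 0}$ admits an exact triangle $E\to X\to D$ with $E\in\overline{\langle G\rangle}^{[-A,A]}$ and $D\in\mathcal{D}^{\le -1}$. Two t-structures with aisles $\mathcal{D}_1^{\le 0},\mathcal{D}_2^{\le 0}$ are equivalent if there is $A>0$ with $\mathcal{D}_1^{\le -A}\subset\mathcal{D}_2^{\le 0}\subset\mathcal{D}_1^{\le A}$. The t-structure generated by a compact object $G$ has aisle $\overline{\langle G\rangle}^{(-\infty,0]}$. If $\mathcal{D}$ has a compact generator $G$, the preferred equivalence class of t-structures is the one containing the t-structure generated by $G$ (it does not depend on $G$). In the situation of the statement $i^*G$ is a compact generator of $\mathcal{D}_F$, so $\mathcal{D}_F$ has a preferred equivalence class. Given a t-structure, $\mathcal{D}^+=\bigcup_{m>0}\mathcal{D}^{\ge -m}$, $\mathcal{D}^-=\bigcup_{m>0}\mathcal{D}^{\le m}$, $\mathcal{D}^b=\mathcal{D}^+\cap\mathcal{D}^-$; $\mathcal{D}^-_c$ is the full subcategory of those $X$ such that for every integer $m>0$ there is an exact triangle $E\to X\to E'$ with $E$ compact and $E'\in\mathcal{D}^{\le -m}$; $\mathcal{D}^b_c=\mathcal{D}^-_c\cap\mathcal{D}^b$. Equivalent t-structures yield the same subcategories. A recollement of $\mathcal{D}$ relative to $\mathcal{D}_F,\mathcal{D}_U$ consists of exact functors $i_*:\mathcal{D}_F\to\mathcal{D}$, $i^*,i^!:\mathcal{D}\to\mathcal{D}_F$, $j^*:\mathcal{D}\to\mathcal{D}_U$, $j_!,j_*:\mathcal{D}_U\to\mathcal{D}$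 such that: $i^*\dashv i_*\dashv i^!$ and $j_!\dashv j^*\dashv j_*$; $j^*i_*=0$; $i_*,j_!,j_*$ are fully faithful; and for every $X\in\mathcal{D}$ there are exact triangles, natural in $X$, $j_!j^*X\to X\to i_*i^*X\to j_!j^*X[1]$ and $i_*i^!X\to X\to j_*j^*X\to i_*i^!X[1]$ whose first two maps are the (co)units of the adjunctions. *)

theory Defs
  imports "HOL-Algebra.FiniteProduct" "HOL-Algebra.Product_Groups"
begin

unbundle cardinal_syntax

section \<open>Smallness\<close>

text \<open>
  Small sets are the sets of cardinality below a fixed (strongly) inaccessible cardinal
  \<open>\<kappa>\<close>, i.e. up to bijection the members of a Grothendieck universe.  Every set of cardinality
  below \<open>\<kappa>\<close> is in bijection with a subset of the type underlying \<open>\<kappa>\<close>, so that it suffices to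
  take such subsets as the index sets of small families.
\<close>

definition inaccessible :: "'k rel \<Rightarrow> bool" where
  "inaccessible \<kappa> \<longleftrightarrow>
     Card_order \<kappa> \<and> natLeq <o \<kappa> \<and> regularCard \<kappa> \<and>
     (\<forall>A :: 'k set. |A| <o \<kappa> \<longrightarrow> |Pow A| <o \<kappa>)"

section \<open>Categories, functors, adjunctions\<close>

record ('o, 'm) category =
  Obj :: "'o set"
  Arr :: "'m set"
  Dom :: "'m \<Rightarrow> 'o"
  Cod :: "'m \<Rightarrow> 'o"
  ident :: "'o \<Rightarrow> 'm"
  comp :: "'m \<Rightarrow> 'm \<Rightarrow> 'm" (infixl \<open>\<cdot>\<index>\<close> 70)

definition Mor :: "('o, 'm, 'z) category_scheme \<Rightarrow> 'o \<Rightarrow> 'o \<Rightarrow> 'm set" where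
  "Mor C X Y = {f \<in> Arr C. Dom C f = X \<and> Cod C f = Y}"

locale category =
  fixes C :: "('o, 'm, 'z) category_scheme" (structure)
  assumes Dom_Obj: "f \<in> Arr C \<Longrightarrow> Dom C f \<in> Obj C"
    and Cod_Obj: "f \<in> Arr C \<Longrightarrow> Cod C f \<in> Obj C"
    and ident_Mor: "X \<in> Obj C \<Longrightarrow> ident C X \<in> Mor C X X"
    and comp_Mor: "\<lbrakk>f \<in> Mor C X Y; g \<in> Mor C Y Z\<rbrakk> \<Longrightarrow> g \<cdot> f \<in> Mor C X Z"
    and comp_ident: "f \<in> Mor C X Y \<Longrightarrow> f \<cdot> ident C X = f"
    and ident_comp: "f \<in> Mor C X Y \<Longrightarrow> ident C Y \<cdot> f = f"
    and comp_assoc: "\<lbrakk>f \<in> Mor C W X; g \<in> Mor C X Y; h \<in> Mor C Y Z\<rbrakk>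
                      \<Longrightarrow> (h \<cdot> g) \<cdot> f = h \<cdot> (g \<cdot> f)"

definition isomorphism :: "('o, 'm, 'z) category_scheme \<Rightarrow> 'm \<Rightarrow> 'o \<Rightarrow> 'o \<Rightarrow> bool" where
  "isomorphism C f X Y \<longleftrightarrow>
     f \<in> Mor C X Y \<and>
     (\<exists>g \<in> Mor C Y X. g \<cdot>\<^bsub>C\<^esub> f = ident C X \<and> f \<cdot>\<^bsub>C\<^esub> g = ident C Y)"

definition zero_object :: "('o, 'm, 'z) category_scheme \<Rightarrow> 'o \<Rightarrow> bool" where
  "zero_object C Z \<longleftrightarrow>
     Z \<in> Obj C \<and> (\<forall>X \<in> Obj C. (\<exists>!f. f \<in> Mor C X Z) \<and> (\<exists>!f. f \<in> Mor C Z X))"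

definition is_coproduct ::
  "('o, 'm, 'z) category_scheme \<Rightarrow> 'i set \<Rightarrow> ('i \<Rightarrow> 'o) \<Rightarrow> 'o \<Rightarrow> ('i \<Rightarrow> 'm) \<Rightarrow> bool" where
  "is_coproduct C I X P \<iota> \<longleftrightarrow>
     P \<in> Obj C \<and> (\<forall>i \<in> I. \<iota> i \<in> Mor C (X i) P) \<and>
     (\<forall>Y \<in> Obj C. \<forall>f. (\<forall>i \<in> I. f i \<in> Mor C (X i) Y) \<longrightarrow>
        (\<exists>!h. h \<in> Mor C P Y \<and> (\<forall>i \<in> I. h \<cdot>\<^bsub>C\<^esub> \<iota> i = f i)))"

definition has_coproducts :: "'k rel \<Rightarrow> ('o, 'm, 'z) category_scheme \<Rightarrow> bool" where
  "has_coproducts \<kappa> C \<longleftrightarrow>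
     (\<forall>(I :: 'k set) X. |I| <o \<kappa> \<and> (\<forall>i \<in> I. X i \<in> Obj C) \<longrightarrow>
        (\<exists>P \<iota>. is_coproduct C I X P \<iota>))"

definition locally_small :: "'k rel \<Rightarrow> ('o, 'm, 'z) category_scheme \<Rightarrow> bool" where
  "locally_small \<kappa> C \<longleftrightarrow> (\<forall>X \<in> Obj C. \<forall>Y \<in> Obj C. |Mor C X Y| <o \<kappa>)"

record ('o1, 'm1, 'o2, 'm2) functor_data =
  ob :: "'o1 \<Rightarrow> 'o2"
  ar :: "'m1 \<Rightarrow> 'm2"

definition id_functor :: "('o, 'm, 'o, 'm) functor_data" where
  "id_functor = \<lparr>ob = (\<lambda>X. X), ar = (\<lambda>f. f)\<rparr>"

definition comp_functor ::
  "('o2, 'm2, 'o3, 'm3) functor_data \<Rightarrow> ('o1, 'm1, 'o2, 'm2) functor_data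
    \<Rightarrow> ('o1, 'm1, 'o3, 'm3) functor_data" (infixl \<open>\<circ>\<^sub>F\<close> 70) where
  "G \<circ>\<^sub>F F = \<lparr>ob = (\<lambda>X. ob G (ob F X)), ar = (\<lambda>f. ar G (ar F f))\<rparr>"

definition is_functor ::
  "('o1, 'm1, 'z1) category_scheme \<Rightarrow> ('o2, 'm2, 'z2) category_scheme
    \<Rightarrow> ('o1, 'm1, 'o2, 'm2) functor_data \<Rightarrow> bool" where
  "is_functor C D F \<longleftrightarrow>
     (\<forall>X \<in> Obj C. ob F X \<in> Obj D) \<and>
     (\<forall>X Y. \<forall>f \<in> Mor C X Y. ar F f \<in> Mor D (ob F X) (ob F Y)) \<and>
     (\<forall>X \<in> Obj C. ar F (ident C X) = ident D (ob F X)) \<and>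
     (\<forall>X Y Z. \<forall>f \<in> Mor C X Y. \<forall>g \<in> Mor C Y Z. ar F (g \<cdot>\<^bsub>C\<^esub> f) = ar F g \<cdot>\<^bsub>D\<^esub> ar F f)"

definition fully_faithful ::
  "('o1, 'm1, 'z1) category_scheme \<Rightarrow> ('o2, 'm2, 'z2) category_scheme
    \<Rightarrow> ('o1, 'm1, 'o2, 'm2) functor_data \<Rightarrow> bool" where
  "fully_faithful C D F \<longleftrightarrow>
     (\<forall>X \<in> Obj C. \<forall>Y \<in> Obj C. bij_betw (ar F) (Mor C X Y) (Mor D (ob F X) (ob F Y)))"

definition natural_transformation ::
  "('o1, 'm1, 'z1) category_scheme \<Rightarrow> ('o2, 'm2, 'z2) category_scheme
    \<Rightarrow> ('o1, 'm1, 'o2, 'm2) functor_data \<Rightarrow> ('o1, 'm1, 'o2, 'm2) functor_data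
    \<Rightarrow> ('o1 \<Rightarrow> 'm2) \<Rightarrow> bool" where
  "natural_transformation C D F G \<alpha> \<longleftrightarrow>
     (\<forall>X \<in> Obj C. \<alpha> X \<in> Mor D (ob F X) (ob G X)) \<and>
     (\<forall>X Y. \<forall>f \<in> Mor C X Y. ar G f \<cdot>\<^bsub>D\<^esub> \<alpha> X = \<alpha> Y \<cdot>\<^bsub>D\<^esub> ar F f)"

text \<open>\<open>F : C \<rightarrow> D\<close> is left adjoint to \<open>G : D \<rightarrow> C\<close>, with unit \<open>\<eta>\<close> and counit \<open>\<epsilon>\<close>.\<close>

definition adjunction ::
  "('o1, 'm1, 'z1) category_scheme \<Rightarrow> ('o2, 'm2, 'z2) category_scheme
    \<Rightarrow> ('o1, 'm1, 'o2, 'm2) functor_data \<Rightarrow> ('o2, 'm2, 'o1, 'm1) functor_data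
    \<Rightarrow> ('o1 \<Rightarrow> 'm1) \<Rightarrow> ('o2 \<Rightarrow> 'm2) \<Rightarrow> bool" where
  "adjunction C D F G \<eta> \<epsilon> \<longleftrightarrow>
     is_functor C D F \<and> is_functor D C G \<and>
     natural_transformation C C id_functor (G \<circ>\<^sub>F F) \<eta> \<and>
     natural_transformation D D (F \<circ>\<^sub>F G) id_functor \<epsilon> \<and>
     (\<forall>X \<in> Obj C. \<epsilon> (ob F X) \<cdot>\<^bsub>D\<^esub> ar F (\<eta> X) = ident D (ob F X)) \<and>
     (\<forall>Y \<in> Obj D. ar G (\<epsilon> Y) \<cdot>\<^bsub>C\<^esub> \<eta> (ob G Y) = ident C (ob G Y))"

section \<open>Additive categories\<close>

record ('o, 'm) additive_category = "('o, 'm) category" +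
  plus :: "'m \<Rightarrow> 'm \<Rightarrow> 'm" (infixl \<open>\<boxplus>\<index>\<close> 65)
  zero_arr :: "'o \<Rightarrow> 'o \<Rightarrow> 'm"

text \<open>The abelian group \<open>Hom(X, Y)\<close>, as a (multiplicatively written) group of HOL-Algebra.\<close>

definition Hom_group ::
  "('o, 'm, 'z) additive_category_scheme \<Rightarrow> 'o \<Rightarrow> 'o \<Rightarrow> 'm monoid" where
  "Hom_group C X Y = \<lparr>carrier = Mor C X Y, mult = plus C, one = zero_arr C X Y\<rparr>"

definition neg :: "('o, 'm, 'z) additive_category_scheme \<Rightarrow> 'm \<Rightarrow> 'm" where
  "neg C f = m_inv (Hom_group C (Dom C f) (Cod C f)) f"

definition is_biproduct ::
  "('o, 'm, 'z) additive_category_scheme \<Rightarrow> 'o \<Rightarrow> 'o \<Rightarrow> 'o \<Rightarrow> 'm \<Rightarrow> 'm \<Rightarrow> 'm \<Rightarrow> 'm \<Rightarrow> bool" where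
  "is_biproduct C X Y P \<iota>X \<iota>Y \<pi>X \<pi>Y \<longleftrightarrow>
     P \<in> Obj C \<and>
     \<iota>X \<in> Mor C X P \<and> \<iota>Y \<in> Mor C Y P \<and> \<pi>X \<in> Mor C P X \<and> \<pi>Y \<in> Mor C P Y \<and>
     \<pi>X \<cdot>\<^bsub>C\<^esub> \<iota>X = ident C X \<and> \<pi>Y \<cdot>\<^bsub>C\<^esub> \<iota>Y = ident C Y \<and>
     \<pi>Y \<cdot>\<^bsub>C\<^esub> \<iota>X = zero_arr C X Y \<and> \<pi>X \<cdot>\<^bsub>C\<^esub> \<iota>Y = zero_arr C Y X \<and>
     (\<iota>X \<cdot>\<^bsub>C\<^esub> \<pi>X) \<boxplus>\<^bsub>C\<^esub> (\<iota>Y \<cdot>\<^bsub>C\<^esub> \<pi>Y) = ident C P"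

locale additive_category = category C
  for C :: "('o, 'm, 'z) additive_category_scheme" (structure) +
  assumes Hom_comm_group: "\<lbrakk>X \<in> Obj C; Y \<in> Obj C\<rbrakk> \<Longrightarrow> comm_group (Hom_group C X Y)"
    and comp_plus: "\<lbrakk>f \<in> Mor C X Y; f' \<in> Mor C X Y; g \<in> Mor C Y Z\<rbrakk>
                     \<Longrightarrow> g \<cdot> (f \<boxplus> f') = (g \<cdot> f) \<boxplus> (g \<cdot> f')"
    and plus_comp: "\<lbrakk>f \<in> Mor C X Y; g \<in> Mor C Y Z; g' \<in> Mor C Y Z\<rbrakk>
                     \<Longrightarrow> (g \<boxplus> g') \<cdot> f = (g \<cdot> f) \<boxplus> (g' \<cdot> f)"
    and zero_object_exists: "\<exists>Z. zero_object C Z"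
    and biproduct_exists: "\<lbrakk>X \<in> Obj C; Y \<in> Obj C\<rbrakk>
                     \<Longrightarrow> \<exists>P \<iota>X \<iota>Y \<pi>X \<pi>Y. is_biproduct C X Y P \<iota>X \<iota>Y \<pi>X \<pi>Y"

definition additive_functor ::
  "('o1, 'm1, 'z1) additive_category_scheme \<Rightarrow> ('o2, 'm2, 'z2) additive_category_scheme
    \<Rightarrow> ('o1, 'm1, 'o2, 'm2) functor_data \<Rightarrow> bool" where
  "additive_functor C D F \<longleftrightarrow>
     is_functor C D F \<and>
     (\<forall>X Y. \<forall>f \<in> Mor C X Y. \<forall>g \<in> Mor C X Y. ar F (f \<boxplus>\<^bsub>C\<^esub> g) = ar F f \<boxplus>\<^bsub>D\<^esub> ar F g)"

section \<open>Triangulated categories\<close>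

text \<open>
  Verdier's axioms.  As in Verdier's and Neeman's definitions, the suspension is an additive
  automorphism of the category, so that its integral powers are functions on objects.
  \<open>(f, g, h) \<in> Tri C\<close> means that \<open>X \<rightarrow> Y \<rightarrow> Z \<rightarrow> \<Sigma>X\<close> with maps \<open>f, g, h\<close> is an exact triangle.
\<close>

record ('o, 'm) triangulated_category = "('o, 'm) additive_category" +
  susp :: "('o, 'm, 'o, 'm) functor_data" (\<open>\<Sigma>\<index>\<close>)
  Tri :: "('m \<times> 'm \<times> 'm) set"

definition triangle ::
  "('o, 'm, 'z) triangulated_category_scheme \<Rightarrow> 'm \<Rightarrow> 'm \<Rightarrow> 'm \<Rightarrow> 'o \<Rightarrow> 'o \<Rightarrow> 'o \<Rightarrow> bool" where
  "triangle C f g h X Y Z \<longleftrightarrow>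
     f \<in> Mor C X Y \<and> g \<in> Mor C Y Z \<and> h \<in> Mor C Z (ob (susp C) X)"

locale triangulated_category = additive_category C
  for C :: "('o, 'm, 'z) triangulated_category_scheme" (structure) +
  assumes susp_additive: "additive_functor C C \<Sigma>"
    and susp_bij_Obj: "bij_betw (ob \<Sigma>) (Obj C) (Obj C)"
    and susp_bij_Arr: "bij_betw (ar \<Sigma>) (Arr C) (Arr C)"
    and Tri_triangle: "(f, g, h) \<in> Tri C \<Longrightarrow> \<exists>X Y Z. triangle C f g h X Y Z"
    and TR1_iso: "\<lbrakk>(f, g, h) \<in> Tri C; triangle C f g h X Y Z; triangle C f' g' h' X' Y' Z';
                   isomorphism C u X X'; isomorphism C v Y Y'; isomorphism C w Z Z';
                   v \<cdot> f = f' \<cdot> u; w \<cdot> g = g' \<cdot> v; ar \<Sigma> u \<cdot> h = h' \<cdot> w\<rbrakk>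
                  \<Longrightarrow> (f', g', h') \<in> Tri C"
    and TR1_ident: "\<lbrakk>X \<in> Obj C; zero_object C Z\<rbrakk>
                  \<Longrightarrow> (ident C X, zero_arr C X Z, zero_arr C Z (ob \<Sigma> X)) \<in> Tri C"
    and TR1_cone: "f \<in> Arr C \<Longrightarrow> \<exists>g h. (f, g, h) \<in> Tri C"
    and TR2: "triangle C f g h X Y Z
                  \<Longrightarrow> (f, g, h) \<in> Tri C \<longleftrightarrow> (g, h, neg C (ar \<Sigma> f)) \<in> Tri C"
    and TR3: "\<lbrakk>(f, g, h) \<in> Tri C; triangle C f g h X Y Z;
               (f', g', h') \<in> Tri C; triangle C f' g' h' X' Y' Z';
               u \<in> Mor C X X'; v \<in> Mor C Y Y'; v \<cdot> f = f' \<cdot> u\<rbrakk>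
                  \<Longrightarrow> \<exists>w \<in> Mor C Z Z'. w \<cdot> g = g' \<cdot> v \<and> ar \<Sigma> u \<cdot> h = h' \<cdot> w"
    and TR4: "\<lbrakk>(f, f', f'') \<in> Tri C; triangle C f f' f'' X Y K;
               (g, g', g'') \<in> Tri C; triangle C g g' g'' Y Z L;
               (g \<cdot> f, h', h'') \<in> Tri C; triangle C (g \<cdot> f) h' h'' X Z M\<rbrakk>
                  \<Longrightarrow> \<exists>u \<in> Mor C K M. \<exists>v \<in> Mor C M L.
                        (u, v, ar \<Sigma> f' \<cdot> g'') \<in> Tri C \<and>
                        u \<cdot> f' = h' \<cdot> g \<and> h'' \<cdot> u = f'' \<and>
                        v \<cdot> h' = g' \<and> g'' \<cdot> v = ar \<Sigma> f \<cdot> h''"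

definition exact_triangle ::
  "('o, 'm, 'z) triangulated_category_scheme \<Rightarrow> 'o \<Rightarrow> 'o \<Rightarrow> 'o \<Rightarrow> bool" where
  "exact_triangle C X Y Z \<longleftrightarrow> (\<exists>f g h. (f, g, h) \<in> Tri C \<and> triangle C f g h X Y Z)"

text \<open>\<open>shift C n X\<close> is \<open>\<Sigma>\<^sup>n X\<close>.\<close>

definition shift ::
  "('o, 'm, 'z) triangulated_category_scheme \<Rightarrow> int \<Rightarrow> 'o \<Rightarrow> 'o" where
  "shift C n X =
     (if n \<ge> 0 then (ob (susp C) ^^ nat n) X
      else (inv_into (Obj C) (ob (susp C)) ^^ nat (- n)) X)"

text \<open>
  An exact functor commutes with the suspensions up to a natural isomorphism, by means of
  which it takes exact triangles to exact triangles.
\<close>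

definition exact_functor ::
  "('o1, 'm1, 'z1) triangulated_category_scheme \<Rightarrow> ('o2, 'm2, 'z2) triangulated_category_scheme
    \<Rightarrow> ('o1, 'm1, 'o2, 'm2) functor_data \<Rightarrow> bool" where
  "exact_functor C D F \<longleftrightarrow>
     additive_functor C D F \<and>
     (\<exists>\<phi>. natural_transformation C D (F \<circ>\<^sub>F susp C) (susp D \<circ>\<^sub>F F) \<phi> \<and>
          (\<forall>X \<in> Obj C. isomorphism D (\<phi> X) (ob F (ob (susp C) X)) (ob (susp D) (ob F X))) \<and>
          (\<forall>f g h. (f, g, h) \<in> Tri C \<longrightarrow>
             (ar F f, ar F g, \<phi> (Dom C f) \<cdot>\<^bsub>D\<^esub> ar F h) \<in> Tri D))"

text \<open>Triangulated categories with small coproducts; Hom-sets are small as usual.\<close>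

definition triangulated_with_coproducts ::
  "'k rel \<Rightarrow> ('o, 'm, 'z) triangulated_category_scheme \<Rightarrow> bool" where
  "triangulated_with_coproducts \<kappa> C \<longleftrightarrow>
     triangulated_category C \<and> locally_small \<kappa> C \<and> has_coproducts \<kappa> C"

section \<open>Compact objects and generation\<close>

text \<open>
  \<open>E\<close> is compact if for every small family \<open>X\<close> the canonical homomorphism from the direct sum
  of the groups \<open>Hom(E, X\<^sub>i)\<close> to \<open>Hom(E, P)\<close>, where \<open>P\<close> is the coproduct of \<open>X\<close>, is an
  isomorphism.  The product below is a finite sum of morphisms, as the groups are written
  multiplicatively.
\<close>

definition compact_object ::
  "'k rel \<Rightarrow> ('o, 'm, 'z) additive_category_scheme \<Rightarrow> 'o \<Rightarrow> bool" where
  "compact_object \<kappa> C E \<longleftrightarrow>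
     E \<in> Obj C \<and>
     (\<forall>(I :: 'k set) X P \<iota>.
        |I| <o \<kappa> \<and> (\<forall>i \<in> I. X i \<in> Obj C) \<and> is_coproduct C I X P \<iota> \<longrightarrow>
        (\<lambda>f. finprod (Hom_group C E P) (\<lambda>i. \<iota> i \<cdot>\<^bsub>C\<^esub> f i) {i \<in> I. f i \<noteq> zero_arr C E (X i)})
          \<in> iso (sum_group I (\<lambda>i. Hom_group C E (X i))) (Hom_group C E P))"

definition compact_generator ::
  "'k rel \<Rightarrow> ('o, 'm, 'z) triangulated_category_scheme \<Rightarrow> 'o \<Rightarrow> bool" where
  "compact_generator \<kappa> C G \<longleftrightarrow>
     compact_object \<kappa> C G \<and>
     (\<forall>X \<in> Obj C. (\<forall>n. Mor C (shift C n G) X = {zero_arr C (shift C n G) X}) \<longrightarrow> zero_object C X)"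

text \<open>Full subcategories are given by their sets of objects.\<close>

definition star ::
  "('o, 'm, 'z) triangulated_category_scheme \<Rightarrow> 'o set \<Rightarrow> 'o set \<Rightarrow> 'o set" where
  "star C \<A> \<B> = {X \<in> Obj C. \<exists>A \<in> \<A>. \<exists>B \<in> \<B>. exact_triangle C A X B}"

definition smd :: "('o, 'm, 'z) additive_category_scheme \<Rightarrow> 'o set \<Rightarrow> 'o set" where
  "smd C \<A> = {X \<in> Obj C. \<exists>Y \<in> Obj C. \<exists>P \<in> \<A>. \<exists>\<iota>X \<iota>Y \<pi>X \<pi>Y. is_biproduct C X Y P \<iota>X \<iota>Y \<pi>X \<pi>Y}"

definition closed_under_coproducts ::
  "'k rel \<Rightarrow> ('o, 'm, 'z) category_scheme \<Rightarrow> 'o set \<Rightarrow> bool" where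
  "closed_under_coproducts \<kappa> C \<S> \<longleftrightarrow>
     (\<forall>(I :: 'k set) X P \<iota>.
        |I| <o \<kappa> \<and> (\<forall>i \<in> I. X i \<in> \<S>) \<and> is_coproduct C I X P \<iota> \<longrightarrow> P \<in> \<S>)"

definition Coprod ::
  "'k rel \<Rightarrow> ('o, 'm, 'z) triangulated_category_scheme \<Rightarrow> 'o set \<Rightarrow> 'o set" where
  "Coprod \<kappa> C \<G> =
     \<Inter> {\<S>. \<S> \<subseteq> Obj C \<and> closed_under_coproducts \<kappa> C \<S> \<and> star C \<S> \<S> \<subseteq> \<S> \<and> \<G> \<subseteq> \<S>}"

text \<open>
  \<open>G[A, B]\<close>, with the interval given as a set of integers: \<open>{A..B}\<close> for finite \<open>A, B\<close>, and
  \<open>{..B}\<close> for \<open>A = -\<infinity>\<close>.  Note the sign: the shifts involved are \<open>\<Sigma>\<^sup>-\<^sup>i G\<close>.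
\<close>

definition shifts ::
  "('o, 'm, 'z) triangulated_category_scheme \<Rightarrow> 'o \<Rightarrow> int set \<Rightarrow> 'o set" where
  "shifts C G J = {shift C (- i) G | i. i \<in> J}"

definition gen_closure ::
  "'k rel \<Rightarrow> ('o, 'm, 'z) triangulated_category_scheme \<Rightarrow> 'o \<Rightarrow> int set \<Rightarrow> 'o set" where
  "gen_closure \<kappa> C G J = smd C (Coprod \<kappa> C (shifts C G J))"

section \<open>t-structures\<close>

record 'o t_structure =
  aisle :: "'o set"
  coaisle :: "'o set"

definition le_part ::
  "('o, 'm, 'z) triangulated_category_scheme \<Rightarrow> 'o t_structure \<Rightarrow> int \<Rightarrow> 'o set" where
  "le_part C t n = shift C (- n) ` aisle t"

definition ge_part ::
  "('o, 'm, 'z) triangulated_category_scheme \<Rightarrow> 'o t_structure \<Rightarrow> int \<Rightarrow> 'o set" where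
  "ge_part C t n = shift C (- n) ` coaisle t"

definition iso_closed :: "('o, 'm, 'z) category_scheme \<Rightarrow> 'o set \<Rightarrow> bool" where
  "iso_closed C \<A> \<longleftrightarrow> (\<forall>X \<in> \<A>. \<forall>Y \<in> Obj C. (\<exists>f. isomorphism C f X Y) \<longrightarrow> Y \<in> \<A>)"

definition is_t_structure ::
  "('o, 'm, 'z) triangulated_category_scheme \<Rightarrow> 'o t_structure \<Rightarrow> bool" where
  "is_t_structure C t \<longleftrightarrow>
     aisle t \<subseteq> Obj C \<and> coaisle t \<subseteq> Obj C \<and> iso_closed C (aisle t) \<and> iso_closed C (coaisle t) \<and>
     le_part C t (-1) \<subseteq> le_part C t 0 \<and> ge_part C t 1 \<subseteq> ge_part C t 0 \<and>
     (\<forall>X \<in> le_part C t 0. \<forall>Y \<in> ge_part C t 1. Mor C X Y = {zero_arr C X Y}) \<and>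
     (\<forall>X \<in> Obj C. \<exists>A \<in> le_part C t 0. \<exists>B \<in> ge_part C t 1. exact_triangle C A X B)"

definition equivalent_t_structures ::
  "('o, 'm, 'z) triangulated_category_scheme \<Rightarrow> 'o t_structure \<Rightarrow> 'o t_structure \<Rightarrow> bool" where
  "equivalent_t_structures C t1 t2 \<longleftrightarrow>
     (\<exists>A > 0. le_part C t1 (- A) \<subseteq> le_part C t2 0 \<and> le_part C t2 0 \<subseteq> le_part C t1 A)"

definition generated_t_structure ::
  "'k rel \<Rightarrow> ('o, 'm, 'z) triangulated_category_scheme \<Rightarrow> 'o \<Rightarrow> 'o t_structure \<Rightarrow> bool" where
  "generated_t_structure \<kappa> C G t \<longleftrightarrow> is_t_structure C t \<and> aisle t = gen_closure \<kappa> C G {..0}"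

text \<open>Membership in the preferred equivalence class.\<close>

definition preferred_t_structure ::
  "'k rel \<Rightarrow> ('o, 'm, 'z) triangulated_category_scheme \<Rightarrow> 'o t_structure \<Rightarrow> bool" where
  "preferred_t_structure \<kappa> C t \<longleftrightarrow>
     is_t_structure C t \<and>
     (\<exists>G t0. compact_generator \<kappa> C G \<and> generated_t_structure \<kappa> C G t0 \<and>
             equivalent_t_structures C t0 t)"

definition weakly_approximable ::
  "'k rel \<Rightarrow> ('o, 'm, 'z) triangulated_category_scheme \<Rightarrow> bool" where
  "weakly_approximable \<kappa> C \<longleftrightarrow>
     (\<exists>G t. \<exists>A > 0. compact_generator \<kappa> C G \<and> is_t_structure C t \<and>
        shift C A G \<in> le_part C t 0 \<and>
        (\<forall>X \<in> le_part C t 0. Mor C (shift C (- A) G) X = {zero_arr C (shift C (- A) G) X}) \<and>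
        (\<forall>X \<in> le_part C t 0. \<exists>E \<in> gen_closure \<kappa> C G {- A..A}. \<exists>D \<in> le_part C t (-1).
           exact_triangle C E X D))"

definition plus_part ::
  "('o, 'm, 'z) triangulated_category_scheme \<Rightarrow> 'o t_structure \<Rightarrow> 'o set" where
  "plus_part C t = (\<Union>m \<in> {0<..}. ge_part C t (- m))"

definition minus_part ::
  "('o, 'm, 'z) triangulated_category_scheme \<Rightarrow> 'o t_structure \<Rightarrow> 'o set" where
  "minus_part C t = (\<Union>m \<in> {0<..}. le_part C t m)"

definition bounded_part ::
  "('o, 'm, 'z) triangulated_category_scheme \<Rightarrow> 'o t_structure \<Rightarrow> 'o set" where
  "bounded_part C t = plus_part C t \<inter> minus_part C t"

definition minus_c_part ::
  "'k rel \<Rightarrow> ('o, 'm, 'z) triangulated_category_scheme \<Rightarrow> 'o t_structure \<Rightarrow> 'o set" where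
  "minus_c_part \<kappa> C t =
     {X \<in> Obj C. \<forall>m > 0. \<exists>E E'. compact_object \<kappa> C E \<and> E' \<in> le_part C t (- m) \<and>
                   exact_triangle C E X E'}"

definition bounded_c_part ::
  "'k rel \<Rightarrow> ('o, 'm, 'z) triangulated_category_scheme \<Rightarrow> 'o t_structure \<Rightarrow> 'o set" where
  "bounded_c_part \<kappa> C t = minus_c_part \<kappa> C t \<inter> bounded_part C t"

section \<open>Recollements\<close>

text \<open>
  A recollement of \<open>D\<close> relative to \<open>DF\<close> and \<open>DU\<close>; the functors are written
  \<open>i_up = i\<^sup>*\<close>, \<open>i_low = i\<^sub>*\<close>, \<open>i_shr = i\<^sup>!\<close>, \<open>j_shr = j\<^sub>!\<close>, \<open>j_up = j\<^sup>*\<close>, \<open>j_low = j\<^sub>*\<close>.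
\<close>

definition recollement ::
  "('of, 'mf, 'zf) triangulated_category_scheme \<Rightarrow> ('o, 'm, 'z) triangulated_category_scheme
    \<Rightarrow> ('ou, 'mu, 'zu) triangulated_category_scheme
    \<Rightarrow> ('o, 'm, 'of, 'mf) functor_data \<Rightarrow> ('of, 'mf, 'o, 'm) functor_data
    \<Rightarrow> ('o, 'm, 'of, 'mf) functor_data
    \<Rightarrow> ('ou, 'mu, 'o, 'm) functor_data \<Rightarrow> ('o, 'm, 'ou, 'mu) functor_data
    \<Rightarrow> ('ou, 'mu, 'o, 'm) functor_data \<Rightarrow> bool" where
  "recollement DF D DU i_up i_low i_shr j_shr j_up j_low \<longleftrightarrow>
     exact_functor D DF i_up \<and> exact_functor DF D i_low \<and> exact_functor D DF i_shr \<and>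
     exact_functor DU D j_shr \<and> exact_functor D DU j_up \<and> exact_functor DU D j_low \<and>
     (\<forall>Y \<in> Obj DF. zero_object DU (ob j_up (ob i_low Y))) \<and>
     fully_faithful DF D i_low \<and> fully_faithful DU D j_shr \<and> fully_faithful DU D j_low \<and>
     (\<exists>\<eta>\<^sub>1 \<epsilon>\<^sub>1 \<eta>\<^sub>2 \<epsilon>\<^sub>2 \<eta>\<^sub>3 \<epsilon>\<^sub>3 \<eta>\<^sub>4 \<epsilon>\<^sub>4.
        adjunction D DF i_up i_low \<eta>\<^sub>1 \<epsilon>\<^sub>1 \<and> adjunction DF D i_low i_shr \<eta>\<^sub>2 \<epsilon>\<^sub>2 \<and>
        adjunction DU D j_shr j_up \<eta>\<^sub>3 \<epsilon>\<^sub>3 \<and> adjunction D DU j_up j_low \<eta>\<^sub>4 \<epsilon>\<^sub>4 \<and>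
        (\<exists>\<delta>. natural_transformation D D (i_low \<circ>\<^sub>F i_up) (susp D \<circ>\<^sub>F (j_shr \<circ>\<^sub>F j_up)) \<delta> \<and>
             (\<forall>X \<in> Obj D. (\<epsilon>\<^sub>3 X, \<eta>\<^sub>1 X, \<delta> X) \<in> Tri D)) \<and>
        (\<exists>\<delta>. natural_transformation D D (j_low \<circ>\<^sub>F j_up) (susp D \<circ>\<^sub>F (i_low \<circ>\<^sub>F i_shr)) \<delta> \<and>
             (\<forall>X \<in> Obj D. (\<epsilon>\<^sub>2 X, \<eta>\<^sub>4 X, \<delta> X) \<in> Tri D)))"

end

theory Submission
  imports Defs
begin

text \<open>
  Everything reduces to how the six functors act on the aisles and on compact objects, and this is
  controlled by one fact: a thick subcategory containing a compact generator contains all compact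
  objects.  A coproduct-preserving exact functor that sends compact objects into \<open>D\<^sup>-\<close> sends
  \<open>D\<^sup>\<le>\<^sup>0\<close> into some \<open>D\<^sup>\<le>\<^sup>n\<close>, because the aisles are generated by a compact object;
  its right adjoint then preserves \<open>D\<^sup>+\<close>.  Since \<open>Hom(\<Sigma>\<^sup>-\<^sup>n H, H) = 0\<close> for large \<open>n\<close> and a
  suitable generator \<open>H\<close>, both in \<open>D\<close> and in \<open>D\<^sub>U\<close>, the subcategories \<open>D\<^sup>-\<^sub>c\<close> and
  \<open>(D\<^sub>U)\<^sup>-\<^sub>c\<close> are thick.  As \<open>i\<^sup>*\<close> and \<open>j\<^sub>!\<close> preserve compact objects, the hypothesis on
  \<open>j\<^sup>*G\<close> gives \<open>j\<^sup>*K \<in> (D\<^sub>U)\<^sup>-\<^sub>c\<close> for all compact \<open>K\<close> and, through the triangle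
  \<open>j\<^sub>!j\<^sup>*G \<rightarrow> G \<rightarrow> i\<^sub>*i\<^sup>*G\<close>, also \<open>i\<^sub>*K \<in> D\<^sup>-\<^sub>c\<close> for all compact \<open>K\<close> of \<open>D\<^sub>F\<close>.  Now
  \<open>i\<^sup>*, j\<^sup>*, i\<^sub>*, j\<^sub>!\<close> all preserve \<open>D\<^sup>-\<^sub>c\<close>, and \<open>i\<^sub>*, j\<^sub>*, i\<^sup>!, j\<^sup>*\<close> all preserve \<open>D\<^sup>+\<close>.
\<close>

section \<open>Calculus of morphisms\<close>

text \<open>The obstacle is that \<open>j_up\<close> and \<open>i_low\<close> need not preserve
  compact objects. Applied to an approximating triangle E -> X -> E', the functors
  \<open>i_up\<close> and \<open>j_shr\<close> return such a triangle, but \<open>j_up\<close> and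
  \<open>i_low\<close> send E only into the class \<open>minus_c_part\<close>, and its image must be
  approximated afresh. Splicing two approximations requires that a compact K has no maps into
  \<Sigma>a' once a' lies deep enough in the aisle; the bound on Hom(\<Sigma>^-n H, H) provides
  this. Retracts are the second difficulty: a generator reaches the other compact objects only with
  the help of direct summands, and an approximation of W does not directly give one of a summand of
  W. That a thick class containing a generator contains every compact K is shown without quotient
  categories: a tower K -> X_1 -> X_2 -> ... kills the maps from the generator, compactness makes
  some K -> X_n zero, so K is a summand of its fibre, and every map from a compact object to this
  fibre factors through a compact member of the thick class.\<close>

context category
begin

lemma Mor_Obj: "f \<in> Mor C X Y \<Longrightarrow> X \<in> Obj C" "f \<in> Mor C X Y \<Longrightarrow> Y \<in> Obj C"
  using Dom_Obj Cod_Obj by (auto simp: Mor_def)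

lemma comp_arr:
  assumes "f \<in> Arr C" "g \<in> Arr C" "Dom C g = Cod C f"
  shows "g \<cdot> f \<in> Arr C" "Dom C (g \<cdot> f) = Dom C f" "Cod C (g \<cdot> f) = Cod C g"
  using comp_Mor[of f "Dom C f" "Cod C f" g "Cod C g"] assms by (auto simp: Mor_def)

lemma ident_arr:
  assumes "X \<in> Obj C"
  shows "ident C X \<in> Arr C" "Dom C (ident C X) = X" "Cod C (ident C X) = X"
  using ident_Mor[OF assms] by (auto simp: Mor_def)

lemma comp_ident_arr: "\<lbrakk>f \<in> Arr C; Dom C f = X\<rbrakk> \<Longrightarrow> f \<cdot> ident C X = f"
  using comp_ident[of f X "Cod C f"] by (auto simp: Mor_def)

lemma ident_comp_arr: "\<lbrakk>f \<in> Arr C; Cod C f = X\<rbrakk> \<Longrightarrow> ident C X \<cdot> f = f"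
  using ident_comp[of f "Dom C f" X] by (auto simp: Mor_def)

lemma assoc_arr:
  "\<lbrakk>f \<in> Arr C; g \<in> Arr C; h \<in> Arr C; Dom C g = Cod C f; Dom C h = Cod C g\<rbrakk>
   \<Longrightarrow> (h \<cdot> g) \<cdot> f = h \<cdot> (g \<cdot> f)"
  by (rule comp_assoc[of f "Dom C f" "Cod C f" g "Cod C g" h "Cod C h"]) (auto simp: Mor_def)

lemmas arr_simps = Dom_Obj Cod_Obj comp_arr ident_arr comp_ident_arr ident_comp_arr assoc_arr

lemma isomorphism_sym:
  assumes "isomorphism C f X Y"
  obtains g where "isomorphism C g Y X" "g \<cdot> f = ident C X" "f \<cdot> g = ident C Y"
  using assms unfolding isomorphism_def by blast

lemma isomorphism_ident: "X \<in> Obj C \<Longrightarrow> isomorphism C (ident C X) X X"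
  unfolding isomorphism_def using ident_Mor ident_comp by blast

lemma isomorphism_comp:
  assumes "isomorphism C f X Y" "isomorphism C g Y Z"
  shows "isomorphism C (g \<cdot> f) X Z"
proof -
  obtain f' where f: "f \<in> Mor C X Y" "f' \<in> Mor C Y X" "f' \<cdot> f = ident C X" "f \<cdot> f' = ident C Y"
    using assms(1) by (auto simp: isomorphism_def)
  obtain g' where g: "g \<in> Mor C Y Z" "g' \<in> Mor C Z Y" "g' \<cdot> g = ident C Y" "g \<cdot> g' = ident C Z"
    using assms(2) by (auto simp: isomorphism_def)
  have "(f' \<cdot> g') \<cdot> (g \<cdot> f) = f' \<cdot> ((g' \<cdot> g) \<cdot> f)" "(g \<cdot> f) \<cdot> (f' \<cdot> g') = g \<cdot> ((f \<cdot> f') \<cdot> g')"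
    using f(1,2) g(1,2) by (auto simp: Mor_def arr_simps)
  then have "(f' \<cdot> g') \<cdot> (g \<cdot> f) = ident C X" "(g \<cdot> f) \<cdot> (f' \<cdot> g') = ident C Z"
    using f g ident_comp[OF f(1)] ident_comp[OF g(2)] by (simp_all)
  then show ?thesis
    unfolding isomorphism_def using comp_Mor[OF f(1) g(1)] comp_Mor[OF g(2) f(2)] by blast
qed

end

definition isomorphic :: "('o, 'm, 'z) category_scheme \<Rightarrow> 'o \<Rightarrow> 'o \<Rightarrow> bool" where
  "isomorphic C X Y \<longleftrightarrow> (\<exists>f. isomorphism C f X Y)"

text \<open>Summands enter through their split inclusions alone; a complement is produced by
  \<open>retract_complement\<close> where one is needed.\<close>

definition retract :: "('o, 'm, 'z) category_scheme \<Rightarrow> 'o \<Rightarrow> 'o \<Rightarrow> bool" where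
  "retract C X Y \<longleftrightarrow> (\<exists>s \<in> Mor C X Y. \<exists>r \<in> Mor C Y X. r \<cdot>\<^bsub>C\<^esub> s = ident C X)"

context category
begin

lemma isomorphic_Obj: "isomorphic C X Y \<Longrightarrow> X \<in> Obj C" "isomorphic C X Y \<Longrightarrow> Y \<in> Obj C"
  using Mor_Obj by (auto simp: isomorphic_def isomorphism_def)

lemma isomorphic_refl: "X \<in> Obj C \<Longrightarrow> isomorphic C X X"
  unfolding isomorphic_def using isomorphism_ident by blast

lemma isomorphic_sym: "isomorphic C X Y \<Longrightarrow> isomorphic C Y X"
  unfolding isomorphic_def by (meson isomorphism_sym)

lemma isomorphic_trans: "\<lbrakk>isomorphic C X Y; isomorphic C Y Z\<rbrakk> \<Longrightarrow> isomorphic C X Z"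
  unfolding isomorphic_def using isomorphism_comp by blast

lemma isomorphic_retract: "isomorphic C X Y \<Longrightarrow> retract C X Y"
  unfolding isomorphic_def isomorphism_def retract_def by blast

lemma coproduct_Mor: "\<lbrakk>is_coproduct C I X P \<iota>; i \<in> I\<rbrakk> \<Longrightarrow> \<iota> i \<in> Mor C (X i) P"
  and coproduct_Obj: "is_coproduct C I X P \<iota> \<Longrightarrow> P \<in> Obj C"
  by (auto simp: is_coproduct_def)

lemma coproduct_desc:
  assumes "is_coproduct C I X P \<iota>" "Y \<in> Obj C" "\<forall>i \<in> I. f i \<in> Mor C (X i) Y"
  shows "\<exists>h \<in> Mor C P Y. \<forall>i \<in> I. h \<cdot> \<iota> i = f i"
  using assms unfolding is_coproduct_def by blast

lemma coproduct_ext: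
  assumes "is_coproduct C I X P \<iota>" "g \<in> Mor C P Y" "h \<in> Mor C P Y"
    "\<And>i. i \<in> I \<Longrightarrow> g \<cdot> \<iota> i = h \<cdot> \<iota> i"
  shows "g = h"
proof -
  have "\<forall>i\<in>I. h \<cdot> \<iota> i \<in> Mor C (X i) Y"
    using comp_Mor[OF coproduct_Mor[OF assms(1)] assms(3)] by simp
  then have "\<exists>!h'. h' \<in> Mor C P Y \<and> (\<forall>i\<in>I. h' \<cdot> \<iota> i = h \<cdot> \<iota> i)"
    using assms(1) Mor_Obj(2)[OF assms(3)] unfolding is_coproduct_def by simp
  moreover have "\<forall>i\<in>I. g \<cdot> \<iota> i = h \<cdot> \<iota> i"
    using assms(4) by simp
  ultimately show ?thesis
    using assms(2,3) by (elim ex1E) metis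
qed

end

section \<open>Additive categories\<close>

text \<open>Phrased as in the definitions of the statement. The equation also places both objects in
  \<open>Obj C\<close>, because the zero arrow must then lie in \<open>Mor C X Y\<close>
  (\<open>orth_Obj\<close>).\<close>

definition orth :: "('o, 'm, 'z) additive_category_scheme \<Rightarrow> 'o \<Rightarrow> 'o \<Rightarrow> bool" where
  "orth C X Y \<longleftrightarrow> Mor C X Y = {zero_arr C X Y}"

definition diff :: "('o, 'm, 'z) additive_category_scheme \<Rightarrow> 'm \<Rightarrow> 'm \<Rightarrow> 'm" where
  "diff C f g = plus C f (neg C g)"

context additive_category
begin

lemma zero_Mor: "\<lbrakk>X \<in> Obj C; Y \<in> Obj C\<rbrakk> \<Longrightarrow> zero_arr C X Y \<in> Mor C X Y"
  using comm_group.axioms(2)[OF Hom_comm_group, of X Y] group.is_monoid monoid.one_closed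
  by (fastforce simp: Hom_group_def)

lemma plus_Mor: "\<lbrakk>f \<in> Mor C X Y; g \<in> Mor C X Y\<rbrakk> \<Longrightarrow> f \<boxplus> g \<in> Mor C X Y"
  using comm_group.axioms(2)[OF Hom_comm_group, of X Y] group.is_monoid monoid.m_closed Mor_Obj
  by (fastforce simp: Hom_group_def)

lemma neg_Mor: "f \<in> Mor C X Y \<Longrightarrow> neg C f \<in> Mor C X Y"
  using comm_group.axioms(2)[OF Hom_comm_group, of X Y] group.inv_closed[of "Hom_group C X Y" f] Mor_Obj
  by (auto simp: neg_def Hom_group_def Mor_def)

lemma diff_Mor: "\<lbrakk>f \<in> Mor C X Y; g \<in> Mor C X Y\<rbrakk> \<Longrightarrow> diff C f g \<in> Mor C X Y"
  by (simp add: diff_def plus_Mor neg_Mor)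

lemma zero_arr_arr:
  assumes "X \<in> Obj C" "Y \<in> Obj C"
  shows "zero_arr C X Y \<in> Arr C" "Dom C (zero_arr C X Y) = X" "Cod C (zero_arr C X Y) = Y"
  using zero_Mor[OF assms] by (auto simp: Mor_def)

lemma plus_arr:
  assumes "f \<in> Arr C" "g \<in> Arr C" "Dom C g = Dom C f" "Cod C g = Cod C f"
  shows "f \<boxplus> g \<in> Arr C" "Dom C (f \<boxplus> g) = Dom C f" "Cod C (f \<boxplus> g) = Cod C f"
  using plus_Mor[of f "Dom C f" "Cod C f" g] assms by (auto simp: Mor_def)

lemma neg_arr:
  assumes "f \<in> Arr C"
  shows "neg C f \<in> Arr C" "Dom C (neg C f) = Dom C f" "Cod C (neg C f) = Cod C f"
  using neg_Mor[of f "Dom C f" "Cod C f"] assms by (auto simp: Mor_def)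

lemma diff_arr:
  assumes "f \<in> Arr C" "g \<in> Arr C" "Dom C g = Dom C f" "Cod C g = Cod C f"
  shows "diff C f g \<in> Arr C" "Dom C (diff C f g) = Dom C f" "Cod C (diff C f g) = Cod C f"
  using diff_Mor[of f "Dom C f" "Cod C f" g] assms by (auto simp: Mor_def)

lemma
  assumes "f \<in> Mor C X Y"
  shows plus_zero: "f \<boxplus> zero_arr C X Y = f" and zero_plus: "zero_arr C X Y \<boxplus> f = f"
    and plus_neg: "f \<boxplus> neg C f = zero_arr C X Y" and neg_plus: "neg C f \<boxplus> f = zero_arr C X Y"
proof -
  have X: "X \<in> Obj C" "Y \<in> Obj C"
    using assms Mor_Obj by blast+
  interpret comm_group "Hom_group C X Y"
    by (rule Hom_comm_group[OF X])
  have f: "f \<in> carrier (Hom_group C X Y)" "Dom C f = X" "Cod C f = Y"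
    using assms by (auto simp: Hom_group_def Mor_def)
  then show "f \<boxplus> zero_arr C X Y = f" "zero_arr C X Y \<boxplus> f = f"
    "f \<boxplus> neg C f = zero_arr C X Y" "neg C f \<boxplus> f = zero_arr C X Y"
    using r_one[of f] l_one[of f] r_inv[of f] l_inv[of f] by (auto simp: neg_def Hom_group_def)
qed

lemma plus_assoc:
  assumes "f \<in> Mor C X Y" "g \<in> Mor C X Y" "h \<in> Mor C X Y"
  shows "(f \<boxplus> g) \<boxplus> h = f \<boxplus> (g \<boxplus> h)"
proof -
  have X: "X \<in> Obj C" "Y \<in> Obj C"
    using assms Mor_Obj by blast+
  interpret comm_group "Hom_group C X Y"
    by (rule Hom_comm_group[OF X])
  show ?thesis
    using m_assoc[of f g h] assms by (simp add: Hom_group_def)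
qed

lemma plus_comm:
  assumes "f \<in> Mor C X Y" "g \<in> Mor C X Y"
  shows "f \<boxplus> g = g \<boxplus> f"
proof -
  have X: "X \<in> Obj C" "Y \<in> Obj C"
    using assms Mor_Obj by blast+
  interpret comm_group "Hom_group C X Y"
    by (rule Hom_comm_group[OF X])
  show ?thesis
    using m_comm[of f g] assms by (simp add: Hom_group_def)
qed

lemma neg_unique:
  assumes "f \<in> Mor C X Y" "g \<in> Mor C X Y" "f \<boxplus> g = zero_arr C X Y"
  shows "g = neg C f"
proof -
  have "neg C f \<boxplus> (f \<boxplus> g) = g"
    using plus_assoc[OF neg_Mor[OF assms(1)] assms(1,2)] neg_plus[OF assms(1)] zero_plus[OF assms(2)] by simp
  then show ?thesis
    using assms(3) plus_zero[OF neg_Mor[OF assms(1)]] by simp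
qed

lemma neg_neg: "f \<in> Mor C X Y \<Longrightarrow> neg C (neg C f) = f"
  using neg_unique[OF neg_Mor _ neg_plus] by simp

lemma neg_zero: "\<lbrakk>X \<in> Obj C; Y \<in> Obj C\<rbrakk> \<Longrightarrow> neg C (zero_arr C X Y) = zero_arr C X Y"
  using neg_unique[OF zero_Mor zero_Mor plus_zero[OF zero_Mor]] by simp

lemma diff_self: "f \<in> Mor C X Y \<Longrightarrow> diff C f f = zero_arr C X Y"
  by (simp add: diff_def plus_neg)

lemma diff_zero: "f \<in> Mor C X Y \<Longrightarrow> diff C f (zero_arr C X Y) = f"
  using Mor_Obj[of f X Y] by (simp add: diff_def neg_zero plus_zero)

lemma diff_eq_zero:
  assumes "f \<in> Mor C X Y" "g \<in> Mor C X Y" "diff C f g = zero_arr C X Y"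
  shows "f = g"
proof -
  have "f \<boxplus> neg C g = zero_arr C X Y"
    using assms(3) by (simp add: diff_def)
  then have "neg C g = neg C f"
    by (rule neg_unique[OF assms(1) neg_Mor[OF assms(2)]])
  then show ?thesis
    using neg_neg[OF assms(1)] neg_neg[OF assms(2)] by simp
qed

lemma diff_plus:
  assumes "f \<in> Mor C X Y" "g \<in> Mor C X Y"
  shows "diff C f g \<boxplus> g = f" "g \<boxplus> diff C f g = f"
proof -
  show "diff C f g \<boxplus> g = f"
    unfolding diff_def
    using plus_assoc[OF assms(1) neg_Mor[OF assms(2)] assms(2)] neg_plus[OF assms(2)] plus_zero[OF assms(1)]
    by simp
  then show "g \<boxplus> diff C f g = f"
    using plus_comm[OF diff_Mor[OF assms] assms(2)] by simp
qed

lemma eq_diff: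
  assumes "f \<in> Mor C X Y" "g \<in> Mor C X Y" "h \<in> Mor C X Y" "f \<boxplus> g = h"
  shows "f = diff C h g"
  using plus_assoc[OF assms(1,2) neg_Mor[OF assms(2)]] plus_neg[OF assms(2)] plus_zero[OF assms(1)] assms(4)
  by (simp add: diff_def)

lemma idem_zero:
  assumes "f \<in> Mor C X Y" "f \<boxplus> f = f"
  shows "f = zero_arr C X Y"
  using eq_diff[OF assms(1) assms(1) assms(1) assms(2)] diff_self[OF assms(1)] by simp

lemma comp_zero:
  assumes "g \<in> Arr C" "Dom C g = Y" "X \<in> Obj C"
  shows "g \<cdot> zero_arr C X Y = zero_arr C X (Cod C g)"
proof -
  have Y: "Y \<in> Obj C" and g: "g \<in> Mor C Y (Cod C g)"
    using assms Dom_Obj by (auto simp: Mor_def)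
  let ?z = "zero_arr C X Y"
  have z: "?z \<in> Mor C X Y"
    by (rule zero_Mor[OF assms(3) Y])
  have "(g \<cdot> ?z) \<boxplus> (g \<cdot> ?z) = g \<cdot> ?z"
    using comp_plus[OF z z g] plus_zero[OF z] by simp
  then show ?thesis
    by (rule idem_zero[OF comp_Mor[OF z g]])
qed

lemma zero_comp:
  assumes "f \<in> Arr C" "Cod C f = Y" "Z \<in> Obj C"
  shows "zero_arr C Y Z \<cdot> f = zero_arr C (Dom C f) Z"
proof -
  have Y: "Y \<in> Obj C" and f: "f \<in> Mor C (Dom C f) Y"
    using assms Cod_Obj by (auto simp: Mor_def)
  let ?z = "zero_arr C Y Z"
  have z: "?z \<in> Mor C Y Z"
    by (rule zero_Mor[OF Y assms(3)])
  have "(?z \<cdot> f) \<boxplus> (?z \<cdot> f) = ?z \<cdot> f"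
    using plus_comp[OF f z z] plus_zero[OF z] by simp
  then show ?thesis
    by (rule idem_zero[OF comp_Mor[OF f z]])
qed

lemma comp_neg:
  assumes "f \<in> Arr C" "g \<in> Arr C" "Dom C g = Cod C f"
  shows "g \<cdot> neg C f = neg C (g \<cdot> f)"
proof -
  have fg: "f \<in> Mor C (Dom C f) (Cod C f)" "g \<in> Mor C (Cod C f) (Cod C g)"
    using assms by (auto simp: Mor_def)
  have "(g \<cdot> f) \<boxplus> (g \<cdot> neg C f) = g \<cdot> zero_arr C (Dom C f) (Cod C f)"
    using comp_plus[OF fg(1) neg_Mor[OF fg(1)] fg(2)] plus_neg[OF fg(1)] by simp
  also have "\<dots> = zero_arr C (Dom C f) (Cod C g)"
    using assms by (simp add: comp_zero Dom_Obj)
  finally show ?thesis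
    by (rule neg_unique[OF comp_Mor[OF fg] comp_Mor[OF neg_Mor[OF fg(1)] fg(2)]])
qed

lemma neg_comp:
  assumes "f \<in> Arr C" "g \<in> Arr C" "Dom C g = Cod C f"
  shows "neg C g \<cdot> f = neg C (g \<cdot> f)"
proof -
  have fg: "f \<in> Mor C (Dom C f) (Cod C f)" "g \<in> Mor C (Cod C f) (Cod C g)"
    using assms by (auto simp: Mor_def)
  have "(g \<cdot> f) \<boxplus> (neg C g \<cdot> f) = zero_arr C (Cod C f) (Cod C g) \<cdot> f"
    using plus_comp[OF fg(1,2) neg_Mor[OF fg(2)]] plus_neg[OF fg(2)] by simp
  also have "\<dots> = zero_arr C (Dom C f) (Cod C g)"
    using assms by (simp add: zero_comp Cod_Obj)
  finally show ?thesis
    by (rule neg_unique[OF comp_Mor[OF fg] comp_Mor[OF fg(1) neg_Mor[OF fg(2)]]])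
qed

lemma comp_plus_arr:
  assumes "f \<in> Arr C" "f' \<in> Arr C" "g \<in> Arr C" "Dom C f' = Dom C f" "Cod C f' = Cod C f" "Dom C g = Cod C f"
  shows "g \<cdot> (f \<boxplus> f') = (g \<cdot> f) \<boxplus> (g \<cdot> f')"
  by (rule comp_plus[of f "Dom C f" "Cod C f" f' g "Cod C g"]) (simp_all add: Mor_def assms)

lemma plus_comp_arr:
  assumes "f \<in> Arr C" "g' \<in> Arr C" "g \<in> Arr C" "Dom C g' = Dom C g" "Cod C g' = Cod C g" "Dom C g = Cod C f"
  shows "(g \<boxplus> g') \<cdot> f = (g \<cdot> f) \<boxplus> (g' \<cdot> f)"
  by (rule plus_comp[of f "Dom C f" "Cod C f" g "Cod C g" g']) (simp_all add: Mor_def assms)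

lemma comp_diff:
  assumes "f \<in> Arr C" "f' \<in> Arr C" "g \<in> Arr C" "Dom C f' = Dom C f" "Cod C f' = Cod C f" "Dom C g = Cod C f"
  shows "g \<cdot> diff C f f' = diff C (g \<cdot> f) (g \<cdot> f')"
  using assms by (simp add: diff_def comp_plus_arr neg_arr comp_neg)

lemma diff_comp:
  assumes "f \<in> Arr C" "g' \<in> Arr C" "g \<in> Arr C" "Dom C g' = Dom C g" "Cod C g' = Cod C g" "Dom C g = Cod C f"
  shows "diff C g g' \<cdot> f = diff C (g \<cdot> f) (g' \<cdot> f)"
  using assms by (simp add: diff_def plus_comp_arr neg_arr neg_comp)

lemmas add_simps = arr_simps zero_arr_arr plus_arr neg_arr diff_arr comp_zero zero_comp comp_neg neg_comp
  comp_plus_arr plus_comp_arr comp_diff diff_comp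

lemma orthD: "\<lbrakk>orth C X Y; f \<in> Mor C X Y\<rbrakk> \<Longrightarrow> f = zero_arr C X Y"
  by (simp add: orth_def)

lemma orthI: "\<lbrakk>X \<in> Obj C; Y \<in> Obj C; \<And>f. f \<in> Mor C X Y \<Longrightarrow> f = zero_arr C X Y\<rbrakk> \<Longrightarrow> orth C X Y"
  using zero_Mor by (auto simp: orth_def)

lemma orth_Obj: "orth C X Y \<Longrightarrow> X \<in> Obj C" "orth C X Y \<Longrightarrow> Y \<in> Obj C"
  using Mor_Obj unfolding orth_def by blast+

lemma zero_object_orth:
  assumes "zero_object C Z" "X \<in> Obj C"
  shows "orth C X Z" "orth C Z X"
proof -
  have Z: "Z \<in> Obj C" "\<exists>!f. f \<in> Mor C X Z" "\<exists>!f. f \<in> Mor C Z X"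
    using assms unfolding zero_object_def by auto
  show "orth C X Z"
    by (rule orthI[OF assms(2) Z(1)]) (use Z(2) zero_Mor[OF assms(2) Z(1)] in blast)
  show "orth C Z X"
    by (rule orthI[OF Z(1) assms(2)]) (use Z(3) zero_Mor[OF Z(1) assms(2)] in blast)
qed

lemma zero_objectI:
  assumes "Z \<in> Obj C" "ident C Z = zero_arr C Z Z"
  shows "zero_object C Z"
proof -
  have "f = zero_arr C X Z" if "f \<in> Mor C X Z" for f X
    using ident_comp[OF that] zero_comp[of f Z Z] that assms by (auto simp: Mor_def)
  moreover have "f = zero_arr C Z X" if "f \<in> Mor C Z X" for f X
    using comp_ident[OF that] comp_zero[of f Z Z] that assms by (auto simp: Mor_def)
  ultimately show ?thesis
    unfolding zero_object_def using assms(1) zero_Mor by blast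
qed

lemma zero_object_Obj: "zero_object C Z \<Longrightarrow> Z \<in> Obj C"
  by (simp add: zero_object_def)

lemma orth_self: "orth C Z Z \<Longrightarrow> zero_object C Z"
  using orthD[OF _ ident_Mor] orth_Obj zero_objectI by blast

lemma zero_object_ident: "zero_object C Z \<Longrightarrow> ident C Z = zero_arr C Z Z"
  using orthD[OF zero_object_orth(1) ident_Mor] zero_object_Obj by blast

lemma orth_retract_left:
  assumes "orth C W Y" "retract C X W"
  shows "orth C X Y"
proof -
  obtain s r where sr: "s \<in> Mor C X W" "r \<in> Mor C W X" "r \<cdot> s = ident C X"
    using assms(2) by (auto simp: retract_def)
  show ?thesis
  proof (rule orthI)
    fix f assume f: "f \<in> Mor C X Y"
    have "f \<cdot> r = zero_arr C W Y"
      using orthD[OF assms(1) comp_Mor[OF sr(2) f]] .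
    then have "f \<cdot> (r \<cdot> s) = zero_arr C W Y \<cdot> s"
      using comp_assoc[OF sr(1,2) f] by simp
    then show "f = zero_arr C X Y"
      using sr(1) f sr(3) Mor_Obj(2)[OF f] by (simp add: Mor_def add_simps)
  qed (use sr(1) Mor_Obj orth_Obj[OF assms(1)] in auto)
qed

lemma orth_retract_right:
  assumes "orth C X W" "retract C Y W"
  shows "orth C X Y"
proof -
  obtain s r where sr: "s \<in> Mor C Y W" "r \<in> Mor C W Y" "r \<cdot> s = ident C Y"
    using assms(2) by (auto simp: retract_def)
  show ?thesis
  proof (rule orthI)
    fix f assume f: "f \<in> Mor C X Y"
    have "s \<cdot> f = zero_arr C X W"
      using orthD[OF assms(1) comp_Mor[OF f sr(1)]] .
    then have "(r \<cdot> s) \<cdot> f = r \<cdot> zero_arr C X W"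
      using comp_assoc[OF f sr(1,2)] by simp
    then show "f = zero_arr C X Y"
      using sr(2) f sr(3) Mor_Obj(1)[OF f] by (simp add: Mor_def add_simps)
  qed (use sr(1) Mor_Obj orth_Obj[OF assms(1)] in auto)
qed

lemma zero_retract:
  assumes "zero_object C Z" "X \<in> Obj C"
  shows "retract C Z X"
proof -
  have Z: "Z \<in> Obj C"
    by (rule zero_object_Obj[OF assms(1)])
  have "zero_arr C X Z \<cdot> zero_arr C Z X = ident C Z"
    using Z assms by (simp add: add_simps zero_object_ident)
  then show ?thesis
    unfolding retract_def using zero_Mor Z assms(2) by blast
qed

lemma orth_coproduct:
  assumes "is_coproduct C I X P \<iota>" "\<And>i. i \<in> I \<Longrightarrow> orth C (X i) Y" "Y \<in> Obj C"
  shows "orth C P Y"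
proof (rule orthI)
  fix f assume f: "f \<in> Mor C P Y"
  show "f = zero_arr C P Y"
  proof (rule coproduct_ext[OF assms(1) f zero_Mor[OF coproduct_Obj[OF assms(1)] assms(3)]])
    fix i assume i: "i \<in> I"
    have "f \<cdot> \<iota> i = zero_arr C (X i) Y"
      using orthD[OF assms(2)[OF i] comp_Mor[OF coproduct_Mor[OF assms(1) i] f]] .
    then show "f \<cdot> \<iota> i = zero_arr C P Y \<cdot> \<iota> i"
      using coproduct_Mor[OF assms(1) i] assms(3) by (simp add: Mor_def add_simps)
  qed
qed (use coproduct_Obj assms in auto)

lemma biproduct_zero:
  assumes "X \<in> Obj C" "zero_object C Z"
  shows "is_biproduct C X Z X (ident C X) (zero_arr C Z X) (ident C X) (zero_arr C X Z)"
  unfolding is_biproduct_def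
  using assms ident_Mor[OF assms(1)] zero_object_Obj[OF assms(2)] zero_Mor[of X Z] zero_Mor[of Z X]
    zero_object_ident[OF assms(2)] plus_zero[OF ident_Mor[OF assms(1)]]
  by (simp add: add_simps)

lemma additive_functor_zero:
  assumes F: "additive_functor C D F" and D: "additive_category D" and X: "X \<in> Obj C" "Y \<in> Obj C"
  shows "ar F (zero_arr C X Y) = zero_arr D (ob F X) (ob F Y)"
proof -
  interpret D: additive_category D
    by (rule D)
  let ?z = "zero_arr C X Y"
  have z: "?z \<in> Mor C X Y" "?z \<boxplus> ?z = ?z"
    using zero_Mor[OF X] plus_zero by auto
  have Fz: "ar F ?z \<in> Mor D (ob F X) (ob F Y)"
    using F z(1) by (auto simp: additive_functor_def is_functor_def)
  have "plus D (ar F ?z) (ar F ?z) = ar F ?z"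
    using F z unfolding additive_functor_def by metis
  then show ?thesis
    using D.idem_zero[OF Fz] by simp
qed

end

lemma functor_Obj: "\<lbrakk>is_functor C D F; X \<in> Obj C\<rbrakk> \<Longrightarrow> ob F X \<in> Obj D"
  and functor_Mor: "\<lbrakk>is_functor C D F; f \<in> Mor C X Y\<rbrakk> \<Longrightarrow> ar F f \<in> Mor D (ob F X) (ob F Y)"
  and functor_ident: "\<lbrakk>is_functor C D F; X \<in> Obj C\<rbrakk> \<Longrightarrow> ar F (ident C X) = ident D (ob F X)"
  and functor_comp: "\<lbrakk>is_functor C D F; f \<in> Mor C X Y; g \<in> Mor C Y Z\<rbrakk>
    \<Longrightarrow> ar F (g \<cdot>\<^bsub>C\<^esub> f) = ar F g \<cdot>\<^bsub>D\<^esub> ar F f"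
  by (auto simp: is_functor_def)

lemma functor_retract:
  assumes F: "is_functor C D F" and "category C" and "retract C X Y"
  shows "retract D (ob F X) (ob F Y)"
proof -
  obtain s r where sr: "s \<in> Mor C X Y" "r \<in> Mor C Y X" "r \<cdot>\<^bsub>C\<^esub> s = ident C X"
    using assms(3) by (auto simp: retract_def)
  then have "ar F r \<cdot>\<^bsub>D\<^esub> ar F s = ident D (ob F X)"
    using functor_comp[OF F sr(1,2)] functor_ident[OF F] category.Mor_Obj(1)[OF assms(2) sr(1)] by simp
  then show ?thesis
    unfolding retract_def using functor_Mor[OF F] sr by blast
qed

lemma functor_isomorphic:
  assumes F: "is_functor C D F" and "category C" and "isomorphic C X Y"
  shows "isomorphic D (ob F X) (ob F Y)"
proof -
  obtain f g where fg: "f \<in> Mor C X Y" "g \<in> Mor C Y X" "g \<cdot>\<^bsub>C\<^esub> f = ident C X" "f \<cdot>\<^bsub>C\<^esub> g = ident C Y"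
    using assms(3) by (auto simp: isomorphic_def isomorphism_def)
  have "ar F g \<cdot>\<^bsub>D\<^esub> ar F f = ident D (ob F X)" "ar F f \<cdot>\<^bsub>D\<^esub> ar F g = ident D (ob F Y)"
    using functor_comp[OF F fg(1,2)] functor_comp[OF F fg(2,1)] functor_ident[OF F] fg(3,4)
      category.Mor_Obj[OF assms(2) fg(1)] by simp_all
  then show ?thesis
    unfolding isomorphic_def isomorphism_def using functor_Mor[OF F] fg by blast
qed

section \<open>Exact triangles\<close>

definition tri ::
  "('o, 'm, 'z) triangulated_category_scheme \<Rightarrow> 'm \<Rightarrow> 'm \<Rightarrow> 'm \<Rightarrow> 'o \<Rightarrow> 'o \<Rightarrow> 'o \<Rightarrow> bool" where
  "tri C f g h X Y Z \<longleftrightarrow> (f, g, h) \<in> Tri C \<and> triangle C f g h X Y Z"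

lemma exact_triangle_tri: "exact_triangle C X Y Z \<longleftrightarrow> (\<exists>f g h. tri C f g h X Y Z)"
  by (simp add: exact_triangle_def tri_def)

lemma tri_exact: "tri C f g h X Y Z \<Longrightarrow> exact_triangle C X Y Z"
  unfolding exact_triangle_tri by blast

context triangulated_category
begin

section \<open>The suspension, its integral powers, and orthogonality\<close>

lemma susp_functor: "is_functor C C \<Sigma>"
  using susp_additive by (simp add: additive_functor_def)

lemma susp_Obj: "X \<in> Obj C \<Longrightarrow> ob \<Sigma> X \<in> Obj C"
  by (rule functor_Obj[OF susp_functor])

lemma susp_Mor: "f \<in> Mor C X Y \<Longrightarrow> ar \<Sigma> f \<in> Mor C (ob \<Sigma> X) (ob \<Sigma> Y)"
  by (rule functor_Mor[OF susp_functor])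

lemma susp_arr:
  assumes "f \<in> Arr C"
  shows "ar \<Sigma> f \<in> Arr C" "Dom C (ar \<Sigma> f) = ob \<Sigma> (Dom C f)" "Cod C (ar \<Sigma> f) = ob \<Sigma> (Cod C f)"
  using susp_Mor[of f "Dom C f" "Cod C f"] assms by (auto simp: Mor_def)

lemma susp_ident: "X \<in> Obj C \<Longrightarrow> ar \<Sigma> (ident C X) = ident C (ob \<Sigma> X)"
  by (rule functor_ident[OF susp_functor])

lemma susp_comp: "\<lbrakk>f \<in> Arr C; g \<in> Arr C; Dom C g = Cod C f\<rbrakk> \<Longrightarrow> ar \<Sigma> (g \<cdot> f) = ar \<Sigma> g \<cdot> ar \<Sigma> f"
  by (rule functor_comp[OF susp_functor, of f "Dom C f" "Cod C f" g "Cod C g"]) (simp_all add: Mor_def)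

lemma susp_plus:
  "\<lbrakk>f \<in> Mor C X Y; g \<in> Mor C X Y\<rbrakk> \<Longrightarrow> ar \<Sigma> (f \<boxplus> g) = ar \<Sigma> f \<boxplus> ar \<Sigma> g"
  using susp_additive by (simp add: additive_functor_def)

lemma susp_zero:
  "\<lbrakk>X \<in> Obj C; Y \<in> Obj C\<rbrakk> \<Longrightarrow> ar \<Sigma> (zero_arr C X Y) = zero_arr C (ob \<Sigma> X) (ob \<Sigma> Y)"
  by (rule additive_functor_zero[OF susp_additive additive_category_axioms])

lemma susp_neg:
  assumes "f \<in> Arr C"
  shows "ar \<Sigma> (neg C f) = neg C (ar \<Sigma> f)"
proof -
  have f: "f \<in> Mor C (Dom C f) (Cod C f)"
    using assms by (simp add: Mor_def)
  have "ar \<Sigma> f \<boxplus> ar \<Sigma> (neg C f) = zero_arr C (ob \<Sigma> (Dom C f)) (ob \<Sigma> (Cod C f))"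
    using susp_plus[OF f neg_Mor[OF f]] plus_neg[OF f] susp_zero Dom_Obj Cod_Obj assms by simp
  then show ?thesis
    by (rule neg_unique[OF susp_Mor[OF f] susp_Mor[OF neg_Mor[OF f]]])
qed

lemmas tri_simps = add_simps susp_Obj susp_arr susp_ident susp_comp susp_zero susp_neg

lemma susp_inj_Obj: "\<lbrakk>X \<in> Obj C; Y \<in> Obj C; ob \<Sigma> X = ob \<Sigma> Y\<rbrakk> \<Longrightarrow> X = Y"
  using susp_bij_Obj by (auto simp: bij_betw_def inj_on_def)

lemma susp_inj_Arr: "\<lbrakk>f \<in> Arr C; g \<in> Arr C; ar \<Sigma> f = ar \<Sigma> g\<rbrakk> \<Longrightarrow> f = g"
  using susp_bij_Arr by (auto simp: bij_betw_def inj_on_def)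

lemma susp_faithful: "\<lbrakk>ar \<Sigma> f = ar \<Sigma> g; f \<in> Mor C X Y; g \<in> Mor C X' Y'\<rbrakk> \<Longrightarrow> f = g"
  using susp_inj_Arr by (auto simp: Mor_def)

lemma susp_full:
  assumes "f \<in> Mor C (ob \<Sigma> X) (ob \<Sigma> Y)" "X \<in> Obj C" "Y \<in> Obj C"
  obtains f' where "f' \<in> Mor C X Y" "ar \<Sigma> f' = f"
proof -
  have "f \<in> Arr C"
    using assms(1) by (simp add: Mor_def)
  then obtain f' where f': "f' \<in> Arr C" "ar \<Sigma> f' = f"
    using susp_bij_Arr by (metis bij_betw_def imageE)
  then have "ob \<Sigma> (Dom C f') = ob \<Sigma> X" "ob \<Sigma> (Cod C f') = ob \<Sigma> Y"
    using assms(1) susp_arr[of f'] by (auto simp: Mor_def)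
  then have "f' \<in> Mor C X Y"
    using f' assms susp_inj_Obj Dom_Obj Cod_Obj by (auto simp: Mor_def)
  then show ?thesis
    using that f' by blast
qed

lemma shift_0: "shift C 0 X = X"
  by (simp add: shift_def)

lemma shift_1: "shift C 1 X = ob \<Sigma> X"
  by (simp add: shift_def)

lemma desusp:
  assumes "X \<in> Obj C"
  shows "inv_into (Obj C) (ob \<Sigma>) X \<in> Obj C" "ob \<Sigma> (inv_into (Obj C) (ob \<Sigma>) X) = X"
proof -
  have "X \<in> ob \<Sigma> ` Obj C"
    using assms susp_bij_Obj by (simp add: bij_betw_def)
  then show "inv_into (Obj C) (ob \<Sigma>) X \<in> Obj C" "ob \<Sigma> (inv_into (Obj C) (ob \<Sigma>) X) = X"
    by (rule inv_into_into, rule f_inv_into_f)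
qed

lemma shift_Obj:
  assumes "X \<in> Obj C"
  shows "shift C n X \<in> Obj C"
proof -
  have "(ob \<Sigma> ^^ k) X \<in> Obj C" "(inv_into (Obj C) (ob \<Sigma>) ^^ k) X \<in> Obj C" for k
    by (induction k) (simp_all add: assms susp_Obj desusp(1))
  then show ?thesis
    by (simp add: shift_def)
qed

lemma shift_Suc:
  assumes "X \<in> Obj C"
  shows "shift C (n + 1) X = ob \<Sigma> (shift C n X)"
proof (cases "n \<ge> 0")
  case True
  then show ?thesis
    by (simp add: shift_def nat_add_distrib)
next
  case False
  define k where "k = nat (- n - 1)"
  have n: "nat (- n) = Suc k" "nat (- (n + 1)) = k" "n + 1 \<ge> 0 \<Longrightarrow> k = 0"
    using False by (auto simp: k_def)
  have "(inv_into (Obj C) (ob \<Sigma>) ^^ k) X \<in> Obj C"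
    by (induction k) (simp_all add: assms desusp(1))
  then show ?thesis
    using False n desusp by (simp add: shift_def)
qed

lemma shift_shift:
  assumes "X \<in> Obj C"
  shows "shift C m (shift C n X) = shift C (m + n) X"
proof (induction m rule: int_induct[of _ 0])
  case base
  then show ?case
    by (simp add: shift_0)
next
  case (step1 i)
  then show ?case
    using shift_Suc[OF shift_Obj[OF assms], of i n] shift_Suc[OF assms, of "i + n"]
    by (simp add: algebra_simps)
next
  case (step2 i)
  have "ob \<Sigma> (shift C (i - 1) (shift C n X)) = ob \<Sigma> (shift C (i - 1 + n) X)"
    using step2 shift_Suc[OF shift_Obj[OF assms], of "i - 1" n] shift_Suc[OF assms, of "i - 1 + n"]
    by (simp add: algebra_simps)
  then show ?case
    using susp_inj_Obj shift_Obj assms by blast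
qed

lemma susp_shift: "X \<in> Obj C \<Longrightarrow> ob \<Sigma> (shift C n X) = shift C (n + 1) X"
  by (simp add: shift_Suc)

lemma orth_susp:
  assumes "X \<in> Obj C" "Y \<in> Obj C"
  shows "orth C (ob \<Sigma> X) (ob \<Sigma> Y) \<longleftrightarrow> orth C X Y"
proof
  assume o: "orth C (ob \<Sigma> X) (ob \<Sigma> Y)"
  show "orth C X Y"
  proof (rule orthI[OF assms])
    fix f assume f: "f \<in> Mor C X Y"
    have "ar \<Sigma> f = ar \<Sigma> (zero_arr C X Y)"
      using orthD[OF o susp_Mor[OF f]] susp_zero[OF assms] by simp
    then show "f = zero_arr C X Y"
      by (rule susp_faithful[OF _ f zero_Mor[OF assms]])
  qed
next
  assume o: "orth C X Y"
  show "orth C (ob \<Sigma> X) (ob \<Sigma> Y)"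
  proof (rule orthI[OF susp_Obj[OF assms(1)] susp_Obj[OF assms(2)]])
    fix f assume "f \<in> Mor C (ob \<Sigma> X) (ob \<Sigma> Y)"
    then obtain f' where f': "f' \<in> Mor C X Y" "ar \<Sigma> f' = f"
      using susp_full assms by blast
    then show "f = zero_arr C (ob \<Sigma> X) (ob \<Sigma> Y)"
      using orthD[OF o f'(1)] susp_zero[OF assms] by simp
  qed
qed

lemma orth_shift:
  assumes "X \<in> Obj C" "Y \<in> Obj C"
  shows "orth C (shift C n X) (shift C n Y) \<longleftrightarrow> orth C X Y"
proof (induction n rule: int_induct[of _ 0])
  case base
  then show ?case
    by (simp add: shift_0)
next
  case (step1 i)
  then show ?case
    using orth_susp shift_Obj assms by (simp add: shift_Suc)
next
  case (step2 i)
  then show ?case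
    using orth_susp[of "shift C (i - 1) X" "shift C (i - 1) Y"] shift_Obj assms shift_Suc[of X "i - 1"]
      shift_Suc[of Y "i - 1"] by simp
qed

lemma orth_shift_left:
  assumes "X \<in> Obj C" "Y \<in> Obj C"
  shows "orth C (shift C n X) Y \<longleftrightarrow> orth C X (shift C (- n) Y)"
  using orth_shift[OF shift_Obj[OF assms(1)] assms(2), of "- n" n] assms by (simp add: shift_shift shift_0)

lemma zero_susp: "zero_object C Z \<Longrightarrow> zero_object C (ob \<Sigma> Z)"
  using orth_susp zero_object_orth zero_object_Obj orth_self by metis

lemma zero_shift: "zero_object C Z \<Longrightarrow> zero_object C (shift C n Z)"
  using orth_shift zero_object_orth zero_object_Obj orth_self by metis

lemma isomorphic_susp: "isomorphic C X Y \<Longrightarrow> isomorphic C (ob \<Sigma> X) (ob \<Sigma> Y)"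
  by (rule functor_isomorphic[OF susp_functor category_axioms])

section \<open>Cones, rotation, and lifting along exact triangles\<close>

lemma tri_Mor:
  assumes "tri C f g h X Y Z"
  shows "f \<in> Mor C X Y" "g \<in> Mor C Y Z" "h \<in> Mor C Z (ob \<Sigma> X)"
  using assms by (auto simp: tri_def triangle_def)

lemma tri_Obj:
  assumes "tri C f g h X Y Z"
  shows "X \<in> Obj C" "Y \<in> Obj C" "Z \<in> Obj C"
  using tri_Mor[OF assms] Mor_Obj by blast+

lemma exact_Obj:
  assumes "exact_triangle C X Y Z"
  shows "X \<in> Obj C" "Y \<in> Obj C" "Z \<in> Obj C"
  using assms tri_Obj unfolding exact_triangle_tri by blast+

lemma tri_cone:
  assumes "f \<in> Mor C X Y"
  obtains g h Z where "tri C f g h X Y Z"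
proof -
  obtain g h where gh: "(f, g, h) \<in> Tri C"
    using TR1_cone[of f] assms by (auto simp: Mor_def)
  then obtain X' Y' Z where t: "triangle C f g h X' Y' Z"
    using Tri_triangle by blast
  then have "X' = X" "Y' = Y"
    using assms by (auto simp: triangle_def Mor_def)
  then show ?thesis
    using that gh t by (simp add: tri_def)
qed

lemma tri_ident:
  assumes "X \<in> Obj C" "zero_object C Z"
  shows "tri C (ident C X) (zero_arr C X Z) (zero_arr C Z (ob \<Sigma> X)) X X Z"
  using TR1_ident[OF assms] ident_Mor zero_Mor susp_Obj assms zero_object_Obj
  by (simp add: tri_def triangle_def)

lemma tri_rot:
  assumes "tri C f g h X Y Z"
  shows "tri C g h (neg C (ar \<Sigma> f)) Y Z (ob \<Sigma> X)"
  using assms TR2[of f g h X Y Z] neg_Mor susp_Mor by (auto simp: tri_def triangle_def)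

text \<open>TR2 read backwards: rotating a triangle puts a sign on the suspended map, so
  \<open>k\<close> has to be the desuspension of -h.\<close>

lemma tri_rot_inv:
  assumes "tri C f g h X Y (ob \<Sigma> Z)" "Z \<in> Obj C"
  obtains k where "tri C k f g Z X Y" "ar \<Sigma> k = neg C h"
proof -
  have f: "f \<in> Mor C X Y" "g \<in> Mor C Y (ob \<Sigma> Z)" "h \<in> Mor C (ob \<Sigma> Z) (ob \<Sigma> X)"
    using tri_Mor[OF assms(1)] by auto
  obtain k where k: "k \<in> Mor C Z X" "ar \<Sigma> k = neg C h"
    using susp_full[OF neg_Mor[OF f(3)] assms(2) Mor_Obj(1)[OF f(1)]] by blast
  have "neg C (ar \<Sigma> k) = h"
    using k neg_neg f(3) by simp
  then have "tri C k f g Z X Y"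
    using TR2[of k f g Z X Y] assms k f by (simp add: tri_def triangle_def)
  then show ?thesis
    using that k by blast
qed

lemma tri_map:
  assumes "tri C f g h X Y Z" "tri C f' g' h' X' Y' Z'"
    "u \<in> Mor C X X'" "v \<in> Mor C Y Y'" "v \<cdot> f = f' \<cdot> u"
  obtains w where "w \<in> Mor C Z Z'" "w \<cdot> g = g' \<cdot> v" "ar \<Sigma> u \<cdot> h = h' \<cdot> w"
proof -
  have "\<exists>w \<in> Mor C Z Z'. w \<cdot> g = g' \<cdot> v \<and> ar \<Sigma> u \<cdot> h = h' \<cdot> w"
    using assms by (intro TR3[of f g h X Y Z f' g' h' X' Y' Z' u v]) (simp_all add: tri_def)
  then show ?thesis
    using that by blast
qed

text \<open>The identity triangle with third vertex \<Sigma>Z, rotated backwards; a zero arrow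
  absorbs the sign.\<close>

lemma tri_zero_left:
  assumes "X \<in> Obj C" "zero_object C Z"
  shows "tri C (zero_arr C Z X) (ident C X) (zero_arr C X (ob \<Sigma> Z)) Z X X"
proof -
  have Z: "Z \<in> Obj C" "ob \<Sigma> Z \<in> Obj C"
    using assms zero_object_Obj susp_Obj by auto
  have "(ident C X, zero_arr C X (ob \<Sigma> Z), neg C (ar \<Sigma> (zero_arr C Z X))) \<in> Tri C"
    using TR1_ident[OF assms(1) zero_susp[OF assms(2)]] Z assms(1)
    by (simp add: susp_zero neg_zero susp_Obj)
  then show ?thesis
    using TR2[of "zero_arr C Z X" "ident C X" "zero_arr C X (ob \<Sigma> Z)" Z X X] Z zero_Mor ident_Mor assms(1)
    by (simp add: tri_def triangle_def)
qed

text \<open>By TR3 the identity triangle X -> X -> 0 maps to the given one with components 1 and f;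
  its third component starts at a zero object, and gf factors through it.\<close>

lemma tri_comp_zero:
  assumes "tri C f g h X Y Z"
  shows "g \<cdot> f = zero_arr C X Z"
proof -
  obtain N where N: "zero_object C N"
    using zero_object_exists by blast
  have X: "X \<in> Obj C" "Z \<in> Obj C" "N \<in> Obj C" and f: "f \<in> Mor C X Y"
    using tri_Obj[OF assms] zero_object_Obj[OF N] tri_Mor[OF assms] by auto
  obtain w where w: "w \<in> Mor C N Z" "w \<cdot> zero_arr C X N = g \<cdot> f"
    using tri_map[OF tri_ident[OF X(1) N] assms ident_Mor[OF X(1)] f] by blast
  show ?thesis
    using w X by (auto simp: Mor_def tri_simps)
qed

text \<open>TR3 only fills in third maps, so both triangles are rotated first: W -> 0 -> \<Sigma>W
  is compared with Y -> Z -> \<Sigma>X, and the resulting map \<Sigma>W -> \<Sigma>X is desuspended.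
  The signs of the two rotations cancel.\<close>

lemma tri_lift:
  assumes "tri C f g h X Y Z" "k \<in> Mor C W Y" "g \<cdot> k = zero_arr C W Z"
  obtains l where "l \<in> Mor C W X" "f \<cdot> l = k"
proof -
  obtain N where N: "zero_object C N"
    using zero_object_exists by blast
  have W: "W \<in> Obj C" "N \<in> Obj C" "Z \<in> Obj C" "X \<in> Obj C"
    using Mor_Obj assms(2) zero_object_Obj[OF N] tri_Obj[OF assms(1)] by auto
  have f: "f \<in> Mor C X Y"
    using tri_Mor[OF assms(1)] by blast
  have comm: "zero_arr C N Z \<cdot> zero_arr C W N = g \<cdot> k"
    using assms(3) W by (simp add: tri_simps)
  obtain w where w: "w \<in> Mor C (ob \<Sigma> W) (ob \<Sigma> X)"
     "ar \<Sigma> k \<cdot> neg C (ar \<Sigma> (ident C W)) = neg C (ar \<Sigma> f) \<cdot> w"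
    using tri_map[OF tri_rot[OF tri_ident[OF W(1) N]] tri_rot[OF assms(1)] assms(2) zero_Mor[OF W(2,3)] comm]
    by blast
  obtain l where l: "l \<in> Mor C W X" "ar \<Sigma> l = w"
    using susp_full[OF w(1) W(1,4)] .
  have "neg C (ar \<Sigma> k) = neg C (ar \<Sigma> (f \<cdot> l))"
    using w l f assms(2) W by (auto simp: Mor_def tri_simps)
  then have "ar \<Sigma> k = ar \<Sigma> (f \<cdot> l)"
    using neg_neg susp_Mor assms(2) comp_Mor[OF l(1) f] by metis
  then have "k = f \<cdot> l"
    by (rule susp_faithful[OF _ assms(2) comp_Mor[OF l(1) f]])
  then show ?thesis
    using that l(1) by simp
qed

text \<open>TR3 with the target triangle 0 -> W -> W; the third map is the factorization.\<close>

lemma tri_desc: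
  assumes "tri C f g h X Y Z" "k \<in> Mor C Y W" "k \<cdot> f = zero_arr C X W"
  obtains l where "l \<in> Mor C Z W" "l \<cdot> g = k"
proof -
  obtain N where N: "zero_object C N"
    using zero_object_exists by blast
  have W: "W \<in> Obj C" "N \<in> Obj C" "X \<in> Obj C"
    using Mor_Obj assms(2) zero_object_Obj[OF N] tri_Obj[OF assms(1)] by auto
  have comm: "k \<cdot> f = zero_arr C N W \<cdot> zero_arr C X N"
    using assms(3) W by (simp add: tri_simps)
  obtain w where "w \<in> Mor C Z W" "w \<cdot> g = ident C W \<cdot> k"
    using tri_map[OF assms(1) tri_zero_left[OF W(1) N] zero_Mor[OF W(3,2)] assms(2) comm] by blast
  then show ?thesis
    using that ident_comp assms(2) by simp
qed

lemma tri_iso: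
  assumes "tri C f g h X Y Z" "triangle C f' g' h' X' Y' Z'"
    "isomorphism C u X X'" "isomorphism C v Y Y'" "isomorphism C w Z Z'"
    "v \<cdot> f = f' \<cdot> u" "w \<cdot> g = g' \<cdot> v" "ar \<Sigma> u \<cdot> h = h' \<cdot> w"
  shows "tri C f' g' h' X' Y' Z'"
  using TR1_iso[of f g h X Y Z f' g' h' X' Y' Z' u v w] assms by (simp add: tri_def)

lemma tri_octahedron:
  assumes "tri C f f' f'' X Y K" "tri C g g' g'' Y Z L" "tri C (g \<cdot> f) h' h'' X Z M"
  shows "exact_triangle C K M L"
proof -
  obtain u v where uv: "u \<in> Mor C K M" "v \<in> Mor C M L" "(u, v, ar \<Sigma> f' \<cdot> g'') \<in> Tri C"
    using TR4[of f f' f'' X Y K g g' g'' Z L h' h'' M] assms by (auto simp: tri_def)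
  have "ar \<Sigma> f' \<cdot> g'' \<in> Mor C L (ob \<Sigma> K)"
    using tri_Mor[OF assms(1)] tri_Mor[OF assms(2)] by (meson comp_Mor susp_Mor)
  then have "tri C u v (ar \<Sigma> f' \<cdot> g'') K M L"
    using uv by (simp add: tri_def triangle_def)
  then show ?thesis
    by (auto simp: exact_triangle_tri)
qed

text \<open>After rotating backwards, k factors through the zero object \<Sigma>^-1 Z.\<close>

lemma tri_mono:
  assumes "tri C f g h X Y Z" "zero_object C Z" "k \<in> Mor C W X" "f \<cdot> k = zero_arr C W Y"
  shows "k = zero_arr C W X"
proof -
  let ?Z = "shift C (-1) Z"
  have Z: "Z = ob \<Sigma> ?Z" "?Z \<in> Obj C" "zero_object C ?Z"
    using zero_object_Obj[OF assms(2)] zero_shift[OF assms(2)] by (auto simp: susp_shift shift_0 shift_Obj)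
  have "tri C f g h X Y (ob \<Sigma> ?Z)"
    using assms(1) Z(1) by simp
  then obtain m where t: "tri C m f g ?Z X Y"
    using tri_rot_inv Z(2) by blast
  note m = tri_Mor(1)[OF t]
  obtain l where l: "l \<in> Mor C W ?Z" "m \<cdot> l = k"
    using tri_lift[OF t assms(3,4)] .
  have "l = zero_arr C W ?Z"
    using orthD[OF zero_object_orth(1)[OF Z(3)] l(1)] Mor_Obj[OF l(1)] by blast
  then show ?thesis
    using l m Mor_Obj[OF l(1)] by (auto simp: Mor_def tri_simps)
qed

text \<open>Lifting the identity of Y gives a right inverse l; then f(lf - 1) = 0, and
  \<open>tri_mono\<close> makes l a left inverse as well.\<close>

lemma tri_isomorphism:
  assumes "tri C f g h X Y Z" "zero_object C Z"
  shows "isomorphism C f X Y"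
proof -
  have f: "f \<in> Mor C X Y" "g \<in> Mor C Y Z" and N: "X \<in> Obj C" "Y \<in> Obj C"
    using tri_Mor[OF assms(1)] tri_Obj[OF assms(1)] by auto
  have "g \<cdot> ident C Y = zero_arr C Y Z"
    using orthD[OF zero_object_orth(1)[OF assms(2) N(2)] f(2)] f(2) comp_ident by simp
  then obtain l where l: "l \<in> Mor C Y X" "f \<cdot> l = ident C Y"
    using tri_lift[OF assms(1) ident_Mor[OF N(2)]] by blast
  have lf: "l \<cdot> f \<in> Mor C X X"
    using comp_Mor f l by blast
  have "f \<cdot> (l \<cdot> f) = f"
    using comp_assoc[OF f(1) l(1) f(1)] l(2) ident_comp[OF f(1)] by simp
  then have "f \<cdot> diff C (l \<cdot> f) (ident C X) = diff C f f"
    using f l N by (simp add: Mor_def tri_simps)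
  then have "diff C (l \<cdot> f) (ident C X) = zero_arr C X X"
    using tri_mono[OF assms diff_Mor[OF lf ident_Mor[OF N(1)]]] diff_self[OF f(1)] by simp
  then have "l \<cdot> f = ident C X"
    using diff_eq_zero[OF lf ident_Mor[OF N(1)]] by blast
  then show ?thesis
    using f l by (auto simp: isomorphism_def)
qed

section \<open>Extensions and splittings, with only the objects of triangles recorded\<close>

lemma exact_rot: "exact_triangle C X Y Z \<Longrightarrow> exact_triangle C Y Z (ob \<Sigma> X)"
  unfolding exact_triangle_tri using tri_rot by blast

lemma exact_rot_inv: "\<lbrakk>exact_triangle C X Y (ob \<Sigma> Z); Z \<in> Obj C\<rbrakk> \<Longrightarrow> exact_triangle C Z X Y"
  unfolding exact_triangle_tri by (meson tri_rot_inv)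

lemma exact_susp: "exact_triangle C X Y Z \<Longrightarrow> exact_triangle C (ob \<Sigma> X) (ob \<Sigma> Y) (ob \<Sigma> Z)"
  using exact_rot by blast

lemma exact_desusp:
  assumes "exact_triangle C (ob \<Sigma> X) (ob \<Sigma> Y) (ob \<Sigma> Z)" "X \<in> Obj C" "Y \<in> Obj C" "Z \<in> Obj C"
  shows "exact_triangle C X Y Z"
  using assms exact_rot_inv by blast

lemma exact_shift:
  assumes "exact_triangle C X Y Z"
  shows "exact_triangle C (shift C n X) (shift C n Y) (shift C n Z)"
proof (induction n rule: int_induct[of _ 0])
  case base
  then show ?case
    using assms by (simp add: shift_0)
next
  case (step1 i)
  then show ?case
    using exact_susp exact_Obj[OF assms] by (simp add: shift_Suc)
next
  case (step2 i)
  show ?case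
  proof (rule exact_desusp)
    show "exact_triangle C (ob \<Sigma> (shift C (i - 1) X)) (ob \<Sigma> (shift C (i - 1) Y)) (ob \<Sigma> (shift C (i - 1) Z))"
      using step2 exact_Obj[OF assms] by (simp add: susp_shift)
  qed (use exact_Obj[OF assms] shift_Obj in auto)
qed

lemma exact_zero_left: "\<lbrakk>X \<in> Obj C; zero_object C Z\<rbrakk> \<Longrightarrow> exact_triangle C Z X X"
  unfolding exact_triangle_tri using tri_zero_left by blast

lemma exact_zero_right: "\<lbrakk>X \<in> Obj C; zero_object C Z\<rbrakk> \<Longrightarrow> exact_triangle C X X Z"
  unfolding exact_triangle_tri using tri_ident by blast

lemma exact_zero_isomorphic: "\<lbrakk>exact_triangle C X Y Z; zero_object C Z\<rbrakk> \<Longrightarrow> isomorphic C X Y"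
  unfolding exact_triangle_tri isomorphic_def using tri_isomorphism by blast

lemma exact_iso:
  assumes "exact_triangle C X Y Z" "isomorphic C X X'" "isomorphic C Y Y'" "isomorphic C Z Z'"
  shows "exact_triangle C X' Y' Z'"
proof -
  obtain f g h where t: "tri C f g h X Y Z"
    using assms(1) by (auto simp: exact_triangle_tri)
  obtain u u' where u: "isomorphism C u X X'" "u \<in> Mor C X X'" "u' \<in> Mor C X' X" "u' \<cdot> u = ident C X"
    using assms(2) by (auto simp: isomorphic_def isomorphism_def)
  obtain v v' where v: "isomorphism C v Y Y'" "v \<in> Mor C Y Y'" "v' \<in> Mor C Y' Y" "v' \<cdot> v = ident C Y"
    using assms(3) by (auto simp: isomorphic_def isomorphism_def)
  obtain w w' where w: "isomorphism C w Z Z'" "w \<in> Mor C Z Z'" "w' \<in> Mor C Z' Z" "w' \<cdot> w = ident C Z"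
    using assms(4) by (auto simp: isomorphic_def isomorphism_def)
  note m = tri_Mor[OF t]
  let ?f = "(v \<cdot> f) \<cdot> u'" and ?g = "(w \<cdot> g) \<cdot> v'" and ?h = "(ar \<Sigma> u \<cdot> h) \<cdot> w'"
  have "triangle C ?f ?g ?h X' Y' Z'"
    using m u v w by (auto simp: triangle_def Mor_def tri_simps)
  moreover have "v \<cdot> f = ?f \<cdot> u" "w \<cdot> g = ?g \<cdot> v" "ar \<Sigma> u \<cdot> h = ?h \<cdot> w"
    using m u v w by (auto simp: Mor_def tri_simps)
  ultimately have "tri C ?f ?g ?h X' Y' Z'"
    by (rule tri_iso[OF t _ u(1) v(1) w(1)])
  then show ?thesis
    by (rule tri_exact)
qed

text \<open>Half of the associativity of \<open>star\<close>: X' is the fibre of the composite X ->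
  B -> B', and the octahedral axiom identifies it as an extension of K by A.\<close>

lemma star_assoc1:
  assumes "exact_triangle C A X B" "exact_triangle C K B B'"
  obtains X' where "exact_triangle C A X' K" "exact_triangle C X' X B'"
proof -
  obtain f g h u v w where t: "tri C f g h A X B" "tri C u v w K B B'"
    using assms by (auto simp: exact_triangle_tri)
  have "v \<cdot> g \<in> Mor C X B'"
    using comp_Mor tri_Mor t by blast
  then obtain p q M where M: "tri C (v \<cdot> g) p q X B' M"
    using tri_cone by blast
  then have "exact_triangle C (ob \<Sigma> A) M (ob \<Sigma> K)"
    using tri_octahedron[OF tri_rot[OF t(1)] tri_rot[OF t(2)]] by blast
  moreover define X' where "X' = shift C (-1) M"
  have X': "ob \<Sigma> X' = M" "X' \<in> Obj C"
    using tri_Obj[OF M] by (simp_all add: X'_def susp_shift shift_0 shift_Obj)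
  ultimately have "exact_triangle C A X' K"
    using exact_desusp tri_Obj[OF t(1)] tri_Obj[OF t(2)] by blast
  moreover have "exact_triangle C X' X B'"
    using exact_rot_inv[OF _ X'(2)] tri_exact[OF M] X'(1) by simp
  ultimately show ?thesis
    using that by blast
qed

text \<open>The other half: Q is the cone of the composite A' -> A -> Y.\<close>

lemma star_assoc2:
  assumes "exact_triangle C A Y B" "exact_triangle C A' A A''"
  obtains Q where "exact_triangle C A' Y Q" "exact_triangle C A'' Q B"
proof -
  obtain f g h u v w where t: "tri C f g h A Y B" "tri C u v w A' A A''"
    using assms by (auto simp: exact_triangle_tri)
  have "f \<cdot> u \<in> Mor C A' Y"
    using comp_Mor tri_Mor t by blast
  then obtain p q M where M: "tri C (f \<cdot> u) p q A' Y M"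
    using tri_cone by blast
  then have "exact_triangle C A'' M B"
    using tri_octahedron[OF t(2) t(1)] by blast
  then show ?thesis
    using that[OF tri_exact[OF M]] by blast
qed

text \<open>Octahedron on the composite gs = 1, whose cone is zero: it forces the cone of s to be
  isomorphic to X.\<close>

lemma tri_split:
  assumes "tri C f g h X Y Z" "s \<in> Mor C Z Y" "g \<cdot> s = ident C Z"
  shows "exact_triangle C Z Y X"
proof -
  obtain N where N: "zero_object C N"
    using zero_object_exists by blast
  obtain p q W where W: "tri C s p q Z Y W"
    using tri_cone[OF assms(2)] by blast
  have X: "X \<in> Obj C" "Z \<in> Obj C"
    using tri_Obj[OF assms(1)] by auto
  have "exact_triangle C W N (ob \<Sigma> X)"
    using tri_octahedron[OF W tri_rot[OF assms(1)], of "zero_arr C Z N" "zero_arr C N (ob \<Sigma> Z)" N]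
      tri_ident[OF X(2) N] assms(3) by simp
  then have "isomorphic C X W"
    using exact_rot_inv[OF _ X(1)] exact_zero_isomorphic N by blast
  moreover have "exact_triangle C Z Y W"
    by (rule tri_exact[OF W])
  ultimately show ?thesis
    using exact_iso isomorphic_refl isomorphic_sym tri_Obj[OF W] by blast
qed

text \<open>The connecting map vanishes, so the identity of Z lifts to Y and the triangle
  splits.\<close>

lemma exact_swap:
  assumes "exact_triangle C X Y Z" "orth C Z (ob \<Sigma> X)"
  shows "exact_triangle C Z Y X"
proof -
  obtain f g h where t: "tri C f g h X Y Z"
    using assms by (auto simp: exact_triangle_tri)
  have Z: "Z \<in> Obj C"
    using tri_Obj[OF t] by blast
  have h: "h \<in> Mor C Z (ob \<Sigma> X)"
    using tri_Mor[OF t] by blast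
  have "h \<cdot> ident C Z = zero_arr C Z (ob \<Sigma> X)"
    using orthD[OF assms(2) h] comp_ident[OF h] by simp
  then show ?thesis
    using tri_lift[OF tri_rot[OF t] ident_Mor[OF Z]] tri_split[OF t] by blast
qed

text \<open>The complement is the fibre Y of the retraction r; the section s splits the triangle Y
  -> W -> X.\<close>

lemma retract_complement:
  assumes "retract C X W"
  obtains Y where "exact_triangle C Y W X" "exact_triangle C X W Y"
proof -
  obtain s r where sr: "s \<in> Mor C X W" "r \<in> Mor C W X" "r \<cdot> s = ident C X"
    using assms by (auto simp: retract_def)
  obtain g h Z where t: "tri C r g h W X Z"
    using tri_cone[OF sr(2)] by blast
  define Y where "Y = shift C (-1) Z"
  have Z: "Z = ob \<Sigma> Y" "Y \<in> Obj C"
    using tri_Obj[OF t] by (auto simp: Y_def susp_shift shift_0 shift_Obj)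
  have "tri C r g h W X (ob \<Sigma> Y)"
    using t Z(1) by simp
  then obtain k where k: "tri C k r g Y W X"
    using tri_rot_inv Z(2) by blast
  then show ?thesis
    using that[OF tri_exact[OF k] tri_split[OF k sr(1,3)]] by blast
qed

lemma orth_exact_right:
  assumes "exact_triangle C X Y Z" "orth C W X" "orth C W Z"
  shows "orth C W Y"
proof -
  obtain f g h where t: "tri C f g h X Y Z"
    using assms by (auto simp: exact_triangle_tri)
  show ?thesis
  proof (rule orthI)
    fix k assume k: "k \<in> Mor C W Y"
    have "g \<cdot> k = zero_arr C W Z"
      using orthD[OF assms(3)] comp_Mor k tri_Mor[OF t] by blast
    then obtain l where l: "l \<in> Mor C W X" "f \<cdot> l = k"
      using tri_lift[OF t k] by blast
    then show "k = zero_arr C W Y"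
      using orthD[OF assms(2) l(1)] tri_Mor[OF t] Mor_Obj[OF k] by (auto simp: Mor_def tri_simps)
  qed (use orth_Obj assms tri_Obj[OF t] in auto)
qed

lemma orth_exact_left:
  assumes "exact_triangle C X Y Z" "orth C X W" "orth C Z W"
  shows "orth C Y W"
proof -
  obtain f g h where t: "tri C f g h X Y Z"
    using assms by (auto simp: exact_triangle_tri)
  show ?thesis
  proof (rule orthI)
    fix k assume k: "k \<in> Mor C Y W"
    have "k \<cdot> f = zero_arr C X W"
      using orthD[OF assms(2)] comp_Mor k tri_Mor[OF t] by blast
    then obtain l where l: "l \<in> Mor C Z W" "l \<cdot> g = k"
      using tri_desc[OF t k] by blast
    then show "k = zero_arr C Y W"
      using orthD[OF assms(3) l(1)] tri_Mor[OF t] Mor_Obj[OF k] by (auto simp: Mor_def tri_simps)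
  qed (use orth_Obj assms tri_Obj[OF t] in auto)
qed

text \<open>The biproduct is compared with the cone Z of \<open>iX\<close>. Since \<open>iX\<close>
  is a split mono, the connecting map h is zero, so \<open>g\<close> is epi, and the comparison
  \<open>c\<close> has as inverse the composite of \<open>iY\<close> and \<open>g\<close>.\<close>

lemma biproduct_tri:
  assumes "is_biproduct C X Y P iX iY pX pY"
  shows "tri C iX pY (zero_arr C Y (ob \<Sigma> X)) X P Y"
proof -
  have b: "iX \<in> Mor C X P" "iY \<in> Mor C Y P" "pX \<in> Mor C P X" "pY \<in> Mor C P Y"
    "pX \<cdot> iX = ident C X" "pY \<cdot> iY = ident C Y" "pY \<cdot> iX = zero_arr C X Y" "pX \<cdot> iY = zero_arr C Y X"
    "(iX \<cdot> pX) \<boxplus> (iY \<cdot> pY) = ident C P" and P: "P \<in> Obj C"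
    using assms by (auto simp: is_biproduct_def)
  have N: "X \<in> Obj C" "Y \<in> Obj C"
    using Mor_Obj b(3,4) by auto
  obtain g h Z where t: "tri C iX g h X P Z"
    using tri_cone[OF b(1)] by blast
  note m = tri_Mor[OF t] and Z = tri_Obj(3)[OF t]
  have "ar \<Sigma> iX \<cdot> h = zero_arr C Z (ob \<Sigma> P)"
  proof -
    have "neg C (ar \<Sigma> iX) \<cdot> h = zero_arr C Z (ob \<Sigma> P)"
      using tri_comp_zero[OF tri_rot[OF tri_rot[OF t]]] .
    then have "neg C (neg C (ar \<Sigma> iX \<cdot> h)) = neg C (zero_arr C Z (ob \<Sigma> P))"
      using m by (auto simp: Mor_def tri_simps)
    then show ?thesis
      using neg_neg[OF comp_Mor[OF m(3) susp_Mor[OF m(1)]]] neg_zero Z P by (simp add: susp_Obj)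
  qed
  then have "ar \<Sigma> pX \<cdot> (ar \<Sigma> iX \<cdot> h) = zero_arr C Z (ob \<Sigma> X)"
    using b m Z N by (auto simp: Mor_def tri_simps)
  moreover have "ar \<Sigma> pX \<cdot> (ar \<Sigma> iX \<cdot> h) = ar \<Sigma> (pX \<cdot> iX) \<cdot> h"
    using b(1,3) m by (auto simp: Mor_def tri_simps)
  ultimately have h: "h = zero_arr C Z (ob \<Sigma> X)"
    using b(5) m(3) N by (auto simp: Mor_def tri_simps)
  have gepi: "x = zero_arr C Z V" if x: "x \<in> Mor C Z V" "x \<cdot> g = zero_arr C P V" for x V
  proof -
    obtain l where l: "l \<in> Mor C (ob \<Sigma> X) V" "l \<cdot> h = x"
      using tri_desc[OF tri_rot[OF t] x] by blast
    then show ?thesis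
      using h Z by (auto simp: Mor_def tri_simps)
  qed
  obtain c where c: "c \<in> Mor C Z Y" "c \<cdot> g = pY"
    using tri_desc[OF t b(4,7)] by blast
  let ?d = "g \<cdot> iY"
  have d: "?d \<in> Mor C Y Z"
    using comp_Mor b m by blast
  have cd: "c \<cdot> ?d = ident C Y"
    using c b m comp_assoc[OF b(2) m(2) c(1)] by simp
  have "?d \<cdot> (c \<cdot> g) = g \<cdot> (iY \<cdot> pY)"
    using c b(2,4) m(2) comp_assoc by simp
  also have "iY \<cdot> pY = diff C (ident C P) (iX \<cdot> pX)"
    using eq_diff[of "iY \<cdot> pY" P P "iX \<cdot> pX" "ident C P"] plus_comm[of "iX \<cdot> pX" P P "iY \<cdot> pY"] b comp_Mor
      ident_Mor P by metis
  also have "g \<cdot> \<dots> = diff C g ((g \<cdot> iX) \<cdot> pX)"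
    using m(2) b(1,3) P by (auto simp: Mor_def tri_simps)
  also have "g \<cdot> iX = zero_arr C X Z"
    by (rule tri_comp_zero[OF t])
  also have "diff C g (zero_arr C X Z \<cdot> pX) = g"
    using m(2) b(3) Z diff_zero[OF m(2)] by (auto simp: Mor_def tri_simps)
  finally have "?d \<cdot> (c \<cdot> g) = g" .
  then have "diff C (?d \<cdot> c) (ident C Z) \<cdot> g = diff C g g"
    using c(1) d m(2) Z by (auto simp: Mor_def tri_simps)
  then have "diff C (?d \<cdot> c) (ident C Z) = zero_arr C Z Z"
    using gepi diff_Mor[OF comp_Mor[OF c(1) d] ident_Mor[OF Z]] diff_self m(2) by metis
  then have "?d \<cdot> c = ident C Z"
    using diff_eq_zero[OF comp_Mor[OF c(1) d] ident_Mor[OF Z]] by blast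
  then have iso: "isomorphism C c Z Y"
    using c d cd by (auto simp: isomorphism_def)
  show ?thesis
  proof (rule tri_iso[OF t _ isomorphism_ident[OF N(1)] isomorphism_ident[OF P] iso])
    show "triangle C iX pY (zero_arr C Y (ob \<Sigma> X)) X P Y"
      using b N zero_Mor susp_Obj by (auto simp: triangle_def)
    show "ident C P \<cdot> iX = iX \<cdot> ident C X" "c \<cdot> g = pY \<cdot> ident C P"
      using b(1,4) c(2) comp_ident ident_comp by simp_all
    show "ar \<Sigma> (ident C X) \<cdot> h = zero_arr C Y (ob \<Sigma> X) \<cdot> c"
      using h c(1) N Z by (auto simp: Mor_def tri_simps)
  qed
qed

end

section \<open>Compact objects\<close>

text \<open>The image of the direct sum of the groups Hom(E, X_i) in Hom(E, P): finite sums of maps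
  through single components. Compactness amounts to this image being all of Hom(E, P) for every
  small coproduct (\<open>compact_finite_maps\<close>, \<open>compact_objectI\<close>), so that
  claims about maps from a compact object can be proved by induction.\<close>

inductive_set finite_maps ::
  "('o, 'm, 'z) additive_category_scheme \<Rightarrow> 'i set \<Rightarrow> ('i \<Rightarrow> 'o) \<Rightarrow> 'o \<Rightarrow> ('i \<Rightarrow> 'm) \<Rightarrow> 'o \<Rightarrow> 'm set"
  for C I X P \<iota> E where
  zero: "zero_arr C E P \<in> finite_maps C I X P \<iota> E"
| step: "\<lbrakk>g \<in> finite_maps C I X P \<iota> E; i \<in> I; f \<in> Mor C E (X i)\<rbrakk>
    \<Longrightarrow> (\<iota> i \<cdot>\<^bsub>C\<^esub> f) \<boxplus>\<^bsub>C\<^esub> g \<in> finite_maps C I X P \<iota> E"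

lemma is_coproduct_reindex:
  assumes b: "bij_betw b I T" and cop: "is_coproduct C I (\<lambda>i. X (b i)) P (\<lambda>i. \<iota> (b i))"
  shows "is_coproduct C T X P \<iota>"
proof -
  have all: "(\<forall>i \<in> I. Q (b i)) \<longleftrightarrow> (\<forall>t \<in> T. Q t)" for Q
    using b by (auto simp: bij_betw_def)
  show ?thesis
    unfolding is_coproduct_def
  proof (intro conjI allI impI ballI)
    fix Y f assume Y: "Y \<in> Obj C" and f: "\<forall>t \<in> T. f t \<in> Mor C (X t) Y"
    have "\<forall>i \<in> I. f (b i) \<in> Mor C (X (b i)) Y"
      using all[of "\<lambda>t. f t \<in> Mor C (X t) Y"] f by simp
    moreover have "\<forall>g. (\<forall>i \<in> I. g i \<in> Mor C (X (b i)) Y) \<longrightarrow>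
        (\<exists>!h. h \<in> Mor C P Y \<and> (\<forall>i \<in> I. h \<cdot>\<^bsub>C\<^esub> \<iota> (b i) = g i))"
      using cop Y unfolding is_coproduct_def by simp
    ultimately have "\<exists>!h. h \<in> Mor C P Y \<and> (\<forall>i \<in> I. h \<cdot>\<^bsub>C\<^esub> \<iota> (b i) = f (b i))"
      by (elim allE[of _ "\<lambda>i. f (b i)"]) simp
    then show "\<exists>!h. h \<in> Mor C P Y \<and> (\<forall>t \<in> T. h \<cdot>\<^bsub>C\<^esub> \<iota> t = f t)"
      using all[of "\<lambda>t. _ \<cdot>\<^bsub>C\<^esub> \<iota> t = f t"] by simp
  next
    fix t assume "t \<in> T"
    then show "\<iota> t \<in> Mor C (X t) P"
      using cop all[of "\<lambda>t. \<iota> t \<in> Mor C (X t) P"] by (simp add: is_coproduct_def)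
  qed (use cop in \<open>simp add: is_coproduct_def\<close>)
qed

lemma finite_maps_reindex:
  assumes "bij_betw b I T" "f \<in> finite_maps C I (\<lambda>i. X (b i)) P (\<lambda>i. \<iota> (b i)) E"
  shows "f \<in> finite_maps C T X P \<iota> E"
  using assms(2)
proof induction
  case zero
  then show ?case
    by (rule finite_maps.zero)
next
  case (step g i f)
  then show ?case
    using finite_maps.step[of g C T X P \<iota> E "b i" f] bij_betwE[OF assms(1)] by blast
qed

context category
begin

lemma is_coproductI:
  assumes "P \<in> Obj C" "\<And>i. i \<in> I \<Longrightarrow> \<iota> i \<in> Mor C (X i) P"
    and "\<And>Y f. \<lbrakk>Y \<in> Obj C; \<And>i. i \<in> I \<Longrightarrow> f i \<in> Mor C (X i) Y\<rbrakk>
      \<Longrightarrow> \<exists>h \<in> Mor C P Y. \<forall>i \<in> I. h \<cdot> \<iota> i = f i"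
    and "\<And>Y g h. \<lbrakk>g \<in> Mor C P Y; h \<in> Mor C P Y; \<And>i. i \<in> I \<Longrightarrow> g \<cdot> \<iota> i = h \<cdot> \<iota> i\<rbrakk> \<Longrightarrow> g = h"
  shows "is_coproduct C I X P \<iota>"
  unfolding is_coproduct_def
proof (intro conjI allI ballI impI)
  fix Y f assume Y: "Y \<in> Obj C" "\<forall>i \<in> I. f i \<in> Mor C (X i) Y"
  then obtain h where h: "h \<in> Mor C P Y" "\<forall>i \<in> I. h \<cdot> \<iota> i = f i"
    using assms(3)[of Y f] by auto
  show "\<exists>!h. h \<in> Mor C P Y \<and> (\<forall>i \<in> I. h \<cdot> \<iota> i = f i)"
  proof (rule ex1I)
    show "h \<in> Mor C P Y \<and> (\<forall>i \<in> I. h \<cdot> \<iota> i = f i)"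
      using h by simp
    fix g assume "g \<in> Mor C P Y \<and> (\<forall>i \<in> I. g \<cdot> \<iota> i = f i)"
    then show "g = h"
      using assms(4)[of g Y h] h by simp
  qed
qed (use assms in auto)

end

context additive_category
begin

lemma finite_maps_Mor:
  assumes "is_coproduct C I X P \<iota>" "E \<in> Obj C" "g \<in> finite_maps C I X P \<iota> E"
  shows "g \<in> Mor C E P"
  using assms(3)
proof induction
  case zero
  then show ?case
    by (rule zero_Mor[OF assms(2) coproduct_Obj[OF assms(1)]])
next
  case (step g i f)
  then show ?case
    using plus_Mor comp_Mor coproduct_Mor[OF assms(1)] by blast
qed

lemma finite_maps_plus:
  assumes cop: "is_coproduct C I X P \<iota>" "E \<in> Obj C"
    and "g \<in> finite_maps C I X P \<iota> E" and h: "h \<in> finite_maps C I X P \<iota> E"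
  shows "g \<boxplus> h \<in> finite_maps C I X P \<iota> E"
  using assms(3)
proof induction
  case zero
  then show ?case
    using h zero_plus finite_maps_Mor[OF cop h] by simp
next
  case (step g i f)
  have "((\<iota> i \<cdot> f) \<boxplus> g) \<boxplus> h = (\<iota> i \<cdot> f) \<boxplus> (g \<boxplus> h)"
    using plus_assoc[OF comp_Mor[OF step(3) coproduct_Mor[OF cop(1) step(2)]]]
      finite_maps_Mor[OF cop] step(1) h by blast
  then show ?case
    using finite_maps.step[OF step.IH step(2,3)] by simp
qed

lemma finite_maps_comp:
  assumes cop: "is_coproduct C I X P \<iota>" and u: "u \<in> Mor C E' E" and "g \<in> finite_maps C I X P \<iota> E"
  shows "g \<cdot> u \<in> finite_maps C I X P \<iota> E'"
  using assms(3)
proof induction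
  case zero
  then show ?case
    using u coproduct_Obj[OF cop] finite_maps.zero by (simp add: Mor_def add_simps)
next
  case (step g i f)
  have "((\<iota> i \<cdot> f) \<boxplus> g) \<cdot> u = (\<iota> i \<cdot> (f \<cdot> u)) \<boxplus> (g \<cdot> u)"
    using coproduct_Mor[OF cop step(2)] step(3) finite_maps_Mor[OF cop _ step(1)] u Mor_Obj(2)[OF u]
    by (simp add: Mor_def add_simps)
  then show ?case
    using finite_maps.step[OF step.IH step(2) comp_Mor[OF u step(3)]] by simp
qed

text \<open>For finite J such a map h plays the part of the projection of P onto the finite
  subcoproduct indexed by J, without that subcoproduct being chosen.\<close>

lemma truncation_exists:
  assumes cop: "is_coproduct C I X P \<iota>"
  obtains h where "h \<in> Mor C P P"
    "\<And>i. i \<in> I \<Longrightarrow> h \<cdot> \<iota> i = (if i \<in> J then \<iota> i else zero_arr C (X i) P)"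
proof -
  have P: "P \<in> Obj C"
    by (rule coproduct_Obj[OF cop])
  have "\<forall>i \<in> I. (if i \<in> J then \<iota> i else zero_arr C (X i) P) \<in> Mor C (X i) P"
    using coproduct_Mor[OF cop] Mor_Obj(1)[OF coproduct_Mor[OF cop]] zero_Mor[OF _ P] by auto
  then show ?thesis
    using coproduct_desc[OF cop P, of "\<lambda>i. if i \<in> J then \<iota> i else zero_arr C (X i) P"] that by blast
qed

lemma projection_exists:
  assumes cop: "is_coproduct C I X P \<iota>" and j: "j \<in> I"
  obtains p where "p \<in> Mor C P (X j)" "p \<cdot> \<iota> j = ident C (X j)"
    "\<And>i. \<lbrakk>i \<in> I; i \<noteq> j\<rbrakk> \<Longrightarrow> p \<cdot> \<iota> i = zero_arr C (X i) (X j)"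
proof -
  have Ob: "X i \<in> Obj C" if "i \<in> I" for i
    using coproduct_Mor[OF cop that] Mor_Obj by blast
  have "\<forall>i \<in> I. (if i = j then ident C (X j) else zero_arr C (X i) (X j)) \<in> Mor C (X i) (X j)"
    using ident_Mor zero_Mor Ob j by simp
  then obtain p where "p \<in> Mor C P (X j)"
      "\<And>i. i \<in> I \<Longrightarrow> p \<cdot> \<iota> i = (if i = j then ident C (X j) else zero_arr C (X i) (X j))"
    using coproduct_desc[OF cop Ob[OF j], of "\<lambda>i. if i = j then ident C (X j) else zero_arr C (X i) (X j)"]
    by blast
  then show ?thesis
    using that j by simp
qed

lemma truncation_finite:
  assumes cop: "is_coproduct C I X P \<iota>" and "finite J" "J \<subseteq> I"
    and "h \<in> Mor C P P" "\<And>i. i \<in> I \<Longrightarrow> h \<cdot> \<iota> i = (if i \<in> J then \<iota> i else zero_arr C (X i) P)"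
  shows "h \<in> finite_maps C I X P \<iota> P"
  using assms(2-)
proof (induction J arbitrary: h)
  case empty
  have P: "P \<in> Obj C"
    by (rule coproduct_Obj[OF cop])
  have "h = zero_arr C P P"
  proof (rule coproduct_ext[OF cop empty(2) zero_Mor[OF P P]])
    fix i assume "i \<in> I"
    then show "h \<cdot> \<iota> i = zero_arr C P P \<cdot> \<iota> i"
      using empty(3) coproduct_Mor[OF cop] P by (auto simp: Mor_def add_simps)
  qed
  then show ?case
    by (simp add: finite_maps.zero)
next
  case (insert j J)
  obtain p where p: "p \<in> Mor C P (X j)" "p \<cdot> \<iota> j = ident C (X j)"
    "\<And>i. \<lbrakk>i \<in> I; i \<noteq> j\<rbrakk> \<Longrightarrow> p \<cdot> \<iota> i = zero_arr C (X i) (X j)"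
    using projection_exists[OF cop, of j] insert(4) by blast
  obtain h' where h': "h' \<in> Mor C P P"
    "\<And>i. i \<in> I \<Longrightarrow> h' \<cdot> \<iota> i = (if i \<in> J then \<iota> i else zero_arr C (X i) P)"
    using truncation_exists[OF cop] by blast
  have j: "j \<in> I"
    using insert by auto
  note \<iota> = coproduct_Mor[OF cop]
  have "h = (\<iota> j \<cdot> p) \<boxplus> h'"
  proof (rule coproduct_ext[OF cop insert(5) plus_Mor[OF comp_Mor[OF p(1) \<iota>[OF j]] h'(1)]])
    fix i assume i: "i \<in> I"
    have "((\<iota> j \<cdot> p) \<boxplus> h') \<cdot> \<iota> i = (\<iota> j \<cdot> (p \<cdot> \<iota> i)) \<boxplus> (h' \<cdot> \<iota> i)"
      using \<iota>[OF i] \<iota>[OF j] p(1) h'(1) by (simp add: Mor_def add_simps)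
    also have "\<dots> = h \<cdot> \<iota> i"
    proof (cases "i = j")
      case True
      then show ?thesis
        using p(2) h'(2)[OF j] insert(2) insert(6)[OF j] comp_ident[OF \<iota>[OF j]] plus_zero[OF \<iota>[OF j]] by simp
    next
      case False
      have "\<iota> j \<cdot> zero_arr C (X i) (X j) = zero_arr C (X i) P"
        using \<iota>[OF i] \<iota>[OF j] Mor_Obj(1)[OF \<iota>[OF i]] by (simp add: Mor_def add_simps)
      moreover have "h' \<cdot> \<iota> i \<in> Mor C (X i) P"
        by (rule comp_Mor[OF \<iota>[OF i] h'(1)])
      ultimately show ?thesis
        using False p(3)[OF i False] h'(2)[OF i] insert(6)[OF i] zero_plus by simp
    qed
    finally show "h \<cdot> \<iota> i = ((\<iota> j \<cdot> p) \<boxplus> h') \<cdot> \<iota> i"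
      by simp
  qed
  then show ?case
    using finite_maps.step[OF insert(3)[OF _ h'] j p(1)] insert(4) by simp
qed

text \<open>Only finitely many components occur in a finite sum, and truncation to them leaves it
  unchanged. The truncation itself is returned because \<open>compact_extension\<close> applies it
  to a second map.\<close>

lemma finite_maps_truncated:
  assumes cop: "is_coproduct C I X P \<iota>" and E: "E \<in> Obj C" and "g \<in> finite_maps C I X P \<iota> E"
  obtains h where "h \<in> finite_maps C I X P \<iota> P" "h \<cdot> g = g"
proof -
  note \<iota> = coproduct_Mor[OF cop]
  have P: "P \<in> Obj C"
    by (rule coproduct_Obj[OF cop])
  define tr where "tr J h \<longleftrightarrow> h \<in> Mor C P P \<and>
    (\<forall>i \<in> I. h \<cdot> \<iota> i = (if i \<in> J then \<iota> i else zero_arr C (X i) P))" for J h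
  \<comment> \<open>Quantifying over all J' containing J lets the induction step enlarge J by
    \<open>i\<close> and still use the induction hypothesis.\<close>
  have "\<exists>J \<subseteq> I. finite J \<and> (\<forall>J' h. J \<subseteq> J' \<longrightarrow> tr J' h \<longrightarrow> h \<cdot> g = g)"
    using assms(3)
  proof induction
    case zero
    then show ?case
      using E P by (intro exI[of _ "{}"]) (auto simp: tr_def Mor_def add_simps)
  next
    case (step g i f)
    from step.IH obtain J where J: "J \<subseteq> I" "finite J" "\<forall>J' h. J \<subseteq> J' \<longrightarrow> tr J' h \<longrightarrow> h \<cdot> g = g"
      by blast
    have "h \<cdot> ((\<iota> i \<cdot> f) \<boxplus> g) = (\<iota> i \<cdot> f) \<boxplus> g" if "insert i J \<subseteq> J'" "tr J' h" for J' h
    proof -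
      have h: "h \<in> Mor C P P" "h \<cdot> \<iota> i = \<iota> i"
        using that step(2) by (auto simp: tr_def)
      have "h \<cdot> ((\<iota> i \<cdot> f) \<boxplus> g) = ((h \<cdot> \<iota> i) \<cdot> f) \<boxplus> (h \<cdot> g)"
        using \<iota>[OF step(2)] step(3) h(1) finite_maps_Mor[OF cop E step(1)] by (simp add: Mor_def add_simps)
      moreover have "h \<cdot> g = g"
        using J(3) that by blast
      ultimately show ?thesis
        using h(2) by simp
    qed
    then show ?case
      using J(1,2) step(2) by (intro exI[of _ "insert i J"]) simp
  qed
  then obtain J where J: "J \<subseteq> I" "finite J" "\<And>h. tr J h \<Longrightarrow> h \<cdot> g = g"
    by blast
  obtain h where h: "h \<in> Mor C P P" "\<And>i. i \<in> I \<Longrightarrow> h \<cdot> \<iota> i = (if i \<in> J then \<iota> i else zero_arr C (X i) P)"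
    using truncation_exists[OF cop] by blast
  have "tr J h"
    using h by (simp add: tr_def)
  then show ?thesis
    using that[OF truncation_finite[OF cop J(2,1) h]] J(3) by blast
qed

lemma compact_finite_maps:
  assumes E: "compact_object \<kappa> C E" and I: "|I :: 'k set| <o (\<kappa> :: 'k rel)" "\<And>i. i \<in> I \<Longrightarrow> X i \<in> Obj C"
    and cop: "is_coproduct C I X P \<iota>" and f: "f \<in> Mor C E P"
  shows "f \<in> finite_maps C I X P \<iota> E"
proof -
  have Ob: "E \<in> Obj C" "P \<in> Obj C"
    using E coproduct_Obj[OF cop] by (auto simp: compact_object_def)
  interpret H: comm_group "Hom_group C E P"
    by (rule Hom_comm_group[OF Ob])
  have grp: "group (Hom_group C E (X i))" if "i \<in> I" for i
    using comm_group.axioms(2)[OF Hom_comm_group[OF Ob(1) I(2)[OF that]]] .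
  let ?h = "\<lambda>f. finprod (Hom_group C E P) (\<lambda>i. \<iota> i \<cdot> f i) {i \<in> I. f i \<noteq> zero_arr C E (X i)}"
  have "?h \<in> iso (sum_group I (\<lambda>i. Hom_group C E (X i))) (Hom_group C E P)"
    using E I cop unfolding compact_object_def by blast
  then have "f \<in> ?h ` carrier (sum_group I (\<lambda>i. Hom_group C E (X i)))"
    using f by (auto simp: iso_def bij_betw_def Hom_group_def)
  then obtain x where x: "x \<in> carrier (sum_group I (\<lambda>i. Hom_group C E (X i)))" "f = ?h x"
    by blast
  then have xm: "\<And>i. i \<in> I \<Longrightarrow> x i \<in> Mor C E (X i)" "finite {i \<in> I. x i \<noteq> zero_arr C E (X i)}"
    using carrier_sum_group[of I "\<lambda>i. Hom_group C E (X i)"] grp by (auto simp: Hom_group_def)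
  have "finprod (Hom_group C E P) (\<lambda>i. \<iota> i \<cdot> x i) J \<in> finite_maps C I X P \<iota> E" if "finite J" "J \<subseteq> I" for J
    using that
  proof (induction J)
    case empty
    then show ?case
      by (simp only: H.finprod_empty) (simp add: Hom_group_def finite_maps.zero)
  next
    case (insert j J)
    have "(\<lambda>i. \<iota> i \<cdot> x i) \<in> J \<rightarrow> carrier (Hom_group C E P)" "\<iota> j \<cdot> x j \<in> carrier (Hom_group C E P)"
      using insert(4) comp_Mor[OF xm(1) coproduct_Mor[OF cop]] by (auto simp: Hom_group_def)
    then have "finprod (Hom_group C E P) (\<lambda>i. \<iota> i \<cdot> x i) (insert j J)
        = (\<iota> j \<cdot> x j) \<boxplus> finprod (Hom_group C E P) (\<lambda>i. \<iota> i \<cdot> x i) J"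
      using H.finprod_insert[OF insert(1,2), of "\<lambda>i. \<iota> i \<cdot> x i"] by (simp add: Hom_group_def)
    then show ?case
      using finite_maps.step[OF insert(3), of j "x j"] xm(1) insert(4) by simp
  qed
  then show ?thesis
    using x(2) xm(2) by blast
qed

text \<open>Injectivity of the canonical map holds for every E: the projections of P recover the
  entries of a family from its sum. Only surjectivity is left to the hypothesis.\<close>

lemma compact_objectI:
  assumes E: "E \<in> Obj C"
    and fin: "\<And>(I :: 'k set) X P \<iota> f. \<lbrakk>|I| <o (\<kappa> :: 'k rel); \<And>i. i \<in> I \<Longrightarrow> X i \<in> Obj C; is_coproduct C I X P \<iota>;
      f \<in> Mor C E P\<rbrakk> \<Longrightarrow> f \<in> finite_maps C I X P \<iota> E"
  shows "compact_object \<kappa> C E"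
  unfolding compact_object_def
proof (intro conjI allI impI E, elim conjE)
  fix I :: "'k set" and X P \<iota>
  assume I: "|I| <o \<kappa>" "\<forall>i \<in> I. X i \<in> Obj C" and cop: "is_coproduct C I X P \<iota>"
  note \<iota> = coproduct_Mor[OF cop]
  have P: "P \<in> Obj C"
    by (rule coproduct_Obj[OF cop])
  interpret H: comm_group "Hom_group C E P"
    by (rule Hom_comm_group[OF E P])
  have grp: "group (Hom_group C E (X i))" if "i \<in> I" for i
    using comm_group.axioms(2)[OF Hom_comm_group[OF E]] I(2) that by blast
  let ?z = "\<lambda>i. zero_arr C E (X i)"
  let ?S = "sum_group I (\<lambda>i. Hom_group C E (X i))"
  let ?s = "\<lambda>f J. finprod (Hom_group C E P) (\<lambda>i. \<iota> i \<cdot> f i) J"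
  let ?h = "\<lambda>f. ?s f {i \<in> I. f i \<noteq> ?z i}"
  have S: "x \<in> carrier ?S \<longleftrightarrow> x \<in> extensional I \<and> (\<forall>i \<in> I. x i \<in> Mor C E (X i)) \<and> finite {i \<in> I. x i \<noteq> ?z i}" for x
    using carrier_sum_group[of I "\<lambda>i. Hom_group C E (X i)"] grp by (auto simp: Hom_group_def PiE_iff)
  have cm: "\<iota> i \<cdot> f \<in> Mor C E P" if "i \<in> I" "f \<in> Mor C E (X i)" for i f
    using comp_Mor[OF that(2) \<iota>[OF that(1)]] .
  have \<iota>z: "\<iota> i \<cdot> ?z i = zero_arr C E P" if "i \<in> I" for i
    using \<iota>[OF that] E by (simp add: Mor_def add_simps)
  \<comment> \<open>A sum may be taken over any finite set containing the support, so that two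
    families can be added over a common index set.\<close>
  have sub: "?h x = ?s x J" if "finite J" "{i \<in> I. x i \<noteq> ?z i} \<subseteq> J" "J \<subseteq> I" "\<forall>i \<in> I. x i \<in> Mor C E (X i)" for x J
  proof (rule H.finprod_mono_neutral_cong_left[OF that(1,2)])
    show "\<iota> i \<cdot> x i = \<one>\<^bsub>Hom_group C E P\<^esub>" if i: "i \<in> J - {i \<in> I. x i \<noteq> ?z i}" for i
    proof -
      have "i \<in> I" "x i = ?z i"
        using i \<open>J \<subseteq> I\<close> by auto
      then show ?thesis
        using \<iota>z by (simp add: Hom_group_def)
    qed
    show "(\<lambda>i. \<iota> i \<cdot> x i) \<in> J \<rightarrow> carrier (Hom_group C E P)"
      using that(3,4) cm by (auto simp: Hom_group_def)
  qed simp
  have funcs: "(\<lambda>i. \<iota> i \<cdot> x i) \<in> J \<rightarrow> carrier (Hom_group C E P)" if "J \<subseteq> I" "\<forall>i \<in> I. x i \<in> Mor C E (X i)" for x J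
    using that cm by (auto simp: Hom_group_def)
  have hom: "?h (\<lambda>i \<in> I. x i \<boxplus> y i) = ?h x \<boxplus> ?h y" if x: "x \<in> carrier ?S" and y: "y \<in> carrier ?S" for x y
  proof -
    let ?J = "{i \<in> I. x i \<noteq> ?z i} \<union> {i \<in> I. y i \<noteq> ?z i}"
    let ?xy = "\<lambda>i \<in> I. x i \<boxplus> y i"
    have xy: "\<forall>i \<in> I. x i \<in> Mor C E (X i)" "\<forall>i \<in> I. y i \<in> Mor C E (X i)" "finite ?J"
      using x y S by auto
    have "{i \<in> I. ?xy i \<noteq> ?z i} \<subseteq> ?J"
      using plus_zero[OF zero_Mor[OF E]] I(2) by auto
    then have "?h ?xy = ?s ?xy ?J"
      using xy plus_Mor by (intro sub) auto
    also have "\<dots> = finprod (Hom_group C E P) (\<lambda>i. (\<iota> i \<cdot> x i) \<otimes>\<^bsub>Hom_group C E P\<^esub> (\<iota> i \<cdot> y i)) ?J"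
    proof (rule H.finprod_cong')
      fix i assume "i \<in> ?J"
      then have i: "i \<in> I"
        by auto
      show "\<iota> i \<cdot> ?xy i = (\<iota> i \<cdot> x i) \<otimes>\<^bsub>Hom_group C E P\<^esub> (\<iota> i \<cdot> y i)"
        using i comp_plus[of "x i" E "X i" "y i" "\<iota> i" P] xy \<iota> by (simp add: Hom_group_def)
    qed (use xy cm in \<open>auto simp: Hom_group_def intro!: plus_Mor\<close>)
    also have "\<dots> = ?s x ?J \<boxplus> ?s y ?J"
      using H.finprod_multf[OF funcs[OF _ xy(1)] funcs[OF _ xy(2)], of ?J] by (auto simp: Hom_group_def)
    also have "\<dots> = ?h x \<boxplus> ?h y"
    proof -
      have "?h x = ?s x ?J" "?h y = ?s y ?J"
        by (rule sub[OF xy(3) Un_upper1 _ xy(1)], blast, rule sub[OF xy(3) Un_upper2 _ xy(2)], blast)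
      then show ?thesis
        by simp
    qed
    finally show ?thesis .
  qed
  have clos: "?h x \<in> Mor C E P" if "x \<in> carrier ?S" for x
    using H.finprod_closed[OF funcs[of "{i \<in> I. x i \<noteq> ?z i}" x]] that S by (auto simp: Hom_group_def)
  have "?h \<in> hom ?S (Hom_group C E P)"
    using hom clos by (auto simp: hom_def Hom_group_def)
  moreover have "inj_on ?h (carrier ?S)"
  proof (rule inj_onI)
    fix x y assume xy: "x \<in> carrier ?S" "y \<in> carrier ?S" "?h x = ?h y"
    have proj: "p \<cdot> ?h x = x j" if j: "j \<in> I" and x: "x \<in> carrier ?S" and p: "p \<in> Mor C P (X j)"
      "p \<cdot> \<iota> j = ident C (X j)" "\<And>i. \<lbrakk>i \<in> I; i \<noteq> j\<rbrakk> \<Longrightarrow> p \<cdot> \<iota> i = zero_arr C (X i) (X j)" for p j x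
    proof -
      have xm: "\<forall>i \<in> I. x i \<in> Mor C E (X i)" "finite {i \<in> I. x i \<noteq> ?z i}"
        using x S by auto
      have Xj: "X j \<in> Obj C"
        using I(2) j by blast
      have "p \<cdot> ?s x J = (if j \<in> J then x j else ?z j)" if "finite J" "J \<subseteq> I" for J
        using that
      proof (induction J)
        case empty
        then show ?case
          using p(1) E by (simp only: H.finprod_empty) (simp add: Hom_group_def Mor_def add_simps)
      next
        case (insert k J)
        have k: "k \<in> I" "\<iota> k \<in> Mor C (X k) P" "x k \<in> Mor C E (X k)"
          using insert(4) \<iota> xm by auto
        have m: "?s x J \<in> Mor C E P"
          using H.finprod_closed[OF funcs[OF _ xm(1)], of J] insert(4) by (simp add: Hom_group_def)
        have "?s x (insert k J) = (\<iota> k \<cdot> x k) \<boxplus> ?s x J"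
          using H.finprod_insert[OF insert(1,2), of "\<lambda>i. \<iota> i \<cdot> x i"] funcs[OF _ xm(1), of J] insert(4) k comp_Mor[OF k(3,2)]
          by (simp add: Hom_group_def)
        then have "p \<cdot> ?s x (insert k J) = ((p \<cdot> \<iota> k) \<cdot> x k) \<boxplus> (p \<cdot> ?s x J)"
          using comp_plus[OF comp_Mor[OF k(3,2)] m p(1)] comp_assoc[OF k(3,2) p(1)] by simp
        also have "\<dots> = (if j \<in> insert k J then x j else ?z j)"
        proof (cases "k = j")
          case True
          then show ?thesis
            using insert.IH insert(2,4) p(2) k(3) ident_comp[OF k(3)] plus_zero[OF k(3)] by simp
        next
          case False
          have "(p \<cdot> \<iota> k) \<cdot> x k = ?z j"
            using p(3)[OF k(1) False] k(3) Xj by (simp add: Mor_def add_simps)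
          then show ?thesis
            using False insert.IH insert(4) zero_plus[OF zero_Mor[OF E Xj]] zero_plus xm(1) j by simp
        qed
        finally show ?case .
      qed
      then show ?thesis
        using xm(2) j by auto
    qed
    show "x = y"
    proof (rule extensionalityI)
      show "x \<in> extensional I" "y \<in> extensional I"
        using xy S by auto
      fix j assume j: "j \<in> I"
      obtain p where p: "p \<in> Mor C P (X j)" "p \<cdot> \<iota> j = ident C (X j)"
        "\<And>i. \<lbrakk>i \<in> I; i \<noteq> j\<rbrakk> \<Longrightarrow> p \<cdot> \<iota> i = zero_arr C (X i) (X j)"
        using projection_exists[OF cop j] by blast
      show "x j = y j"
        using proj[OF j xy(1) p] proj[OF j xy(2) p] xy(3) by simp
    qed
  qed
  moreover have "\<exists>x \<in> carrier ?S. ?h x = f" if "f \<in> finite_maps C I X P \<iota> E" for f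
    using that
  proof induction
    case zero
    have "(\<lambda>i \<in> I. ?z i) \<in> carrier ?S"
      using S zero_Mor[OF E] I(2) by auto
    moreover have "{i \<in> I. (\<lambda>i \<in> I. ?z i) i \<noteq> ?z i} = {}"
      by auto
    then have "?h (\<lambda>i \<in> I. ?z i) = zero_arr C E P"
      by (simp only: H.finprod_empty) (simp add: Hom_group_def)
    ultimately show ?case
      by blast
  next
    case (step g i f)
    then obtain x where x: "x \<in> carrier ?S" "?h x = g"
      by blast
    \<comment> \<open>The family with the single entry \<open>f\<close> at \<open>i\<close>; adding
      it to \<open>x\<close> realizes the next summand.\<close>
    let ?y = "\<lambda>k \<in> I. if k = i then f else ?z k"
    have ym: "\<forall>k \<in> I. ?y k \<in> Mor C E (X k)"
      using step(3) zero_Mor[OF E] I(2) by auto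
    have fin: "{k \<in> I. ?y k \<noteq> ?z k} \<subseteq> {i}"
      by auto
    have y: "?y \<in> carrier ?S"
      using ym finite_subset[OF fin] S by auto
    have "?h ?y = ?s ?y {i}"
      using step(2) by (intro sub fin ym) auto
    also have "\<dots> = \<iota> i \<cdot> f"
      using step(2) H.finprod_insert[of "{}" i "\<lambda>k. \<iota> k \<cdot> ?y k", unfolded H.finprod_empty]
        cm[OF step(2,3)] plus_zero[OF cm[OF step(2,3)]] by (simp add: Hom_group_def)
    finally have "?h (\<lambda>k \<in> I. ?y k \<boxplus> x k) = (\<iota> i \<cdot> f) \<boxplus> g"
      using hom[OF y x(1)] x(2) by simp
    moreover have "(\<lambda>k \<in> I. ?y k \<boxplus> x k) \<in> carrier ?S"
      using group.is_monoid[OF sum_group[of I "\<lambda>i. Hom_group C E (X i)"]] grp monoid.m_closed[of ?S ?y x] y x(1)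
      by (simp add: Hom_group_def)
    ultimately show ?case
      by blast
  qed
  then have "Mor C E P \<subseteq> ?h ` carrier ?S"
    using fin[OF I(1) _ cop] I(2) by blast
  then have "?h ` carrier ?S = carrier (Hom_group C E P)"
    using clos by (auto simp: Hom_group_def)
  ultimately show "?h \<in> iso ?S (Hom_group C E P)"
    by (simp add: iso_def bij_betw_def)
qed

end

lemma compact_Obj: "compact_object \<kappa> C E \<Longrightarrow> E \<in> Obj C"
  by (simp add: compact_object_def)

section \<open>Adjoint functors\<close>

definition preserves_coproducts ::
  "'k rel \<Rightarrow> ('o1, 'm1, 'z1) category_scheme \<Rightarrow> ('o2, 'm2, 'z2) category_scheme
    \<Rightarrow> ('o1, 'm1, 'o2, 'm2) functor_data \<Rightarrow> bool" where
  "preserves_coproducts \<kappa> C D F \<longleftrightarrow> (\<forall>(I :: 'k set) X P \<iota>. |I| <o \<kappa> \<and> is_coproduct C I X P \<iota> \<longrightarrow>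
     is_coproduct D I (\<lambda>i. ob F (X i)) (ob F P) (\<lambda>i. ar F (\<iota> i)))"

locale adjoint_pair = C: additive_category C + D: additive_category D
  for C :: "('o1, 'm1, 'z1) additive_category_scheme" and D :: "('o2, 'm2, 'z2) additive_category_scheme" +
  fixes L R \<eta> \<epsilon>
  assumes adj: "adjunction C D L R \<eta> \<epsilon>" and addL: "additive_functor C D L" and addR: "additive_functor D C R"
begin

lemma L: "is_functor C D L" and R: "is_functor D C R"
  using adj by (auto simp: adjunction_def)

lemma unit_Mor: "X \<in> Obj C \<Longrightarrow> \<eta> X \<in> Mor C X (ob R (ob L X))"
  using adj by (simp add: adjunction_def natural_transformation_def id_functor_def comp_functor_def)

lemma counit_Mor: "Y \<in> Obj D \<Longrightarrow> \<epsilon> Y \<in> Mor D (ob L (ob R Y)) Y"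
  using adj by (simp add: adjunction_def natural_transformation_def id_functor_def comp_functor_def)

lemma unit_natural: "f \<in> Mor C X Y \<Longrightarrow> ar R (ar L f) \<cdot>\<^bsub>C\<^esub> \<eta> X = \<eta> Y \<cdot>\<^bsub>C\<^esub> f"
  using adj by (simp add: adjunction_def natural_transformation_def id_functor_def comp_functor_def)

lemma counit_natural: "f \<in> Mor D X Y \<Longrightarrow> f \<cdot>\<^bsub>D\<^esub> \<epsilon> X = \<epsilon> Y \<cdot>\<^bsub>D\<^esub> ar L (ar R f)"
  using adj by (simp add: adjunction_def natural_transformation_def id_functor_def comp_functor_def)

lemma triangle_left: "X \<in> Obj C \<Longrightarrow> \<epsilon> (ob L X) \<cdot>\<^bsub>D\<^esub> ar L (\<eta> X) = ident D (ob L X)"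
  and triangle_right: "Y \<in> Obj D \<Longrightarrow> ar R (\<epsilon> Y) \<cdot>\<^bsub>C\<^esub> \<eta> (ob R Y) = ident C (ob R Y)"
  using adj by (simp_all add: adjunction_def)

text \<open>The two directions of the bijection between Hom(LX, Y) and Hom(X, RY).\<close>

definition down :: "'o1 \<Rightarrow> 'm2 \<Rightarrow> 'm1" where "down X f = ar R f \<cdot>\<^bsub>C\<^esub> \<eta> X"
definition up :: "'o2 \<Rightarrow> 'm1 \<Rightarrow> 'm2" where "up Y g = \<epsilon> Y \<cdot>\<^bsub>D\<^esub> ar L g"

lemma down_Mor: "\<lbrakk>X \<in> Obj C; f \<in> Mor D (ob L X) Y\<rbrakk> \<Longrightarrow> down X f \<in> Mor C X (ob R Y)"
  unfolding down_def by (rule C.comp_Mor[OF unit_Mor functor_Mor[OF R]])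

lemma up_Mor: "\<lbrakk>Y \<in> Obj D; g \<in> Mor C X (ob R Y)\<rbrakk> \<Longrightarrow> up Y g \<in> Mor D (ob L X) Y"
  unfolding up_def by (rule D.comp_Mor[OF functor_Mor[OF L] counit_Mor])

lemma up_down:
  assumes X: "X \<in> Obj C" and f: "f \<in> Mor D (ob L X) Y"
  shows "up Y (down X f) = f"
proof -
  have Y: "Y \<in> Obj D"
    using D.Mor_Obj f by blast
  note LX = functor_Obj[OF L X]
  note \<eta> = unit_Mor[OF X] and \<epsilon> = counit_Mor[OF Y] counit_Mor[OF LX] and Rf = functor_Mor[OF R f]
  have "up Y (down X f) = \<epsilon> Y \<cdot>\<^bsub>D\<^esub> (ar L (ar R f) \<cdot>\<^bsub>D\<^esub> ar L (\<eta> X))"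
    unfolding up_def down_def using functor_comp[OF L \<eta> Rf] by simp
  also have "\<dots> = (f \<cdot>\<^bsub>D\<^esub> \<epsilon> (ob L X)) \<cdot>\<^bsub>D\<^esub> ar L (\<eta> X)"
    using D.comp_assoc[OF functor_Mor[OF L \<eta>] functor_Mor[OF L Rf] \<epsilon>(1)] counit_natural[OF f] by simp
  also have "\<dots> = f"
    using D.comp_assoc[OF functor_Mor[OF L \<eta>] \<epsilon>(2) f] triangle_left[OF X] D.comp_ident[OF f] by simp
  finally show ?thesis .
qed

lemma down_up:
  assumes Y: "Y \<in> Obj D" and g: "g \<in> Mor C X (ob R Y)"
  shows "down X (up Y g) = g"
proof -
  have X: "X \<in> Obj C"
    using C.Mor_Obj g by blast
  note RY = functor_Obj[OF R Y]
  note \<epsilon> = counit_Mor[OF Y] and \<eta> = unit_Mor[OF X] unit_Mor[OF RY] and Lg = functor_Mor[OF L g]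
  have "down X (up Y g) = (ar R (\<epsilon> Y) \<cdot>\<^bsub>C\<^esub> ar R (ar L g)) \<cdot>\<^bsub>C\<^esub> \<eta> X"
    unfolding up_def down_def using functor_comp[OF R Lg \<epsilon>] by simp
  also have "\<dots> = ar R (\<epsilon> Y) \<cdot>\<^bsub>C\<^esub> (\<eta> (ob R Y) \<cdot>\<^bsub>C\<^esub> g)"
    using C.comp_assoc[OF \<eta>(1) functor_Mor[OF R Lg] functor_Mor[OF R \<epsilon>]] unit_natural[OF g] by simp
  also have "\<dots> = g"
    using C.comp_assoc[OF g \<eta>(2) functor_Mor[OF R \<epsilon>]] triangle_right[OF Y] C.ident_comp[OF g] by simp
  finally show ?thesis .
qed

lemma up_comp:
  assumes "Y \<in> Obj D" "g \<in> Mor C X (ob R Y)" "h \<in> Mor C W X"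
  shows "up Y (g \<cdot>\<^bsub>C\<^esub> h) = up Y g \<cdot>\<^bsub>D\<^esub> ar L h"
  unfolding up_def
  using functor_comp[OF L assms(3,2)] D.comp_assoc[OF functor_Mor[OF L assms(3)] functor_Mor[OF L assms(2)] counit_Mor[OF assms(1)]]
  by simp

lemma up_comp_right:
  assumes "g \<in> Mor C X (ob R Y)" "k \<in> Mor D Y Y'"
  shows "up Y' (ar R k \<cdot>\<^bsub>C\<^esub> g) = k \<cdot>\<^bsub>D\<^esub> up Y g"
proof -
  have Y: "Y \<in> Obj D" "Y' \<in> Obj D"
    using D.Mor_Obj assms(2) by auto
  note m = functor_Mor[OF L assms(1)] functor_Mor[OF L functor_Mor[OF R assms(2)]]
  show ?thesis
    unfolding up_def
    using functor_comp[OF L assms(1) functor_Mor[OF R assms(2)]] D.comp_assoc[OF m counit_Mor[OF Y(2)]]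
      counit_natural[OF assms(2)] D.comp_assoc[OF m(1) counit_Mor[OF Y(1)] assms(2)] by simp
qed

lemma up_plus:
  assumes "Y \<in> Obj D" "g \<in> Mor C X (ob R Y)" "h \<in> Mor C X (ob R Y)"
  shows "up Y (g \<boxplus>\<^bsub>C\<^esub> h) = up Y g \<boxplus>\<^bsub>D\<^esub> up Y h"
  unfolding up_def
  using addL assms(2,3) D.comp_plus[OF functor_Mor[OF L assms(2)] functor_Mor[OF L assms(3)] counit_Mor[OF assms(1)]]
  by (simp add: additive_functor_def)

lemma up_zero:
  assumes "X \<in> Obj C" "Y \<in> Obj D"
  shows "up Y (zero_arr C X (ob R Y)) = zero_arr D (ob L X) Y"
  using counit_Mor[OF assms(2)] functor_Obj[OF L assms(1)] functor_Obj[OF R assms(2)]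
    C.additive_functor_zero[OF addL D.additive_category_axioms assms(1) functor_Obj[OF R assms(2)]]
  by (simp add: up_def Mor_def D.add_simps)

lemma orth_adjoint:
  assumes "X \<in> Obj C" "Y \<in> Obj D"
  shows "orth D (ob L X) Y \<longleftrightarrow> orth C X (ob R Y)"
proof
  assume o: "orth C X (ob R Y)"
  show "orth D (ob L X) Y"
  proof (rule D.orthI[OF functor_Obj[OF L assms(1)] assms(2)])
    fix f assume f: "f \<in> Mor D (ob L X) Y"
    have "down X f = zero_arr C X (ob R Y)"
      by (rule C.orthD[OF o down_Mor[OF assms(1) f]])
    then show "f = zero_arr D (ob L X) Y"
      using up_down[OF assms(1) f] up_zero[OF assms] by simp
  qed
next
  assume o: "orth D (ob L X) Y"
  show "orth C X (ob R Y)"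
  proof (rule C.orthI[OF assms(1) functor_Obj[OF R assms(2)]])
    fix g assume g: "g \<in> Mor C X (ob R Y)"
    note z = C.zero_Mor[OF assms(1) functor_Obj[OF R assms(2)]]
    have "up Y g = up Y (zero_arr C X (ob R Y))"
      using D.orthD[OF o up_Mor[OF assms(2) g]] up_zero[OF assms] by simp
    then have "down X (up Y g) = down X (up Y (zero_arr C X (ob R Y)))"
      by (rule arg_cong)
    then show "g = zero_arr C X (ob R Y)"
      unfolding down_up[OF assms(2) g] down_up[OF assms(2) z] .
  qed
qed

text \<open>Cocones from the L(X_i) to Y correspond by transposition to cocones from the X_i to
  RY.\<close>

lemma left_adjoint_coproduct:
  assumes cop: "is_coproduct C I X P \<iota>"
  shows "is_coproduct D I (\<lambda>i. ob L (X i)) (ob L P) (\<lambda>i. ar L (\<iota> i))"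
proof (rule D.is_coproductI)
  have P: "P \<in> Obj C"
    by (rule C.coproduct_Obj[OF cop])
  note \<iota> = C.coproduct_Mor[OF cop]
  have X: "X i \<in> Obj C" if "i \<in> I" for i
    using C.Mor_Obj \<iota>[OF that] by blast
  show "ob L P \<in> Obj D"
    by (rule functor_Obj[OF L P])
  show "ar L (\<iota> i) \<in> Mor D (ob L (X i)) (ob L P)" if "i \<in> I" for i
    by (rule functor_Mor[OF L \<iota>[OF that]])
  show "\<exists>h \<in> Mor D (ob L P) Y. \<forall>i \<in> I. h \<cdot>\<^bsub>D\<^esub> ar L (\<iota> i) = f i"
    if Y: "Y \<in> Obj D" and f: "\<And>i. i \<in> I \<Longrightarrow> f i \<in> Mor D (ob L (X i)) Y" for Y f
  proof -
    have "\<forall>i \<in> I. down (X i) (f i) \<in> Mor C (X i) (ob R Y)"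
      using down_Mor[OF X f] by blast
    then obtain h where h: "h \<in> Mor C P (ob R Y)" "\<forall>i \<in> I. h \<cdot>\<^bsub>C\<^esub> \<iota> i = down (X i) (f i)"
      using C.coproduct_desc[OF cop functor_Obj[OF R Y], of "\<lambda>i. down (X i) (f i)"] by blast
    have "up Y h \<cdot>\<^bsub>D\<^esub> ar L (\<iota> i) = f i" if i: "i \<in> I" for i
      using up_comp[OF Y h(1) \<iota>[OF i]] h(2) i up_down[OF X[OF i] f[OF i]] by simp
    then show ?thesis
      using up_Mor[OF Y h(1)] by blast
  qed
  show "g = h" if gh: "g \<in> Mor D (ob L P) Y" "h \<in> Mor D (ob L P) Y"
    and eq: "\<And>i. i \<in> I \<Longrightarrow> g \<cdot>\<^bsub>D\<^esub> ar L (\<iota> i) = h \<cdot>\<^bsub>D\<^esub> ar L (\<iota> i)" for Y g h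
  proof -
    have Y: "Y \<in> Obj D"
      using D.Mor_Obj gh(1) by blast
    have "down P g = down P h"
    proof (rule C.coproduct_ext[OF cop down_Mor[OF P gh(1)] down_Mor[OF P gh(2)]])
      fix i assume i: "i \<in> I"
      have *: "down P k \<cdot>\<^bsub>C\<^esub> \<iota> i = down (X i) (k \<cdot>\<^bsub>D\<^esub> ar L (\<iota> i))" if k: "k \<in> Mor D (ob L P) Y" for k
      proof -
        have "up Y (down P k \<cdot>\<^bsub>C\<^esub> \<iota> i) = k \<cdot>\<^bsub>D\<^esub> ar L (\<iota> i)"
          using up_comp[OF Y down_Mor[OF P k] \<iota>[OF i]] up_down[OF P k] by simp
        then show ?thesis
          using down_up[OF Y C.comp_Mor[OF \<iota>[OF i] down_Mor[OF P k]]] by simp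
      qed
      show "down P g \<cdot>\<^bsub>C\<^esub> \<iota> i = down P h \<cdot>\<^bsub>C\<^esub> \<iota> i"
        using *[OF gh(1)] *[OF gh(2)] eq[OF i] by simp
    qed
    then have "up Y (down P g) = up Y (down P h)"
      by (rule arg_cong)
    then show ?thesis
      unfolding up_down[OF P gh(1)] up_down[OF P gh(2)] .
  qed
qed

lemma left_adjoint_preserves_coproducts: "preserves_coproducts \<kappa> C D L"
  unfolding preserves_coproducts_def using left_adjoint_coproduct by blast

text \<open>A map from LE to a coproduct transposes to one from E to the coproduct of the R(X_i);
  there it is a finite sum, and \<open>up\<close> is additive.\<close>

lemma left_adjoint_compact:
  assumes R': "preserves_coproducts (\<kappa> :: 'k rel) D C R" and E: "compact_object \<kappa> C E"
  shows "compact_object \<kappa> D (ob L E)"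
proof (rule D.compact_objectI)
  have EO: "E \<in> Obj C"
    by (rule compact_Obj[OF E])
  show "ob L E \<in> Obj D"
    by (rule functor_Obj[OF L EO])
  fix I :: "'k set" and X P \<iota> f
  assume I: "|I| <o \<kappa>" "\<And>i. i \<in> I \<Longrightarrow> X i \<in> Obj D" and cop: "is_coproduct D I X P \<iota>" and f: "f \<in> Mor D (ob L E) P"
  have P: "P \<in> Obj D"
    by (rule D.coproduct_Obj[OF cop])
  have cop': "is_coproduct C I (\<lambda>i. ob R (X i)) (ob R P) (\<lambda>i. ar R (\<iota> i))"
    using R' I(1) cop unfolding preserves_coproducts_def by blast
  have "up P g \<in> finite_maps D I X P \<iota> (ob L E)"
    if "g \<in> finite_maps C I (\<lambda>i. ob R (X i)) (ob R P) (\<lambda>i. ar R (\<iota> i)) E" for g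
    using that
  proof induction
    case zero
    then show ?case
      using up_zero[OF EO P] finite_maps.zero by simp
  next
    case (step g i f)
    note \<iota> = D.coproduct_Mor[OF cop step(2)]
    have "up P ((ar R (\<iota> i) \<cdot>\<^bsub>C\<^esub> f) \<boxplus>\<^bsub>C\<^esub> g) = up P (ar R (\<iota> i) \<cdot>\<^bsub>C\<^esub> f) \<boxplus>\<^bsub>D\<^esub> up P g"
      by (rule up_plus[OF P C.comp_Mor[OF step(3) functor_Mor[OF R \<iota>]] C.finite_maps_Mor[OF cop' EO step(1)]])
    also have "up P (ar R (\<iota> i) \<cdot>\<^bsub>C\<^esub> f) = \<iota> i \<cdot>\<^bsub>D\<^esub> up (X i) f"
      by (rule up_comp_right[OF step(3) \<iota>])
    finally show ?case
      using finite_maps.step[OF step.IH step(2) up_Mor[OF I(2)[OF step(2)] step(3)]] by simp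
  qed
  moreover have "down E f \<in> finite_maps C I (\<lambda>i. ob R (X i)) (ob R P) (\<lambda>i. ar R (\<iota> i)) E"
    by (rule C.compact_finite_maps[OF E I(1) functor_Obj[OF R I(2)] cop' down_Mor[OF EO f]])
  ultimately show "f \<in> finite_maps D I X P \<iota> (ob L E)"
    using up_down[OF EO f] by force
qed

end

section \<open>Thick subcategories\<close>

text \<open>Desuspension is set up as a functor so that it is adjoint to \<Sigma> on both sides;
  compactness of all shifts is then a case of \<open>left_adjoint_compact\<close>.\<close>

definition desusp_functor :: "('o, 'm, 'z) triangulated_category_scheme \<Rightarrow> ('o, 'm, 'o, 'm) functor_data" where
  "desusp_functor C = \<lparr>ob = inv_into (Obj C) (ob (susp C)), ar = inv_into (Arr C) (ar (susp C))\<rparr>"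

text \<open>For a nonempty thick class \<B> of compact objects this class is closed under small
  coproducts and extensions. A compact retract of a member is a retract of an object of \<B>, which
  is how \<open>compact_in_thick\<close> concludes.\<close>

definition factoring :: "'k rel \<Rightarrow> ('o, 'm, 'z) additive_category_scheme \<Rightarrow> 'o set \<Rightarrow> 'o set" where
  "factoring \<kappa> C \<B> = {Y \<in> Obj C. \<forall>E f. compact_object \<kappa> C E \<and> f \<in> Mor C E Y \<longrightarrow>
     (\<exists>B \<in> \<B>. \<exists>u \<in> Mor C E B. \<exists>v \<in> Mor C B Y. f = v \<cdot>\<^bsub>C\<^esub> u)}"

text \<open>Closure under all shifts also gives cones and fibres of maps between members. The empty
  class qualifies, so a member is asked for wherever a zero object has to belong to the
  class.\<close>

definition thick :: "('o, 'm, 'z) triangulated_category_scheme \<Rightarrow> 'o set \<Rightarrow> bool" where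
  "thick C \<A> \<longleftrightarrow> \<A> \<subseteq> Obj C \<and> (\<forall>X \<in> \<A>. \<forall>n. shift C n X \<in> \<A>) \<and> star C \<A> \<A> \<subseteq> \<A> \<and>
     (\<forall>X \<in> Obj C. \<forall>Y \<in> \<A>. retract C X Y \<longrightarrow> X \<in> \<A>)"

context triangulated_category
begin

abbreviation Omega (\<open>\<Omega>\<close>) where "\<Omega> \<equiv> desusp_functor C"

lemma desusp_ob:
  assumes "X \<in> Obj C"
  shows "ob \<Omega> X \<in> Obj C" "ob \<Sigma> (ob \<Omega> X) = X"
  using desusp[OF assms] by (simp_all add: desusp_functor_def)

lemma desusp_susp:
  shows "X \<in> Obj C \<Longrightarrow> ob \<Omega> (ob \<Sigma> X) = X" "f \<in> Arr C \<Longrightarrow> ar \<Omega> (ar \<Sigma> f) = f"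
  using susp_bij_Obj susp_bij_Arr by (simp_all add: desusp_functor_def bij_betw_def)

lemma desusp_Mor:
  assumes "f \<in> Mor C X Y"
  shows "ar \<Omega> f \<in> Mor C (ob \<Omega> X) (ob \<Omega> Y)" "ar \<Sigma> (ar \<Omega> f) = f"
proof -
  note X = Mor_Obj[OF assms]
  have "f \<in> Mor C (ob \<Sigma> (ob \<Omega> X)) (ob \<Sigma> (ob \<Omega> Y))"
    using assms X by (simp add: desusp_ob)
  then obtain f' where f': "f' \<in> Mor C (ob \<Omega> X) (ob \<Omega> Y)" "ar \<Sigma> f' = f"
    by (rule susp_full) (simp_all add: desusp_ob X)
  then have "ar \<Omega> f = f'"
    using desusp_susp(2)[of f'] by (simp add: Mor_def)
  then show "ar \<Omega> f \<in> Mor C (ob \<Omega> X) (ob \<Omega> Y)" "ar \<Sigma> (ar \<Omega> f) = f"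
    using f' by simp_all
qed

lemma desusp_additive: "additive_functor C C \<Omega>"
proof -
  have "ar \<Omega> (ident C X) = ident C (ob \<Omega> X)" if "X \<in> Obj C" for X
    using desusp_susp(2)[of "ident C (ob \<Omega> X)"] that by (simp add: tri_simps desusp_ob)
  moreover have "ar \<Omega> (g \<cdot> f) = ar \<Omega> g \<cdot> ar \<Omega> f" if fg: "f \<in> Mor C X Y" "g \<in> Mor C Y Z" for X Y Z f g
  proof (rule susp_faithful[OF _ desusp_Mor(1)[OF comp_Mor[OF fg]] comp_Mor[OF desusp_Mor(1)[OF fg(1)] desusp_Mor(1)[OF fg(2)]]])
    show "ar \<Sigma> (ar \<Omega> (g \<cdot> f)) = ar \<Sigma> (ar \<Omega> g \<cdot> ar \<Omega> f)"
      using functor_comp[OF susp_functor desusp_Mor(1)[OF fg(1)] desusp_Mor(1)[OF fg(2)]]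
        desusp_Mor(2)[OF comp_Mor[OF fg]] desusp_Mor(2)[OF fg(1)] desusp_Mor(2)[OF fg(2)] by simp
  qed
  moreover have "ar \<Omega> (f \<boxplus> g) = ar \<Omega> f \<boxplus> ar \<Omega> g" if fg: "f \<in> Mor C X Y" "g \<in> Mor C X Y" for X Y f g
  proof (rule susp_faithful[OF _ desusp_Mor(1)[OF plus_Mor[OF fg]] plus_Mor[OF desusp_Mor(1)[OF fg(1)] desusp_Mor(1)[OF fg(2)]]])
    show "ar \<Sigma> (ar \<Omega> (f \<boxplus> g)) = ar \<Sigma> (ar \<Omega> f \<boxplus> ar \<Omega> g)"
      using susp_plus[OF desusp_Mor(1)[OF fg(1)] desusp_Mor(1)[OF fg(2)]]
        desusp_Mor(2)[OF plus_Mor[OF fg]] desusp_Mor(2)[OF fg(1)] desusp_Mor(2)[OF fg(2)] by simp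
  qed
  ultimately show ?thesis
    unfolding additive_functor_def is_functor_def using desusp_ob(1) desusp_Mor(1) by blast
qed

text \<open>As \<Sigma> is bijective on objects and arrows, identities serve as units and
  counits.\<close>

lemma susp_desusp_adjoint: "adjoint_pair C C \<Sigma> \<Omega> (ident C) (ident C)"
  and desusp_susp_adjoint: "adjoint_pair C C \<Omega> \<Sigma> (ident C) (ident C)"
proof -
  have nat: "natural_transformation C C F G (ident C)"
    if "\<And>X. X \<in> Obj C \<Longrightarrow> ob F X = X \<and> ob G X = X" "\<And>X Y f. f \<in> Mor C X Y \<Longrightarrow> ar F f = f \<and> ar G f = f" for F G
    unfolding natural_transformation_def using that ident_Mor comp_ident ident_comp by simp
  have F: "is_functor C C \<Sigma>" "is_functor C C \<Omega>"
    using susp_functor desusp_additive by (simp_all add: additive_functor_def)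
  have nats: "natural_transformation C C id_functor (\<Omega> \<circ>\<^sub>F \<Sigma>) (ident C)"
    "natural_transformation C C id_functor (\<Sigma> \<circ>\<^sub>F \<Omega>) (ident C)"
    "natural_transformation C C (\<Omega> \<circ>\<^sub>F \<Sigma>) id_functor (ident C)"
    "natural_transformation C C (\<Sigma> \<circ>\<^sub>F \<Omega>) id_functor (ident C)"
    by (rule nat; simp add: id_functor_def comp_functor_def desusp_ob desusp_susp desusp_Mor(2) Mor_def; fail)+
  have "adjunction C C \<Sigma> \<Omega> (ident C) (ident C)" "adjunction C C \<Omega> \<Sigma> (ident C) (ident C)"
    unfolding adjunction_def
    using F nats functor_ident[OF F(1)] functor_ident[OF F(2)] functor_Obj[OF F(1)] functor_Obj[OF F(2)]
    by (simp_all add: ident_comp[OF ident_Mor])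
  then show "adjoint_pair C C \<Sigma> \<Omega> (ident C) (ident C)" "adjoint_pair C C \<Omega> \<Sigma> (ident C) (ident C)"
    using susp_additive desusp_additive additive_category_axioms
    by (simp_all add: adjoint_pair_def adjoint_pair_axioms_def)
qed

lemma compact_susp: "compact_object \<kappa> C E \<Longrightarrow> compact_object \<kappa> C (ob \<Sigma> E)"
  by (rule adjoint_pair.left_adjoint_compact[OF susp_desusp_adjoint
        adjoint_pair.left_adjoint_preserves_coproducts[OF desusp_susp_adjoint]])

lemma compact_desusp:
  assumes "compact_object \<kappa> C (ob \<Sigma> E)" "E \<in> Obj C"
  shows "compact_object \<kappa> C E"
  using adjoint_pair.left_adjoint_compact[OF desusp_susp_adjoint
      adjoint_pair.left_adjoint_preserves_coproducts[OF susp_desusp_adjoint] assms(1)] desusp_susp(1)[OF assms(2)]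
  by simp

lemma compact_shift:
  assumes "compact_object \<kappa> C E"
  shows "compact_object \<kappa> C (shift C n E)"
proof (induction n rule: int_induct[of _ 0])
  case base
  then show ?case
    using assms by (simp add: shift_0)
next
  case (step1 i)
  then show ?case
    using compact_susp compact_Obj[OF assms] by (simp add: shift_Suc)
next
  case (step2 i)
  then show ?case
    using compact_desusp[of \<kappa> "shift C (i - 1) E"] compact_Obj[OF assms] by (simp add: susp_shift shift_Obj)
qed

lemma compact_retract:
  assumes "compact_object (\<kappa> :: 'k rel) C W" "retract C E W"
  shows "compact_object \<kappa> C E"
proof -
  obtain s r where sr: "s \<in> Mor C E W" "r \<in> Mor C W E" "r \<cdot> s = ident C E"
    using assms(2) by (auto simp: retract_def)
  show ?thesis
  proof (rule compact_objectI)
    show "E \<in> Obj C"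
      using Mor_Obj sr by blast
    fix I :: "'k set" and X P \<iota> f
    assume I: "|I| <o \<kappa>" "\<And>i. i \<in> I \<Longrightarrow> X i \<in> Obj C" and cop: "is_coproduct C I X P \<iota>"
      and f: "f \<in> Mor C E P"
    have "f \<cdot> r \<in> finite_maps C I X P \<iota> W"
      by (rule compact_finite_maps[OF assms(1) I cop comp_Mor[OF sr(2) f]])
    then have "(f \<cdot> r) \<cdot> s \<in> finite_maps C I X P \<iota> E"
      by (rule finite_maps_comp[OF cop sr(1)])
    then show "f \<in> finite_maps C I X P \<iota> E"
      using comp_assoc[OF sr(1,2) f] sr(3) comp_ident[OF f] by simp
  qed
qed

text \<open>Restricted to A, f is a finite sum, hence fixed by a truncation h. Then f - hf vanishes
  on A and so factors through B, where it is a finite sum again; hf is one because h is.\<close>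

lemma compact_extension:
  assumes "exact_triangle C A E B" "compact_object (\<kappa> :: 'k rel) C A" "compact_object \<kappa> C B"
  shows "compact_object \<kappa> C E"
proof -
  obtain u v w where t: "tri C u v w A E B"
    using assms(1) by (auto simp: exact_triangle_tri)
  note m = tri_Mor[OF t]
  have E: "E \<in> Obj C"
    using tri_Obj[OF t] by blast
  show ?thesis
  proof (rule compact_objectI[OF E])
    fix I :: "'k set" and X P \<iota> f
    assume I: "|I| <o \<kappa>" "\<And>i. i \<in> I \<Longrightarrow> X i \<in> Obj C" and cop: "is_coproduct C I X P \<iota>"
      and f: "f \<in> Mor C E P"
    have "f \<cdot> u \<in> finite_maps C I X P \<iota> A"
      by (rule compact_finite_maps[OF assms(2) I cop comp_Mor[OF m(1) f]])
    then obtain h where h: "h \<in> finite_maps C I X P \<iota> P" "h \<cdot> (f \<cdot> u) = f \<cdot> u"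
      using finite_maps_truncated[OF cop tri_Obj(1)[OF t]] by blast
    have hm: "h \<in> Mor C P P"
      by (rule finite_maps_Mor[OF cop coproduct_Obj[OF cop] h(1)])
    have hf: "h \<cdot> f \<in> finite_maps C I X P \<iota> E"
      by (rule finite_maps_comp[OF cop f h(1)])
    have "diff C f (h \<cdot> f) \<cdot> u = diff C (f \<cdot> u) (h \<cdot> (f \<cdot> u))"
      using f hm m(1) by (simp add: Mor_def add_simps)
    also have "\<dots> = zero_arr C A P"
      using h(2) diff_self[OF comp_Mor[OF m(1) f]] by simp
    finally obtain l where l: "l \<in> Mor C B P" "l \<cdot> v = diff C f (h \<cdot> f)"
      using tri_desc[OF t diff_Mor[OF f comp_Mor[OF f hm]]] by blast
    have "l \<in> finite_maps C I X P \<iota> B"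
      by (rule compact_finite_maps[OF assms(3) I cop l(1)])
    then have "diff C f (h \<cdot> f) \<in> finite_maps C I X P \<iota> E"
      using finite_maps_comp[OF cop m(2)] l(2) by fastforce
    then show "f \<in> finite_maps C I X P \<iota> E"
      using finite_maps_plus[OF cop E _ hf] diff_plus(1)[OF f comp_Mor[OF f hm]] by fastforce
  qed
qed

lemma thickI:
  assumes "\<A> \<subseteq> Obj C" "\<And>X n. X \<in> \<A> \<Longrightarrow> shift C n X \<in> \<A>"
    "\<And>X Y Z. \<lbrakk>exact_triangle C X Y Z; X \<in> \<A>; Z \<in> \<A>\<rbrakk> \<Longrightarrow> Y \<in> \<A>"
    "\<And>X Y. \<lbrakk>retract C X Y; X \<in> Obj C; Y \<in> \<A>\<rbrakk> \<Longrightarrow> X \<in> \<A>"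
  shows "thick C \<A>"
  unfolding thick_def star_def using assms by blast

lemma thick_Obj: "\<lbrakk>thick C \<A>; X \<in> \<A>\<rbrakk> \<Longrightarrow> X \<in> Obj C"
  and thick_shift: "\<lbrakk>thick C \<A>; X \<in> \<A>\<rbrakk> \<Longrightarrow> shift C n X \<in> \<A>"
  and thick_retract: "\<lbrakk>thick C \<A>; retract C X Y; X \<in> Obj C; Y \<in> \<A>\<rbrakk> \<Longrightarrow> X \<in> \<A>"
  unfolding thick_def by blast+

lemma thick_exact: "\<lbrakk>thick C \<A>; exact_triangle C X Y Z; X \<in> \<A>; Z \<in> \<A>\<rbrakk> \<Longrightarrow> Y \<in> \<A>"
  using exact_Obj unfolding thick_def star_def by blast

lemma thick_susp: "\<lbrakk>thick C \<A>; X \<in> \<A>\<rbrakk> \<Longrightarrow> ob \<Sigma> X \<in> \<A>"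
  using thick_shift[of \<A> X 1] by (simp add: shift_1)

lemma thick_cone:
  assumes "thick C \<A>" "exact_triangle C X Y Z" "X \<in> \<A>" "Y \<in> \<A>"
  shows "Z \<in> \<A>"
  using thick_exact[OF assms(1) exact_rot[OF assms(2)] assms(4) thick_susp[OF assms(1,3)]] .

lemma thick_fibre:
  assumes "thick C \<A>" "exact_triangle C X Y Z" "Y \<in> \<A>" "Z \<in> \<A>"
  shows "X \<in> \<A>"
proof -
  have "ob \<Sigma> X \<in> \<A>"
    using thick_exact[OF assms(1) exact_rot[OF exact_rot[OF assms(2)]] assms(4) thick_susp[OF assms(1,3)]] .
  then have "shift C (-1) (ob \<Sigma> X) \<in> \<A>"
    by (rule thick_shift[OF assms(1)])
  then show ?thesis
    using exact_Obj(1)[OF assms(2)] shift_shift[of X "-1" 1] by (simp add: shift_1 shift_0)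
qed

lemma thick_zero: "\<lbrakk>thick C \<A>; X \<in> \<A>; zero_object C Z\<rbrakk> \<Longrightarrow> Z \<in> \<A>"
  using thick_retract zero_retract thick_Obj zero_object_Obj by blast

lemma thick_compact: "thick C {E. compact_object \<kappa> C E}"
  using compact_Obj compact_shift compact_extension compact_retract by (intro thickI) auto

text \<open>Boundedness conditions are unions over their bounds: extensions and retracts keep a
  bound, while a shift changes it. Nesting brings two members under a common bound.\<close>

lemma thick_increasing_union:
  fixes S :: "int \<Rightarrow> 'o set"
  assumes "\<And>m. S m \<subseteq> Obj C" and mono: "\<And>m n. m \<le> n \<Longrightarrow> S m \<subseteq> S n"
    and shift: "\<And>m n X. X \<in> S m \<Longrightarrow> \<exists>m'. shift C n X \<in> S m'"
    and ext: "\<And>m X Y Z. \<lbrakk>exact_triangle C X Y Z; X \<in> S m; Z \<in> S m\<rbrakk> \<Longrightarrow> Y \<in> S m"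
    and retr: "\<And>m X Y. \<lbrakk>retract C X Y; X \<in> Obj C; Y \<in> S m\<rbrakk> \<Longrightarrow> X \<in> S m"
  shows "thick C (\<Union>m. S m)"
proof (rule thickI)
  show "Y \<in> (\<Union>m. S m)" if tr: "exact_triangle C X Y Z" "X \<in> (\<Union>m. S m)" "Z \<in> (\<Union>m. S m)" for X Y Z
  proof -
    obtain m n where "X \<in> S m" "Z \<in> S n"
      using tr by blast
    then have "X \<in> S (max m n)" "Z \<in> S (max m n)"
      using mono[of m "max m n"] mono[of n "max m n"] by auto
    then show ?thesis
      using ext[OF tr(1)] by blast
  qed
  show "shift C n X \<in> (\<Union>m. S m)" if "X \<in> (\<Union>m. S m)" for X n
    using that shift by blast
  show "X \<in> (\<Union>m. S m)" if "retract C X Y" "X \<in> Obj C" "Y \<in> (\<Union>m. S m)" for X Y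
    using retr[OF that(1,2)] that(3) by blast
qed (use assms(1) in blast)

lemma thick_Int: "\<lbrakk>thick C \<A>; thick C \<B>\<rbrakk> \<Longrightarrow> thick C (\<A> \<inter> \<B>)"
  unfolding thick_def star_def by blast

section \<open>Compact objects lie in the thick closure of a compact generator\<close>

lemma factoringI:
  assumes "Y \<in> Obj C"
    and "\<And>E f. \<lbrakk>compact_object \<kappa> C E; f \<in> Mor C E Y\<rbrakk>
      \<Longrightarrow> \<exists>B \<in> \<B>. \<exists>u \<in> Mor C E B. \<exists>v \<in> Mor C B Y. f = v \<cdot> u"
  shows "Y \<in> factoring \<kappa> C \<B>"
  using assms by (simp add: factoring_def)

lemma factoringE:
  assumes "Y \<in> factoring \<kappa> C \<B>" "compact_object \<kappa> C E" "f \<in> Mor C E Y"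
  obtains B u v where "B \<in> \<B>" "u \<in> Mor C E B" "v \<in> Mor C B Y" "f = v \<cdot> u"
  using assms unfolding factoring_def by blast

lemma factoring_Obj: "Y \<in> factoring \<kappa> C \<B> \<Longrightarrow> Y \<in> Obj C"
  by (simp add: factoring_def)

lemma factoring_superset:
  assumes "\<B> \<subseteq> Obj C"
  shows "\<B> \<subseteq> factoring \<kappa> C \<B>"
proof
  fix Y assume Y: "Y \<in> \<B>"
  then have YO: "Y \<in> Obj C"
    using assms by blast
  show "Y \<in> factoring \<kappa> C \<B>"
  proof (rule factoringI[OF YO])
    fix E f assume f: "f \<in> Mor C E Y"
    then show "\<exists>B \<in> \<B>. \<exists>u \<in> Mor C E B. \<exists>v \<in> Mor C B Y. f = v \<cdot> u"
      by (intro bexI[OF _ Y] bexI[OF _ f] bexI[OF _ ident_Mor[OF YO]]) (simp add: ident_comp)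
  qed
qed

text \<open>The two maps together factor through the biproduct of B and B', which is an extension
  and hence in \<B>.\<close>

lemma factor_plus:
  assumes \<B>: "thick C \<B>" "B \<in> \<B>" "B' \<in> \<B>"
    and uv: "u \<in> Mor C E B" "v \<in> Mor C B Y" "u' \<in> Mor C E B'" "v' \<in> Mor C B' Y"
  shows "\<exists>B'' \<in> \<B>. \<exists>p \<in> Mor C E B''. \<exists>q \<in> Mor C B'' Y. (v \<cdot> u) \<boxplus> (v' \<cdot> u') = q \<cdot> p"
proof -
  obtain P i i' p p' where b: "is_biproduct C B B' P i i' p p'"
    using biproduct_exists thick_Obj[OF \<B>(1)] \<B> by blast
  then have P: "P \<in> \<B>"
    using thick_exact[OF \<B>(1) tri_exact[OF biproduct_tri[OF b]]] \<B> by blast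
  have m: "i \<in> Mor C B P" "i' \<in> Mor C B' P" "p \<in> Mor C P B" "p' \<in> Mor C P B'"
    and e: "p \<cdot> i = ident C B" "p' \<cdot> i' = ident C B'" "p' \<cdot> i = zero_arr C B B'" "p \<cdot> i' = zero_arr C B' B"
    using b by (auto simp: is_biproduct_def)
  let ?p = "(i \<cdot> u) \<boxplus> (i' \<cdot> u')" and ?q = "(v \<cdot> p) \<boxplus> (v' \<cdot> p')"
  have pm: "?p \<in> Mor C E P" "?q \<in> Mor C P Y"
    using m uv by (meson comp_Mor plus_Mor)+
  have Ob: "B \<in> Obj C" "B' \<in> Obj C" "E \<in> Obj C" "Y \<in> Obj C"
    using Mor_Obj uv by blast+
  have 1: "?q \<cdot> i = v"
  proof -
    have "?q \<cdot> i = (v \<cdot> (p \<cdot> i)) \<boxplus> (v' \<cdot> (p' \<cdot> i))"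
      using m uv by (simp add: Mor_def add_simps)
    also have "\<dots> = v \<boxplus> zero_arr C B Y"
      using e uv Ob by (simp add: Mor_def add_simps)
    finally show ?thesis
      using plus_zero[OF uv(2)] by simp
  qed
  have 2: "?q \<cdot> i' = v'"
  proof -
    have "?q \<cdot> i' = (v \<cdot> (p \<cdot> i')) \<boxplus> (v' \<cdot> (p' \<cdot> i'))"
      using m uv by (simp add: Mor_def add_simps)
    also have "\<dots> = zero_arr C B' Y \<boxplus> v'"
      using e uv Ob by (simp add: Mor_def add_simps)
    finally show ?thesis
      using zero_plus[OF uv(4)] by simp
  qed
  have "?q \<cdot> ?p = (?q \<cdot> (i \<cdot> u)) \<boxplus> (?q \<cdot> (i' \<cdot> u'))"
    by (rule comp_plus[OF comp_Mor[OF uv(1) m(1)] comp_Mor[OF uv(3) m(2)] pm(2)])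
  also have "\<dots> = (v \<cdot> u) \<boxplus> (v' \<cdot> u')"
    using comp_assoc[OF uv(1) m(1) pm(2)] comp_assoc[OF uv(3) m(2) pm(2)] 1 2 by simp
  finally show ?thesis
    using P pm by metis
qed

lemma factoring_coproduct:
  assumes \<B>: "thick C \<B>" "\<B> \<noteq> {}"
  shows "closed_under_coproducts (\<kappa> :: 'k rel) C (factoring \<kappa> C \<B>)"
  unfolding closed_under_coproducts_def
proof (intro allI impI, elim conjE)
  fix I :: "'k set" and X P \<iota>
  assume I: "|I| <o \<kappa>" "\<forall>i \<in> I. X i \<in> factoring \<kappa> C \<B>" and cop: "is_coproduct C I X P \<iota>"
  have fac: "\<exists>B \<in> \<B>. \<exists>u \<in> Mor C E B. \<exists>v \<in> Mor C B P. f = v \<cdot> u"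
    if f: "f \<in> finite_maps C I X P \<iota> E" and E: "compact_object \<kappa> C E" for E f
    using f
  proof induction
    \<comment> \<open>The zero map factors through a zero object, which is in \<B> because \<B> is
      nonempty.\<close>
    case zero
    obtain Z B where Z: "zero_object C Z" "B \<in> \<B>"
      using zero_object_exists \<B> by blast
    then have "Z \<in> \<B>" "Z \<in> Obj C"
      using thick_zero[OF \<B>(1)] zero_object_Obj by blast+
    moreover have "zero_arr C E P = zero_arr C Z P \<cdot> zero_arr C E Z"
      using compact_Obj[OF E] coproduct_Obj[OF cop] \<open>Z \<in> Obj C\<close> by (simp add: add_simps)
    ultimately show ?case
      using zero_Mor compact_Obj[OF E] coproduct_Obj[OF cop] by blast
  next
    case (step g i f)
    have \<iota>: "\<iota> i \<in> Mor C (X i) P"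
      by (rule coproduct_Mor[OF cop step(2)])
    obtain B u v where B: "B \<in> \<B>" "u \<in> Mor C E B" "v \<in> Mor C B (X i)" "f = v \<cdot> u"
      using factoringE[OF bspec[OF I(2) step(2)] E step(3)] .
    from step.IH obtain B' u' v' where B': "B' \<in> \<B>" "u' \<in> Mor C E B'" "v' \<in> Mor C B' P" "g = v' \<cdot> u'"
      by blast
    have "\<iota> i \<cdot> f = (\<iota> i \<cdot> v) \<cdot> u"
      using comp_assoc[OF B(2,3) \<iota>] B(4) by simp
    then show ?case
      using factor_plus[OF \<B>(1) B(1) B'(1) B(2) comp_Mor[OF B(3) \<iota>] B'(2,3)] B'(4) by simp
  qed
  show "P \<in> factoring \<kappa> C \<B>"
  proof (intro factoringI)
    show "P \<in> Obj C"
      by (rule coproduct_Obj[OF cop])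
    fix E f assume E: "compact_object \<kappa> C E" and f: "f \<in> Mor C E P"
    have "f \<in> finite_maps C I X P \<iota> E"
      using factoring_Obj I(2) by (intro compact_finite_maps[OF E I(1) _ cop f]) blast
    with fac E show "\<exists>B \<in> \<B>. \<exists>u \<in> Mor C E B. \<exists>v \<in> Mor C B P. f = v \<cdot> u"
      by blast
  qed
qed

text \<open>Given f : E -> Y, the composite E -> b factors through some b' in \<B>. The fibre F of E
  -> b' is compact, the restriction of f to F lifts to a, and the lift factors through some a' in
  \<B>. Gluing a' and E along F gives an extension Q of b' by a', again in \<B>, through which f
  factors.\<close>

lemma factoring_extension:
  assumes \<B>: "thick C \<B>" "\<B> \<subseteq> {E. compact_object \<kappa> C E}"
    and t: "exact_triangle C a Y b" "a \<in> factoring \<kappa> C \<B>" "b \<in> factoring \<kappa> C \<B>"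
  shows "Y \<in> factoring \<kappa> C \<B>"
proof -
  obtain x y z where t: "tri C x y z a Y b"
    using t(1) by (auto simp: exact_triangle_tri)
  note m = tri_Mor[OF t] and Ob = tri_Obj[OF t]
  have "\<exists>B \<in> \<B>. \<exists>u \<in> Mor C E B. \<exists>v \<in> Mor C B Y. f = v \<cdot> u"
    if f: "f \<in> Mor C E Y" and E: "compact_object \<kappa> C E" for E f
  proof -
    have EO: "E \<in> Obj C"
      by (rule compact_Obj[OF E])
    obtain b' u v where b': "b' \<in> \<B>" "u \<in> Mor C E b'" "v \<in> Mor C b' b" "y \<cdot> f = v \<cdot> u"
      using factoringE[OF assms(5) E comp_Mor[OF f m(2)]] .
    obtain g h L where gh: "tri C u g h E b' L"
      using tri_cone[OF b'(2)] .
    define F where "F = shift C (-1) L"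
    have F: "F \<in> Obj C" "L = ob \<Sigma> F"
      using tri_Obj[OF gh] by (simp_all add: F_def shift_Obj susp_shift shift_0)
    obtain e where e: "tri C e u g F E b'"
      using tri_rot_inv[OF _ F(1)] gh F(2) by blast
    note em = tri_Mor(1)[OF e]
    have "F \<in> {E. compact_object \<kappa> C E}"
      using thick_fibre[OF thick_compact tri_exact[OF e]] E b'(1) \<B>(2) by blast
    then have Fc: "compact_object \<kappa> C F"
      by simp
    have fe: "f \<cdot> e \<in> Mor C F Y"
      by (rule comp_Mor[OF em f])
    have "y \<cdot> (f \<cdot> e) = v \<cdot> (u \<cdot> e)"
      using comp_assoc[OF em f m(2)] comp_assoc[OF em b'(2,3)] b'(4) by simp
    also have "\<dots> = zero_arr C F b"
      using tri_comp_zero[OF e] b'(3) F(1) by (simp add: Mor_def add_simps)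
    finally obtain k where k: "k \<in> Mor C F a" "x \<cdot> k = f \<cdot> e"
      using tri_lift[OF t fe] by blast
    obtain a' k1 k2 where a': "a' \<in> \<B>" "k1 \<in> Mor C F a'" "k2 \<in> Mor C a' a" "k = k2 \<cdot> k1"
      using factoringE[OF assms(4) Fc k(1)] .
    have a'O: "a' \<in> Obj C"
      by (rule thick_Obj[OF \<B>(1) a'(1)])
    obtain P i1 i2 p1 p2 where P: "is_biproduct C a' E P i1 i2 p1 p2"
      using biproduct_exists[OF a'O EO] by blast
    have bm: "i1 \<in> Mor C a' P" "i2 \<in> Mor C E P" "p1 \<in> Mor C P a'" "p2 \<in> Mor C P E"
      and be: "p1 \<cdot> i1 = ident C a'" "p2 \<cdot> i2 = ident C E" "p2 \<cdot> i1 = zero_arr C a' E" "p1 \<cdot> i2 = zero_arr C E a'"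
      using P by (auto simp: is_biproduct_def)
    \<comment> \<open>the homotopy pushout of \<open>a' \<leftarrow> F \<rightarrow> E\<close>, an extension of \<open>b'\<close> by \<open>a'\<close>\<close>
    let ?\<phi> = "diff C (i2 \<cdot> e) (i1 \<cdot> k1)"
    have \<phi>: "?\<phi> \<in> Mor C F P"
      using diff_Mor comp_Mor em bm a'(2) by blast
    obtain q r Q where q: "tri C ?\<phi> q r F P Q"
      using tri_cone[OF \<phi>] .
    have "p2 \<cdot> ?\<phi> = diff C ((p2 \<cdot> i2) \<cdot> e) ((p2 \<cdot> i1) \<cdot> k1)"
      using em bm a'(2) by (simp add: Mor_def add_simps)
    also have "\<dots> = diff C e (zero_arr C F E)"
      using be em a'(2) EO by (simp add: Mor_def add_simps)
    finally have "p2 \<cdot> ?\<phi> = e"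
      using diff_zero[OF em] by simp
    \<comment> \<open>Octahedron on the composite p2 \<phi> = e; the cones are Q of \<phi>,
      \<Sigma>a' of \<open>p2\<close> and b' of \<open>e\<close>.\<close>
    then have "exact_triangle C Q b' (ob \<Sigma> a')"
      using tri_octahedron[OF q tri_rot[OF biproduct_tri[OF P]]] e by simp
    then have Q: "Q \<in> \<B>"
      using thick_fibre[OF \<B>(1)] b'(1) thick_susp[OF \<B>(1) a'(1)] by blast
    \<comment> \<open>The map out of the biproduct with components x k2 and f. They agree on F,
      because x k2 k1 = x k = f e, so the map descends to Q.\<close>
    let ?\<psi> = "((x \<cdot> k2) \<cdot> p1) \<boxplus> (f \<cdot> p2)"
    have xk2: "x \<cdot> k2 \<in> Mor C a' Y"
      by (rule comp_Mor[OF a'(3) m(1)])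
    have \<psi>: "?\<psi> \<in> Mor C P Y"
      using plus_Mor comp_Mor xk2 bm f by blast
    have 1: "?\<psi> \<cdot> i2 = f"
    proof -
      have "?\<psi> \<cdot> i2 = ((x \<cdot> k2) \<cdot> (p1 \<cdot> i2)) \<boxplus> (f \<cdot> (p2 \<cdot> i2))"
        using bm f m(1) a'(3) by (simp add: Mor_def add_simps)
      also have "\<dots> = zero_arr C E Y \<boxplus> f"
        using be f xk2 EO by (simp add: Mor_def add_simps)
      finally show ?thesis
        using zero_plus[OF f] by simp
    qed
    have 2: "?\<psi> \<cdot> i1 = x \<cdot> k2"
    proof -
      have "?\<psi> \<cdot> i1 = ((x \<cdot> k2) \<cdot> (p1 \<cdot> i1)) \<boxplus> (f \<cdot> (p2 \<cdot> i1))"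
        using bm f m(1) a'(3) by (simp add: Mor_def add_simps)
      also have "\<dots> = (x \<cdot> k2) \<boxplus> zero_arr C a' Y"
        using be f comp_ident[OF xk2] a'O by (simp add: Mor_def add_simps)
      finally show ?thesis
        using plus_zero[OF xk2] by simp
    qed
    have "?\<psi> \<cdot> ?\<phi> = diff C ((?\<psi> \<cdot> i2) \<cdot> e) ((?\<psi> \<cdot> i1) \<cdot> k1)"
    proof -
      have "?\<psi> \<cdot> ?\<phi> = diff C (?\<psi> \<cdot> (i2 \<cdot> e)) (?\<psi> \<cdot> (i1 \<cdot> k1))"
        using \<psi> comp_Mor[OF em bm(2)] comp_Mor[OF a'(2) bm(1)] by (intro comp_diff) (auto simp: Mor_def)
      then show ?thesis
        using comp_assoc[OF em bm(2) \<psi>] comp_assoc[OF a'(2) bm(1) \<psi>] by simp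
    qed
    also have "\<dots> = diff C (f \<cdot> e) (f \<cdot> e)"
      using 1 2 comp_assoc[OF a'(2,3) m(1)] a'(4) k(2) by simp
    finally have "?\<psi> \<cdot> ?\<phi> = zero_arr C F Y"
      using diff_self[OF fe] by simp
    then obtain l where l: "l \<in> Mor C Q Y" "l \<cdot> q = ?\<psi>"
      using tri_desc[OF q \<psi>] by blast
    have qm: "q \<in> Mor C P Q"
      using tri_Mor[OF q] by blast
    have "f = l \<cdot> (q \<cdot> i2)"
      using comp_assoc[OF bm(2) qm l(1)] l(2) 1 by simp
    then show ?thesis
      using Q l(1) comp_Mor[OF bm(2) qm] by blast
  qed
  then show ?thesis
    by (intro factoringI[OF Ob(2)])
qed

end

section \<open>Coproducts over other index types, and the tower that kills maps from the
  generator\<close>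

lemma is_coproduct_cong:
  assumes "\<And>i. i \<in> I \<Longrightarrow> X i = X' i" "\<And>i. i \<in> I \<Longrightarrow> \<iota> i = \<iota>' i"
  shows "is_coproduct C I X P \<iota> \<longleftrightarrow> is_coproduct C I X' P \<iota>'"
  unfolding is_coproduct_def using assms by (simp cong: ball_cong)

lemma natLeq_less_countable:
  assumes "natLeq <o (\<kappa> :: 'k rel)" "inj (f :: 'a \<Rightarrow> nat)"
  shows "|UNIV :: 'a set| <o \<kappa>"
proof -
  have "|UNIV :: 'a set| \<le>o |UNIV :: nat set|"
    using assms(2) card_of_ordLeq[of "UNIV :: 'a set" "UNIV :: nat set"] by blast
  also have "|UNIV :: nat set| =o natLeq"
    by (rule card_of_nat)
  finally show ?thesis
    using assms(1) ordLeq_ordLess_trans by blast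
qed

lemma int_less_inaccessible:
  assumes "natLeq <o \<kappa>"
  shows "|UNIV :: int set| <o \<kappa>"
  by (rule natLeq_less_countable[OF assms inj_int_encode])

context triangulated_category
begin

text \<open>Existence of coproducts, closure under them and compactness are stated for index sets in
  the type of \<kappa>. A small set T of another type is moved there by an injection, and the three
  facts are carried back to T.\<close>

lemma small_coproduct:
  assumes \<kappa>: "inaccessible (\<kappa> :: 'k rel)" "has_coproducts \<kappa> C"
    and T: "|T :: 'a set| <o \<kappa>" "\<forall>t \<in> T. X t \<in> Obj C"
  obtains P \<iota> where "is_coproduct C T X P \<iota>"
    "\<forall>S. closed_under_coproducts \<kappa> C S \<and> (\<forall>t \<in> T. X t \<in> S) \<longrightarrow> P \<in> S"
    "\<forall>E. compact_object \<kappa> C E \<longrightarrow> Mor C E P \<subseteq> finite_maps C T X P \<iota> E"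
proof -
  have "|T| \<le>o |Field \<kappa>|"
    using \<kappa>(1) T(1) card_of_Field_ordIso ordIso_symmetric ordLess_imp_ordLeq ordLeq_ordIso_trans
    unfolding inaccessible_def by blast
  then obtain g :: "'a \<Rightarrow> 'k" where g: "inj_on g T"
    using card_of_ordLeq[of T "Field \<kappa>"] by blast
  define I where "I = g ` T"
  define b where "b = inv_into T g"
  have b: "bij_betw b I T"
    unfolding b_def I_def using g by (intro bij_betw_inv_into) (simp add: bij_betw_def)
  then have "|I| =o |T|"
    using card_of_ordIso[of I T] by blast
  then have I: "|I| <o \<kappa>"
    by (rule ordIso_ordLess_trans[OF _ T(1)])
  have X: "X (b i) \<in> Obj C" if "i \<in> I" for i
    using T(2) bij_betwE[OF b] that by blast
  then obtain P j where j: "is_coproduct C I (\<lambda>i. X (b i)) P j"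
    using \<kappa>(2) I unfolding has_coproducts_def by fastforce
  define \<iota> where "\<iota> t = j (g t)" for t
  have "j i = \<iota> (b i)" if "i \<in> I" for i
    using that f_inv_into_f[of i g T] by (simp add: \<iota>_def b_def I_def)
  then have cop: "is_coproduct C I (\<lambda>i. X (b i)) P (\<lambda>i. \<iota> (b i))"
    using j is_coproduct_cong[of I "\<lambda>i. X (b i)" "\<lambda>i. X (b i)" j "\<lambda>i. \<iota> (b i)" C P] by simp
  show ?thesis
  proof
    show "is_coproduct C T X P \<iota>"
      by (rule is_coproduct_reindex[OF b cop])
    show "\<forall>S. closed_under_coproducts \<kappa> C S \<and> (\<forall>t \<in> T. X t \<in> S) \<longrightarrow> P \<in> S"
    proof (intro allI impI, elim conjE)
      fix S assume S: "closed_under_coproducts \<kappa> C S" "\<forall>t \<in> T. X t \<in> S"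
      have "\<forall>i \<in> I. X (b i) \<in> S"
        using S(2) bij_betwE[OF b] by blast
      then show "P \<in> S"
        using S(1) cop I unfolding closed_under_coproducts_def by (elim allE[of _ I] allE[of _ "\<lambda>i. X (b i)"]) blast
    qed
    show "\<forall>E. compact_object \<kappa> C E \<longrightarrow> Mor C E P \<subseteq> finite_maps C T X P \<iota> E"
    proof (intro allI impI subsetI)
      fix E f assume Ef: "compact_object \<kappa> C E" "f \<in> Mor C E P"
      show "f \<in> finite_maps C T X P \<iota> E"
        by (rule finite_maps_reindex[OF b compact_finite_maps[OF Ef(1) I X cop Ef(2)]])
    qed
  qed
qed

text \<open>The coproduct runs over all maps from all shifts of \<open>H\<close> to X, so each such
  map factors through q and dies in the cone X' of q.\<close>

lemma kill_shifts:
  assumes \<kappa>: "inaccessible (\<kappa> :: 'k rel)" "has_coproducts \<kappa> C" "locally_small \<kappa> C"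
    and S: "closed_under_coproducts \<kappa> C S" "\<And>n. shift C n H \<in> S" and H: "H \<in> Obj C" and X: "X \<in> Obj C"
  obtains A a x c X' where "A \<in> S" "tri C a x c A X X'" "\<And>n f. f \<in> Mor C (shift C n H) X \<Longrightarrow> x \<cdot> f = zero_arr C (shift C n H) X'"
proof -
  let ?T = "SIGMA n : (UNIV :: int set). Mor C (shift C n H) X"
  let ?X = "\<lambda>(n, f). shift C n H"
  have \<kappa>': "Card_order \<kappa>" "natLeq <o \<kappa>" "regularCard \<kappa>"
    using \<kappa>(1) by (auto simp: inaccessible_def)
  then have "\<not> finite (Field \<kappa>)"
    using ordLess_imp_ordLeq natLeq_ordLeq_cinfinite cinfinite_def cinfinite_mono natLeq_cinfinite by metis
  then have "stable \<kappa>"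
    using regularCard_stable \<kappa>' by blast
  moreover have "\<forall>n \<in> UNIV. |Mor C (shift C n H) X| <o \<kappa>"
    using \<kappa>(3) shift_Obj[OF H] X unfolding locally_small_def by blast
  \<comment> \<open>Regularity of \<kappa>: countably many small Hom-sets have a small disjoint
    union.\<close>
  ultimately have T: "|?T| <o \<kappa>"
    by (intro stable_elim[OF _ int_less_inaccessible[OF \<kappa>'(2)]]) auto
  have XT: "\<forall>t \<in> ?T. ?X t \<in> Obj C"
    using shift_Obj[OF H] by (auto split: prod.splits)
  obtain P \<iota> where cop: "is_coproduct C ?T ?X P \<iota>"
    and P: "\<forall>S. closed_under_coproducts \<kappa> C S \<and> (\<forall>t \<in> ?T. ?X t \<in> S) \<longrightarrow> P \<in> S"
    by (rule small_coproduct[OF \<kappa>(1,2) T XT]) (rule that)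
  have PS: "P \<in> S"
    using S P by auto
  have "\<forall>t \<in> ?T. snd t \<in> Mor C (?X t) X"
    by auto
  then obtain q where q: "q \<in> Mor C P X" "\<And>t. t \<in> ?T \<Longrightarrow> q \<cdot> \<iota> t = snd t"
    using coproduct_desc[OF cop X, of snd] by blast
  obtain x c X' where t: "tri C q x c P X X'"
    using tri_cone[OF q(1)] .
  note x = tri_Mor(2)[OF t]
  have "x \<cdot> f = zero_arr C (shift C n H) X'" if f: "f \<in> Mor C (shift C n H) X" for n f
  proof -
    have T: "(n, f) \<in> ?T"
      using f by simp
    have \<iota>: "\<iota> (n, f) \<in> Mor C (shift C n H) P"
      using coproduct_Mor[OF cop T] by simp
    have "x \<cdot> f = (x \<cdot> q) \<cdot> \<iota> (n, f)"
      using q(2)[OF T] comp_assoc[OF \<iota> q(1) x] by simp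
    also have "\<dots> = zero_arr C (shift C n H) X'"
      using tri_comp_zero[OF t] \<iota> tri_Obj[OF t] by (simp add: Mor_def add_simps)
    finally show ?thesis .
  qed
  then show ?thesis
    using that[OF PS t] by blast
qed

text \<open>Octahedron for K -> X -> Y: the fibre of the composite is an extension of the fibre of x
  by the fibre of c.\<close>

lemma fibre_comp:
  assumes "tri C a c d A K X" "tri C a' x d' A' X Y"
  obtains a'' d'' A'' where "tri C a'' (x \<cdot> c) d'' A'' K Y" "exact_triangle C A A'' A'"
proof -
  have "x \<cdot> c \<in> Mor C K Y"
    using comp_Mor tri_Mor assms by blast
  then obtain p q M where M: "tri C (x \<cdot> c) p q K Y M"
    using tri_cone by blast
  have ex: "exact_triangle C (ob \<Sigma> A) M (ob \<Sigma> A')"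
    by (rule tri_octahedron[OF tri_rot[OF assms(1)] tri_rot[OF assms(2)] M])
  define A'' where "A'' = shift C (-1) M"
  have A'': "ob \<Sigma> A'' = M" "A'' \<in> Obj C"
    using tri_Obj[OF M] by (simp_all add: A''_def susp_shift shift_0 shift_Obj)
  obtain a'' where "tri C a'' (x \<cdot> c) p A'' K Y"
    using tri_rot_inv[OF _ A''(2)] M A''(1) by blast
  moreover have "exact_triangle C A A'' A'"
    using exact_desusp ex A'' tri_Obj(1)[OF assms(1)] tri_Obj(1)[OF assms(2)] by blast
  ultimately show ?thesis
    using that by blast
qed

text \<open>
  Killing all maps from the shifts of \<open>H\<close> again and again yields \<open>K = X\<^sub>0 \<rightarrow> X\<^sub>1 \<rightarrow> \<dots>\<close> whose homotopy
  colimit vanishes, so that \<open>K \<rightarrow> X\<^sub>n\<close> is zero for large \<open>n\<close>.  The vanishing is used in the form that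
  \<open>1 - s\<close> is invertible on the coproduct of the \<open>X\<^sub>n\<close>, where \<open>s\<close> is induced by the maps
  \<open>X\<^sub>n \<rightarrow> X\<^sub>n\<^sub>+\<^sub>1\<close>: it acts as the identity on maps from the shifts of \<open>H\<close>.
\<close>

lemma eventually_zero:
  assumes \<kappa>: "inaccessible (\<kappa> :: 'k rel)" "has_coproducts \<kappa> C"
    and H: "compact_generator \<kappa> C H" and K: "compact_object \<kappa> C K"
    and X: "\<And>n. X n \<in> Obj C" "\<And>n :: nat. x n \<in> Mor C (X n) (X (Suc n))"
    and kill: "\<And>n k f. f \<in> Mor C (shift C k H) (X n) \<Longrightarrow> x n \<cdot> f = zero_arr C (shift C k H) (X (Suc n))"
    and c: "X 0 = K" "c 0 = ident C K" "\<And>n. c (Suc n) = x n \<cdot> c n"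
  obtains n where "c n = zero_arr C K (X n)"
proof -
  have KO: "K \<in> Obj C"
    by (rule compact_Obj[OF K])
  have Hc: "compact_object \<kappa> C (shift C k H)" for k
    using H by (simp add: compact_shift compact_generator_def)
  have HO: "shift C k H \<in> Obj C" for k
    by (rule compact_Obj[OF Hc])
  have cm: "c n \<in> Mor C K (X n)" for n
    by (induction n) (use KO ident_Mor c comp_Mor X(2) in auto)
  have nat: "|UNIV :: nat set| <o \<kappa>"
    using \<kappa>(1) natLeq_less_countable[of \<kappa> "\<lambda>n. n"] by (simp add: inaccessible_def)
  have "\<forall>n \<in> UNIV. X n \<in> Obj C"
    using X(1) by blast
  then obtain P \<iota> where cop: "is_coproduct C UNIV X P \<iota>"
      and fin': "\<forall>E. compact_object \<kappa> C E \<longrightarrow> Mor C E P \<subseteq> finite_maps C UNIV X P \<iota> E"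
    by (rule small_coproduct[OF \<kappa> nat]) (rule that)
  have fin: "f \<in> finite_maps C UNIV X P \<iota> E" if "compact_object \<kappa> C E" "f \<in> Mor C E P" for E f
    using fin' that by blast
  have \<iota>: "\<iota> n \<in> Mor C (X n) P" for n
    using coproduct_Mor[OF cop] by simp
  have P: "P \<in> Obj C"
    by (rule coproduct_Obj[OF cop])
  have "\<forall>n \<in> UNIV. \<iota> (Suc n) \<cdot> x n \<in> Mor C (X n) P"
    using comp_Mor[OF X(2) \<iota>] by blast
  then obtain s where s: "s \<in> Mor C P P" "\<And>n. s \<cdot> \<iota> n = \<iota> (Suc n) \<cdot> x n"
    using coproduct_desc[OF cop P, of "\<lambda>n. \<iota> (Suc n) \<cdot> x n"] by blast
  define d where "d = diff C (ident C P) s"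
  have d: "d \<in> Mor C P P"
    unfolding d_def by (rule diff_Mor[OF ident_Mor[OF P] s(1)])
  have df: "d \<cdot> f = diff C f (s \<cdot> f)" if "f \<in> Mor C Y P" for f Y
    unfolding d_def using that s(1) P by (simp add: Mor_def add_simps)
  \<comment> \<open>A map from the compact object \<open>shift C k H\<close> is a finite sum through
    the X_i, and each summand is killed by the next map of the tower.\<close>
  have sf: "s \<cdot> f = zero_arr C (shift C k H) P" if "f \<in> Mor C (shift C k H) P" for k f
    using fin[OF Hc that]
  proof induction
    case zero
    then show ?case
      using s(1) HO by (simp add: Mor_def add_simps)
  next
    case (step g i f)
    have g: "g \<in> Mor C (shift C k H) P"
      by (rule finite_maps_Mor[OF cop HO step(1)])
    have "s \<cdot> ((\<iota> i \<cdot> f) \<boxplus> g) = ((s \<cdot> \<iota> i) \<cdot> f) \<boxplus> (s \<cdot> g)"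
      using comp_plus[OF comp_Mor[OF step(3) \<iota>] g s(1)] comp_assoc[OF step(3) \<iota> s(1)] by simp
    also have "(s \<cdot> \<iota> i) \<cdot> f = \<iota> (Suc i) \<cdot> (x i \<cdot> f)"
      using s(2) comp_assoc[OF step(3) X(2) \<iota>] by simp
    also have "\<dots> = zero_arr C (shift C k H) P"
      using kill[OF step(3)] \<iota>[of "Suc i"] HO by (simp add: Mor_def add_simps)
    finally show ?case
      using step.IH plus_zero[OF zero_Mor[OF HO P]] by simp
  qed
  have dH: "d \<cdot> f = f" if "f \<in> Mor C (shift C k H) P" for k f
    using df[OF that] sf[OF that] diff_zero[OF that] by simp
  obtain g h Z where t: "tri C d g h P P Z"
    using tri_cone[OF d] .
  note m = tri_Mor[OF t] and Z = tri_Obj(3)[OF t]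
  \<comment> \<open>The desuspension w of hf satisfies dw = w and dw = 0, so hf = 0 and f lifts to
    some y into P; then f = gy = gdy = 0.\<close>
  have "orth C (shift C n H) Z" for n
  proof (rule orthI[OF HO Z])
    fix f assume f: "f \<in> Mor C (shift C n H) Z"
    have sh: "shift C n H = ob \<Sigma> (shift C (n - 1) H)"
      using H by (simp add: susp_shift compact_generator_def compact_object_def)
    have hf: "h \<cdot> f \<in> Mor C (shift C n H) (ob \<Sigma> P)"
      by (rule comp_Mor[OF f m(3)])
    then obtain w where w: "w \<in> Mor C (shift C (n - 1) H) P" "ar \<Sigma> w = h \<cdot> f"
      using susp_full[OF _ HO P] sh by metis
    have "ar \<Sigma> d \<cdot> h = zero_arr C Z (ob \<Sigma> P)"
    proof -
      have "neg C (ar \<Sigma> d) \<cdot> h = zero_arr C Z (ob \<Sigma> P)"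
        by (rule tri_comp_zero[OF tri_rot[OF tri_rot[OF t]]])
      then have "neg C (neg C (ar \<Sigma> d \<cdot> h)) = neg C (zero_arr C Z (ob \<Sigma> P))"
        using m susp_Mor[OF d] by (simp add: Mor_def add_simps)
      then show ?thesis
        using neg_neg[OF comp_Mor[OF m(3) susp_Mor[OF d]]] neg_zero[OF Z susp_Obj[OF P]] by simp
    qed
    then have "ar \<Sigma> d \<cdot> (h \<cdot> f) = zero_arr C (shift C n H) (ob \<Sigma> P)"
      using comp_assoc[OF f m(3) susp_Mor[OF d]] f susp_Obj[OF P] by (simp add: Mor_def add_simps)
    moreover have "ar \<Sigma> w = ar \<Sigma> d \<cdot> (h \<cdot> f)"
      using functor_comp[OF susp_functor w(1) d] dH[OF w(1)] w(2) by simp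
    ultimately have "h \<cdot> f = zero_arr C (shift C n H) (ob \<Sigma> P)"
      using w(2) by simp
    then obtain y where y: "y \<in> Mor C (shift C n H) P" "g \<cdot> y = f"
      using tri_lift[OF tri_rot[OF t] f] by blast
    have "f = (g \<cdot> d) \<cdot> y"
      using comp_assoc[OF y(1) d m(2)] dH[OF y(1)] y(2) by simp
    then show "f = zero_arr C (shift C n H) Z"
      using tri_comp_zero[OF t] y(1) Z by (simp add: Mor_def add_simps)
  qed
  then have "zero_object C Z"
    using H Z unfolding compact_generator_def orth_def by blast
  then have "isomorphism C d P P"
    by (rule tri_isomorphism[OF t])
  then obtain e where e: "e \<in> Mor C P P" "d \<cdot> e = ident C P"
    by (auto simp: isomorphism_def)
  \<comment> \<open>The solution of y - sy = \<open>\<iota> 0\<close>. Projecting this equation to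
    X_n forces the n-th component of y to be \<open>c n\<close>, while compactness of K leaves only
    finitely many nonzero components.\<close>
  define y where "y = e \<cdot> \<iota> 0"
  have \<iota>0: "\<iota> 0 \<in> Mor C K P"
    using \<iota>[of 0] c(1) by simp
  have y: "y \<in> Mor C K P"
    unfolding y_def by (rule comp_Mor[OF \<iota>0 e(1)])
  have dy: "d \<cdot> y = \<iota> 0"
    unfolding y_def using comp_assoc[OF \<iota>0 e(1) d] e(2) ident_comp[OF \<iota>0] by simp
  have "\<exists>p. p \<in> Mor C P (X n) \<and> p \<cdot> \<iota> n = ident C (X n) \<and> (\<forall>i. i \<noteq> n \<longrightarrow> p \<cdot> \<iota> i = zero_arr C (X i) (X n))" for n
    using projection_exists[OF cop, of n] by (metis UNIV_I)
  then obtain p where p: "\<And>n. p n \<in> Mor C P (X n)" "\<And>n. p n \<cdot> \<iota> n = ident C (X n)"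
      "\<And>n i. i \<noteq> n \<Longrightarrow> p n \<cdot> \<iota> i = zero_arr C (X i) (X n)"
    by metis
  have p0: "p 0 \<cdot> s = zero_arr C P (X 0)"
  proof (rule coproduct_ext[OF cop comp_Mor[OF s(1) p(1)] zero_Mor[OF P X(1)]])
    fix i
    have "(p 0 \<cdot> s) \<cdot> \<iota> i = (p 0 \<cdot> \<iota> (Suc i)) \<cdot> x i"
      using comp_assoc[OF \<iota> s(1) p(1)] s(2) comp_assoc[OF X(2) \<iota> p(1)] by simp
    also have "\<dots> = zero_arr C P (X 0) \<cdot> \<iota> i"
      using p(3)[of "Suc i" 0] X(1) X(2)[of i] \<iota>[of i] by (simp add: Mor_def add_simps)
    finally show "(p 0 \<cdot> s) \<cdot> \<iota> i = zero_arr C P (X 0) \<cdot> \<iota> i" .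
  qed
  have pS: "p (Suc n) \<cdot> s = x n \<cdot> p n" for n
  proof (rule coproduct_ext[OF cop comp_Mor[OF s(1) p(1)] comp_Mor[OF p(1) X(2)]])
    fix i
    have "(p (Suc n) \<cdot> s) \<cdot> \<iota> i = (p (Suc n) \<cdot> \<iota> (Suc i)) \<cdot> x i"
      using comp_assoc[OF \<iota> s(1) p(1)] s(2) comp_assoc[OF X(2) \<iota> p(1)] by simp
    also have "\<dots> = x n \<cdot> (p n \<cdot> \<iota> i)"
    proof (cases "i = n")
      case True
      then show ?thesis
        using p(2) ident_comp[OF X(2)] comp_ident[OF X(2)] by simp
    next
      case False
      then show ?thesis
        using p(3)[of "Suc i" "Suc n"] p(3)[of i n] X(1) X(2)[of i] X(2)[of n] by (simp add: Mor_def add_simps)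
    qed
    finally show "(p (Suc n) \<cdot> s) \<cdot> \<iota> i = (x n \<cdot> p n) \<cdot> \<iota> i"
      using comp_assoc[OF \<iota> p(1) X(2)] by simp
  qed
  have yeq: "diff C y (s \<cdot> y) = \<iota> 0"
    using df[OF y] dy by simp
  have sy: "s \<cdot> y \<in> Mor C K P"
    by (rule comp_Mor[OF y s(1)])
  have pd: "diff C (p n \<cdot> y) ((p n \<cdot> s) \<cdot> y) = p n \<cdot> \<iota> 0" for n
  proof -
    have "p n \<cdot> diff C y (s \<cdot> y) = diff C (p n \<cdot> y) (p n \<cdot> (s \<cdot> y))"
      using y sy p(1)[of n] by (intro comp_diff) (auto simp: Mor_def)
    then show ?thesis
      using yeq comp_assoc[OF y s(1) p(1)] by simp
  qed
  have py: "p n \<cdot> y = c n" for n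
  proof (induction n)
    case 0
    have "(p 0 \<cdot> s) \<cdot> y = zero_arr C K (X 0)"
      using p0 y X(1) by (simp add: Mor_def add_simps)
    then show ?case
      using pd[of 0] diff_zero[OF comp_Mor[OF y p(1)[of 0]]] p(2)[of 0] c(1,2) by simp
  next
    case (Suc n)
    have "diff C (p (Suc n) \<cdot> y) (x n \<cdot> (p n \<cdot> y)) = zero_arr C K (X (Suc n))"
      using pd[of "Suc n"] pS[of n] comp_assoc[OF y p(1) X(2)] p(3)[of 0 "Suc n"] c(1) by simp
    then have "p (Suc n) \<cdot> y = x n \<cdot> (p n \<cdot> y)"
      using diff_eq_zero[OF comp_Mor[OF y p(1)] comp_Mor[OF comp_Mor[OF y p(1)] X(2)]] by blast
    then show ?case
      using Suc c(3) by simp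
  qed
  have "\<exists>N. \<forall>n \<ge> N. p n \<cdot> y = zero_arr C K (X n)"
    using fin[OF K y]
  proof induction
    case zero
    then show ?case
      using p(1) KO by (intro exI[of _ 0]) (auto simp: Mor_def add_simps)
  next
    case (step g i f)
    from step.IH obtain N where N: "\<forall>n \<ge> N. p n \<cdot> g = zero_arr C K (X n)"
      by blast
    have g: "g \<in> Mor C K P"
      by (rule finite_maps_Mor[OF cop KO step(1)])
    have "p n \<cdot> ((\<iota> i \<cdot> f) \<boxplus> g) = zero_arr C K (X n)" if n: "n \<ge> max N (Suc i)" for n
    proof -
      have "p n \<cdot> ((\<iota> i \<cdot> f) \<boxplus> g) = ((p n \<cdot> \<iota> i) \<cdot> f) \<boxplus> (p n \<cdot> g)"
        using comp_plus[OF comp_Mor[OF step(3) \<iota>] g p(1)] comp_assoc[OF step(3) \<iota> p(1)] by simp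
      also have "(p n \<cdot> \<iota> i) \<cdot> f = zero_arr C K (X n)"
        using p(3)[of i n] n step(3) X(1) by (simp add: Mor_def add_simps)
      finally show ?thesis
        using N n plus_zero[OF zero_Mor[OF KO X(1)]] by simp
    qed
    then show ?case
      by blast
  qed
  then show ?thesis
    using that py by auto
qed

theorem compact_in_thick:
  assumes \<kappa>: "inaccessible (\<kappa> :: 'k rel)" "has_coproducts \<kappa> C" "locally_small \<kappa> C"
    and H: "compact_generator \<kappa> C H" and K: "compact_object \<kappa> C K"
    and \<A>: "thick C \<A>" "H \<in> \<A>"
  shows "K \<in> \<A>"
proof -
  \<comment> \<open>\<open>factoring_extension\<close> needs \<B> to consist of compact objects, so
    that the fibre formed in it is compact.\<close>
  define \<B> where "\<B> = \<A> \<inter> {E. compact_object \<kappa> C E}"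
  define S where "S = factoring \<kappa> C \<B>"
  have \<B>: "thick C \<B>" "H \<in> \<B>" "\<B> \<subseteq> {E. compact_object \<kappa> C E}"
    using thick_Int[OF \<A>(1) thick_compact] \<A>(2) H by (auto simp: \<B>_def compact_generator_def)
  have HO: "H \<in> Obj C" and KO: "K \<in> Obj C"
    using thick_Obj[OF \<A>] compact_Obj[OF K] by auto
  have BS: "\<B> \<subseteq> S"
    unfolding S_def using factoring_superset thick_Obj[OF \<B>(1)] by blast
  have S: "closed_under_coproducts \<kappa> C S" "\<And>n. shift C n H \<in> S"
    using factoring_coproduct[OF \<B>(1)] \<B>(2) BS thick_shift[OF \<B>(1,2)] by (auto simp: S_def)
  have "\<exists>X' x. (\<exists>A \<in> S. \<exists>a c. tri C a x c A X X') \<and>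
      (\<forall>n. \<forall>f \<in> Mor C (shift C n H) X. x \<cdot> f = zero_arr C (shift C n H) X')" if X: "X \<in> Obj C" for X
    using kill_shifts[OF \<kappa> S HO X] by metis
  \<comment> \<open>For every object, \<open>nx\<close> chooses the next stage and \<open>mx\<close>
    the map to it, so that the tower is a plain iteration.\<close>
  then obtain nx mx where nm: "\<And>X. X \<in> Obj C \<Longrightarrow> \<exists>A \<in> S. \<exists>a c. tri C a (mx X) c A X (nx X)"
      "\<And>X n f. \<lbrakk>X \<in> Obj C; f \<in> Mor C (shift C n H) X\<rbrakk> \<Longrightarrow> mx X \<cdot> f = zero_arr C (shift C n H) (nx X)"
    by metis
  define X where "X n = (nx ^^ n) K" for n
  define x where "x n = mx (X n)" for n
  define c where "c n = rec_nat (ident C K) (\<lambda>n c. x n \<cdot> c) n" for n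
  have X: "X n \<in> Obj C" for n
  proof (induction n)
    case (Suc n)
    then show ?case
      using nm(1)[OF Suc] tri_Obj by (fastforce simp: X_def)
  qed (simp add: X_def KO)
  have xt: "\<exists>A \<in> S. \<exists>a c. tri C a (x n) c A (X n) (X (Suc n))" for n
    using nm(1)[OF X[of n]] by (simp add: x_def X_def)
  then have xm: "x n \<in> Mor C (X n) (X (Suc n))" for n
    using tri_Mor(2) by blast
  have kill: "x n \<cdot> f = zero_arr C (shift C k H) (X (Suc n))" if "f \<in> Mor C (shift C k H) (X n)" for n k f
    using nm(2)[OF X that] by (simp add: x_def X_def)
  have fib: "\<exists>A \<in> S. \<exists>a d. tri C a (c n) d A K (X n)" for n
  proof (induction n)
    case 0
    obtain Z where Z: "zero_object C Z"
      using zero_object_exists by blast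
    have "Z \<in> S"
      using thick_zero[OF \<B>(1,2) Z] BS by blast
    then show ?case
      using tri_zero_left[OF KO Z] by (auto simp: c_def X_def)
  next
    case (Suc n)
    obtain A a d where A: "A \<in> S" "tri C a (c n) d A K (X n)"
      using Suc by blast
    obtain A' a' d' where A': "A' \<in> S" "tri C a' (x n) d' A' (X n) (X (Suc n))"
      using xt by blast
    obtain a'' d'' A'' where A'': "tri C a'' (x n \<cdot> c n) d'' A'' K (X (Suc n))" "exact_triangle C A A'' A'"
      using fibre_comp[OF A(2) A'(2)] .
    have "A'' \<in> S"
      using factoring_extension[OF \<B>(1,3) A''(2)] A(1) A'(1) by (simp add: S_def)
    then show ?case
      using A''(1) by (auto simp: c_def)
  qed
  obtain n where n: "c n = zero_arr C K (X n)"
    by (rule eventually_zero[where X = X and x = x and c = c, OF \<kappa>(1,2) H K X xm kill])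
      (simp_all add: X_def c_def)
  obtain A a d where A: "A \<in> S" "tri C a (c n) d A K (X n)"
    using fib by blast
  \<comment> \<open>As \<open>c n\<close> is zero, the identity of K lifts to the fibre A; factoring
    the lift through a member of \<B> exhibits K as a retract of that member.\<close>
  have "c n \<cdot> ident C K = zero_arr C K (X n)"
    using n comp_ident tri_Mor(2)[OF A(2)] by simp
  then obtain l where l: "l \<in> Mor C K A" "a \<cdot> l = ident C K"
    using tri_lift[OF A(2) ident_Mor[OF KO]] by blast
  obtain B u v where B: "B \<in> \<B>" "u \<in> Mor C K B" "v \<in> Mor C B A" "l = v \<cdot> u"
    using factoringE[OF _ K l(1)] A(1) unfolding S_def by blast
  have am: "a \<in> Mor C A K"
    using tri_Mor[OF A(2)] by blast
  have "(a \<cdot> v) \<cdot> u = ident C K"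
    using comp_assoc[OF B(2,3) am] B(4) l(2) by simp
  then have "retract C K B"
    unfolding retract_def using B(2) comp_Mor[OF B(3) am] by blast
  then show ?thesis
    using thick_retract[OF \<A>(1) _ KO] B(1) by (simp add: \<B>_def)
qed

end

section \<open>t-structures\<close>

locale t_structured = triangulated_category C
  for C :: "('o, 'm, 'z) triangulated_category_scheme" (structure) +
  fixes t :: "'o t_structure"
  assumes t: "is_t_structure C t"
begin

abbreviation le :: "int \<Rightarrow> 'o set" where "le n \<equiv> le_part C t n"
abbreviation ge :: "int \<Rightarrow> 'o set" where "ge n \<equiv> ge_part C t n"

lemma shift_image_iff:
  assumes "S \<subseteq> Obj C"
  shows "X \<in> shift C (- n) ` S \<longleftrightarrow> X \<in> Obj C \<and> shift C n X \<in> S"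
proof
  show "X \<in> Obj C \<and> shift C n X \<in> S" if "X \<in> shift C (- n) ` S"
    using that assms shift_Obj by (auto simp: shift_shift shift_0 subset_iff)
  show "X \<in> shift C (- n) ` S" if "X \<in> Obj C \<and> shift C n X \<in> S"
    using that by (intro image_eqI[of _ _ "shift C n X"]) (simp_all add: shift_shift shift_0)
qed

lemma le_iff: "X \<in> le n \<longleftrightarrow> X \<in> Obj C \<and> shift C n X \<in> aisle t"
  and ge_iff: "X \<in> ge n \<longleftrightarrow> X \<in> Obj C \<and> shift C n X \<in> coaisle t"
  unfolding le_part_def ge_part_def using t by (intro shift_image_iff; simp add: is_t_structure_def)+

lemma le_Obj: "X \<in> le n \<Longrightarrow> X \<in> Obj C" and ge_Obj: "X \<in> ge n \<Longrightarrow> X \<in> Obj C"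
  by (simp_all add: le_iff ge_iff)

lemma le_shift: "X \<in> Obj C \<Longrightarrow> shift C k X \<in> le n \<longleftrightarrow> X \<in> le (n + k)"
  by (simp add: le_iff shift_shift shift_Obj)

lemma ge_shift: "X \<in> Obj C \<Longrightarrow> shift C k X \<in> ge n \<longleftrightarrow> X \<in> ge (n + k)"
  by (simp add: ge_iff shift_shift shift_Obj)

lemma le_Suc: "X \<in> le n \<Longrightarrow> X \<in> le (n + 1)"
proof -
  assume X: "X \<in> le n"
  have "le (-1) \<subseteq> le 0"
    using t by (simp add: is_t_structure_def)
  moreover have "shift C (n + 1) X \<in> le (-1)"
    using X le_Obj[OF X] le_shift by simp
  ultimately show "X \<in> le (n + 1)"
    using le_Obj[OF X] le_shift[of X "n + 1" 0] by auto
qed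

lemma ge_pred: "X \<in> ge (n + 1) \<Longrightarrow> X \<in> ge n"
proof -
  assume X: "X \<in> ge (n + 1)"
  have "ge 1 \<subseteq> ge 0"
    using t by (simp add: is_t_structure_def)
  moreover have "shift C n X \<in> ge 1"
    using X ge_Obj[OF X] ge_shift[of X n 1] by (simp add: add.commute)
  ultimately show "X \<in> ge n"
    using ge_Obj[OF X] ge_shift[of X n 0] by auto
qed

lemma le_mono:
  assumes "X \<in> le m" "m \<le> n"
  shows "X \<in> le n"
  using assms(2,1) by (induction rule: int_ge_induct) (auto intro: le_Suc)

lemma ge_mono:
  assumes "X \<in> ge n" "m \<le> n"
  shows "X \<in> ge m"
  using assms(2,1) by (induction rule: int_le_induct) (use ge_pred in force)+

lemma orth_le_ge:
  assumes "X \<in> le n" "Y \<in> ge m" "n < m"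
  shows "orth C X Y"
proof -
  have Ob: "X \<in> Obj C" "Y \<in> Obj C"
    using assms le_Obj ge_Obj by auto
  have "Y \<in> ge (n + 1)"
    using ge_mono[OF assms(2)] assms(3) by simp
  then have "shift C n X \<in> le 0" "shift C n Y \<in> ge 1"
    using assms(1) Ob le_shift ge_shift by (simp_all add: add.commute)
  then have "orth C (shift C n X) (shift C n Y)"
    using t unfolding is_t_structure_def orth_def by blast
  then show ?thesis
    using orth_shift Ob by blast
qed

text \<open>In the truncation triangle A -> \<Sigma>^n X -> B, the object B receives only zero maps
  from \<Sigma>^n X and from \<Sigma>A, hence from itself. Being left orthogonals, aisles are closed
  under extensions, retracts and coproducts.\<close>

lemma le_orthI:
  assumes X: "X \<in> Obj C" and o: "\<And>Y. Y \<in> ge (n + 1) \<Longrightarrow> orth C X Y"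
  shows "X \<in> le n"
proof -
  let ?X = "shift C n X"
  have X': "?X \<in> Obj C"
    by (rule shift_Obj[OF X])
  obtain A B where AB: "A \<in> le 0" "B \<in> ge 1" "exact_triangle C A ?X B"
    using t X' unfolding is_t_structure_def by blast
  have BO: "B \<in> Obj C" and AO: "A \<in> Obj C"
    using AB le_Obj ge_Obj by blast+
  have "shift C (- n) B \<in> ge (n + 1)"
    using AB(2) BO ge_shift by (simp add: add.commute)
  then have "orth C ?X B"
    using o orth_shift_left[OF X BO] by blast
  moreover have "ob \<Sigma> A \<in> le 0"
    using AB(1) AO le_shift[of A 1 0] le_mono[of A 0 1] by (simp add: shift_1)
  then have "orth C (ob \<Sigma> A) B"
    using orth_le_ge AB(2) by force
  ultimately have "orth C B B"
    using orth_exact_left[OF exact_rot[OF AB(3)]] by blast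
  then have "isomorphic C A ?X"
    using exact_zero_isomorphic[OF AB(3)] orth_self by blast
  moreover have "A \<in> aisle t"
    using AB(1) by (simp add: le_iff shift_0)
  ultimately have "?X \<in> aisle t"
    using t X' unfolding is_t_structure_def iso_closed_def isomorphic_def by blast
  then show ?thesis
    using X by (simp add: le_iff)
qed

text \<open>Dually, A has only zero maps to \<Sigma>^(n-1) Y and to \<Sigma>^-1 B, hence to
  itself.\<close>

lemma ge_orthI:
  assumes Y: "Y \<in> Obj C" and o: "\<And>X. X \<in> le (n - 1) \<Longrightarrow> orth C X Y"
  shows "Y \<in> ge n"
proof -
  let ?Y = "shift C (n - 1) Y"
  have Y': "?Y \<in> Obj C"
    by (rule shift_Obj[OF Y])
  obtain A B where AB: "A \<in> le 0" "B \<in> ge 1" "exact_triangle C A ?Y B"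
    using t Y' unfolding is_t_structure_def by blast
  have BO: "B \<in> Obj C" and AO: "A \<in> Obj C"
    using AB le_Obj ge_Obj by blast+
  have "shift C (1 - n) A \<in> le (n - 1)"
    using AB(1) AO le_shift by simp
  then have "orth C A ?Y"
    using o orth_shift_left[OF AO Y, of "1 - n"] by simp
  moreover have "shift C (-1) B \<in> ge 1"
    using AB(2) BO ge_mono[of B 1 0] by (simp add: ge_shift)
  then have "orth C A (shift C (-1) B)"
    using orth_le_ge[OF AB(1)] by simp
  moreover have "exact_triangle C (shift C (-1) B) A ?Y"
    using AB(3) BO by (intro exact_rot_inv[OF _ shift_Obj[OF BO]]) (simp add: susp_shift shift_0)
  ultimately have "orth C A A"
    using orth_exact_right by blast
  then have "zero_object C (ob \<Sigma> A)"
    using orth_self zero_susp by blast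
  then have "isomorphic C (ob \<Sigma> B) (ob \<Sigma> ?Y)"
    using exact_zero_isomorphic[OF exact_rot[OF AB(3)]] isomorphic_sym isomorphic_susp by blast
  moreover have "ob \<Sigma> B \<in> coaisle t"
    using AB(2) by (simp add: ge_iff shift_1)
  moreover have "ob \<Sigma> ?Y = shift C n Y"
    using Y by (simp add: susp_shift)
  ultimately have "shift C n Y \<in> coaisle t"
    using t shift_Obj[OF Y] unfolding is_t_structure_def iso_closed_def isomorphic_def by metis
  then show ?thesis
    using Y by (simp add: ge_iff)
qed

lemma le_orthD: "\<lbrakk>X \<in> le n; Y \<in> ge (n + 1)\<rbrakk> \<Longrightarrow> orth C X Y"
  and ge_orthD: "\<lbrakk>Y \<in> ge n; X \<in> le (n - 1)\<rbrakk> \<Longrightarrow> orth C X Y"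
  using orth_le_ge[of X n Y "n + 1"] orth_le_ge[of X "n - 1" Y n] by simp_all

lemma le_exact: "\<lbrakk>exact_triangle C X Y Z; X \<in> le n; Z \<in> le n\<rbrakk> \<Longrightarrow> Y \<in> le n"
  by (rule le_orthI[OF exact_Obj(2)]) (blast intro: orth_exact_left le_orthD)+

lemma ge_exact: "\<lbrakk>exact_triangle C X Y Z; X \<in> ge n; Z \<in> ge n\<rbrakk> \<Longrightarrow> Y \<in> ge n"
  by (rule ge_orthI[OF exact_Obj(2)]) (blast intro: orth_exact_right ge_orthD)+

lemma le_retract: "\<lbrakk>retract C X Y; X \<in> Obj C; Y \<in> le n\<rbrakk> \<Longrightarrow> X \<in> le n"
  by (rule le_orthI) (blast intro: orth_retract_left le_orthD)+

lemma le_coproduct: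
  assumes "is_coproduct C I X P \<iota>" "\<And>i. i \<in> I \<Longrightarrow> X i \<in> le n"
  shows "P \<in> le n"
proof (rule le_orthI[OF coproduct_Obj[OF assms(1)]])
  fix Y assume Y: "Y \<in> ge (n + 1)"
  show "orth C P Y"
    by (rule orth_coproduct[OF assms(1) le_orthD[OF assms(2) Y] ge_Obj[OF Y]])
qed

lemma zero_le: "zero_object C Z \<Longrightarrow> Z \<in> le n"
  using zero_object_orth(2) zero_object_Obj ge_Obj by (blast intro: le_orthI)

text \<open>The definition asks for a positive bound; monotonicity of the aisles allows any
  integer.\<close>

lemma minus_part_iff: "X \<in> minus_part C t \<longleftrightarrow> (\<exists>n. X \<in> le n)"
proof
  show "X \<in> minus_part C t" if ex: "\<exists>n. X \<in> le n"
  proof -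
    obtain n where "X \<in> le n"
      using ex by blast
    then have "X \<in> le (max n 1)"
      by (rule le_mono) simp
    then show ?thesis
      unfolding minus_part_def by (intro UN_I[of "max n 1"]) simp_all
  qed
qed (auto simp: minus_part_def)

lemma plus_part_iff: "X \<in> plus_part C t \<longleftrightarrow> (\<exists>n. X \<in> ge n)"
proof
  show "X \<in> plus_part C t" if ex: "\<exists>n. X \<in> ge n"
  proof -
    obtain n where "X \<in> ge n"
      using ex by blast
    then have "X \<in> ge (- (max (- n) 1))"
      by (rule ge_mono) simp
    then show ?thesis
      unfolding plus_part_def by (intro UN_I[of "max (- n) 1"]) simp_all
  qed
qed (auto simp: plus_part_def)

lemma plus_exact:
  assumes "exact_triangle C X Y Z" "X \<in> plus_part C t" "Z \<in> plus_part C t"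
  shows "Y \<in> plus_part C t"
proof -
  obtain m n where "X \<in> ge m" "Z \<in> ge n"
    using assms(2,3) plus_part_iff by blast
  then have "X \<in> ge (min m n)" "Z \<in> ge (min m n)"
    by (auto elim: ge_mono)
  then show ?thesis
    using ge_exact[OF assms(1)] plus_part_iff by blast
qed

lemma thick_minus: "thick C (minus_part C t)"
proof -
  have "thick C (\<Union>n. le n)"
  proof (rule thick_increasing_union)
    show "\<exists>m'. shift C n X \<in> le m'" if "X \<in> le m" for X m n
      using le_shift[OF le_Obj[OF that], of n "m - n"] that by auto
  qed (use le_Obj le_mono le_exact le_retract in blast)+
  moreover have "minus_part C t = (\<Union>n. le n)"
    using minus_part_iff by blast
  ultimately show ?thesis
    by simp
qed

end

section \<open>Induction over aisles, and the preferred equivalence class\<close>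

definition cocomplete_closed ::
  "'k rel \<Rightarrow> ('o, 'm, 'z) triangulated_category_scheme \<Rightarrow> 'o set \<Rightarrow> bool" where
  "cocomplete_closed \<kappa> C S \<longleftrightarrow> S \<subseteq> Obj C \<and> closed_under_coproducts \<kappa> C S \<and> star C S S \<subseteq> S \<and>
     (\<forall>X \<in> Obj C. \<forall>Y \<in> S. retract C X Y \<longrightarrow> X \<in> S)"

lemma cocomplete_closedI:
  assumes "S \<subseteq> Obj C" "closed_under_coproducts \<kappa> C S"
    "\<And>X Y Z. \<lbrakk>exact_triangle C X Y Z; X \<in> S; Z \<in> S\<rbrakk> \<Longrightarrow> Y \<in> S"
    "\<And>X Y. \<lbrakk>retract C X Y; X \<in> Obj C; Y \<in> S\<rbrakk> \<Longrightarrow> X \<in> S"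
  shows "cocomplete_closed \<kappa> C S"
  unfolding cocomplete_closed_def star_def using assms by blast

text \<open>\<open>cocomplete_closed\<close> collects the operations that build
  \<open>gen_closure\<close>. Shifts are not among them, as an aisle is stable under \<Sigma> but in
  general not under its inverse.\<close>

lemma gen_closure_subset:
  assumes S: "cocomplete_closed \<kappa> C S" "shifts C G J \<subseteq> S"
  shows "gen_closure \<kappa> C G J \<subseteq> S"
proof
  fix X assume "X \<in> gen_closure \<kappa> C G J"
  then obtain P where P: "X \<in> Obj C" "P \<in> Coprod \<kappa> C (shifts C G J)" "retract C X P"
    unfolding gen_closure_def smd_def retract_def is_biproduct_def by blast
  have "Coprod \<kappa> C (shifts C G J) \<subseteq> S"
    unfolding Coprod_def using S unfolding cocomplete_closed_def by blast
  then show "X \<in> S"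
    using P S(1) unfolding cocomplete_closed_def by blast
qed

lemma (in triangulated_category) generator_in_gen_closure:
  assumes "G \<in> Obj C" "0 \<in> J"
  shows "G \<in> gen_closure \<kappa> C G J"
proof -
  obtain Z where Z: "zero_object C Z"
    using zero_object_exists by blast
  have "G \<in> shifts C G J"
    using assms(2) by (auto simp: shifts_def shift_0 intro!: exI[of _ 0])
  then have "G \<in> Coprod \<kappa> C (shifts C G J)"
    unfolding Coprod_def by blast
  then show ?thesis
    unfolding gen_closure_def smd_def using biproduct_zero[OF assms(1) Z] assms(1) zero_object_Obj[OF Z] by blast
qed

locale preferred = t_structured C t
  for C :: "('o, 'm, 'z) triangulated_category_scheme" (structure) and t +
  fixes \<kappa> :: "'k rel"
  assumes inacc: "inaccessible \<kappa>" and coprods: "has_coproducts \<kappa> C" and loc_small: "locally_small \<kappa> C"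
    and pref: "preferred_t_structure \<kappa> C t"
begin

text \<open>The preferred class enters through this statement: a compact generator bounded above,
  and an induction principle for the objects of \<open>le (- A)\<close>. The same A serves both,
  being the constant of the equivalence between \<open>t\<close> and the t-structure generated by
  \<open>G\<close>.\<close>

lemma preferred_generator:
  obtains G A where "compact_generator \<kappa> C G" "G \<in> le A"
    "\<forall>S. cocomplete_closed \<kappa> C S \<and> (\<forall>i \<ge> 0. shift C i G \<in> S) \<longrightarrow> le (- A) \<subseteq> S"
proof -
  obtain G t0 A where G: "compact_generator \<kappa> C G" and t0: "is_t_structure C t0" "aisle t0 = gen_closure \<kappa> C G {..0}"
    and A: "le_part C t0 (- A) \<subseteq> le_part C t 0" "le_part C t 0 \<subseteq> le_part C t0 A"
    using pref unfolding preferred_t_structure_def generated_t_structure_def equivalent_t_structures_def by blast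
  interpret t0: t_structured C t0
    by unfold_locales (rule t0(1))
  have GO: "G \<in> Obj C"
    using G compact_Obj by (auto simp: compact_generator_def)
  have "G \<in> aisle t0"
    by (simp add: t0(2) generator_in_gen_closure[OF GO])
  then have "shift C A G \<in> le_part C t0 (- A)"
    using GO by (simp add: t0.le_iff shift_shift shift_Obj shift_0)
  then have "G \<in> le A"
    using A(1) le_shift[OF GO, of A 0] by auto
  moreover have "\<forall>S. cocomplete_closed \<kappa> C S \<and> (\<forall>i \<ge> 0. shift C i G \<in> S) \<longrightarrow> le (- A) \<subseteq> S"
  proof (intro allI impI subsetI, elim conjE)
    fix S X assume S: "cocomplete_closed \<kappa> C S" and sh: "\<forall>i \<ge> 0. shift C i G \<in> S" and X: "X \<in> le (- A)"
    have XO: "X \<in> Obj C"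
      by (rule le_Obj[OF X])
    have "shift C (- A) X \<in> le 0"
      using le_shift[OF XO, of "- A" 0] X by simp
    then have "X \<in> aisle t0"
      using A(2) XO by (auto simp: t0.le_iff shift_shift shift_0)
    moreover have "shifts C G {..0} \<subseteq> S"
      using sh by (auto simp: shifts_def)
    ultimately show "X \<in> S"
      using t0(2) gen_closure_subset[OF S] by blast
  qed
  ultimately show ?thesis
    using that G by blast
qed

lemma compact_thick: "\<lbrakk>compact_generator \<kappa> C H; compact_object \<kappa> C K; thick C \<A>; H \<in> \<A>\<rbrakk> \<Longrightarrow> K \<in> \<A>"
  by (rule compact_in_thick[OF inacc coprods loc_small])

text \<open>The objects bounded above form a thick class that contains the generator of the
  preferred class.\<close>

lemma compact_minus: "compact_object \<kappa> C K \<Longrightarrow> K \<in> minus_part C t"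
proof -
  assume K: "compact_object \<kappa> C K"
  obtain G A where "compact_generator \<kappa> C G" "G \<in> le A"
    using preferred_generator by metis
  then show ?thesis
    using compact_thick[OF _ K thick_minus] minus_part_iff by blast
qed

text \<open>One degree of the condition defining \<open>minus_c_part\<close>, for an arbitrary
  integer r. It is isolated because \<open>minus_c_retract\<close> improves approximations one
  degree at a time.\<close>

definition approx :: "int \<Rightarrow> 'o \<Rightarrow> bool" where
  "approx r X \<longleftrightarrow> (\<exists>E E'. compact_object \<kappa> C E \<and> E' \<in> le (- r) \<and> exact_triangle C E X E')"

lemma approxI: "\<lbrakk>compact_object \<kappa> C E; E' \<in> le (- r); exact_triangle C E X E'\<rbrakk> \<Longrightarrow> approx r X"
  unfolding approx_def by blast

lemma approxE:
  assumes "approx r X"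
  obtains E E' where "compact_object \<kappa> C E" "E' \<in> le (- r)" "exact_triangle C E X E'"
  using assms unfolding approx_def by blast

lemma approx_antimono: "\<lbrakk>approx r X; s \<le> r\<rbrakk> \<Longrightarrow> approx s X"
  unfolding approx_def using le_mono by (metis neg_le_iff_le)

lemma minus_c_iff: "X \<in> minus_c_part \<kappa> C t \<longleftrightarrow> X \<in> Obj C \<and> (\<forall>r. approx r X)"
proof
  assume X: "X \<in> minus_c_part \<kappa> C t"
  have "approx r X" for r
  proof -
    have "approx (max r 1) X"
      using X unfolding minus_c_part_def approx_def by simp
    then show ?thesis
      by (rule approx_antimono) simp
  qed
  then show "X \<in> Obj C \<and> (\<forall>r. approx r X)"
    using X by (simp add: minus_c_part_def)
qed (auto simp: minus_c_part_def approx_def)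

lemma zero_compact: "zero_object C Z \<Longrightarrow> compact_object \<kappa> C Z"
  using preferred_generator thick_zero[OF thick_compact] by (metis compact_generator_def mem_Collect_eq)

lemma compact_minus_c: "compact_object \<kappa> C K \<Longrightarrow> K \<in> minus_c_part \<kappa> C t"
  using minus_c_iff compact_Obj zero_object_exists zero_le exact_zero_right unfolding approx_def by metis

lemma approx_le:
  assumes "X \<in> le (- r)"
  shows "approx r X"
proof -
  obtain Z where "zero_object C Z"
    using zero_object_exists by blast
  then show ?thesis
    using approxI[OF zero_compact assms exact_zero_left] le_Obj[OF assms] by blast
qed

lemma minus_c_minus: "X \<in> minus_c_part \<kappa> C t \<Longrightarrow> X \<in> minus_part C t"
proof -
  assume "X \<in> minus_c_part \<kappa> C t"
  then obtain E E' where E: "compact_object \<kappa> C E" "E' \<in> le (- 0)" "exact_triangle C E X E'"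
    using minus_c_iff approxE by metis
  then show ?thesis
    using thick_exact[OF thick_minus E(3) compact_minus[OF E(1)]] minus_part_iff by blast
qed

text \<open>Boundedness above is automatic, since compact objects are bounded above and so are
  extensions of objects bounded above.\<close>

lemma bounded_c_iff: "X \<in> bounded_c_part \<kappa> C t \<longleftrightarrow> X \<in> minus_c_part \<kappa> C t \<and> X \<in> plus_part C t"
  using minus_c_minus by (auto simp: bounded_c_part_def bounded_part_def)

end

text \<open>
  The boundedness of \<open>Hom(\<Sigma>\<^sup>-\<^sup>n H, H)\<close> makes every compact object orthogonal to all sufficiently
  connective objects; this is what makes \<open>D\<^sup>-\<^sub>c\<close> thick.
\<close>

locale bounded_preferred = preferred C t \<kappa>
  for C :: "('o, 'm, 'z) triangulated_category_scheme" (structure) and t and \<kappa> :: "'k rel" +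
  fixes H N
  assumes gen: "compact_generator \<kappa> C H" and gen_orth: "\<And>n. n \<ge> N \<Longrightarrow> orth C (shift C (- n) H) H"
begin

lemma H: "H \<in> Obj C" "compact_object \<kappa> C H"
  using gen compact_Obj by (auto simp: compact_generator_def)

text \<open>A filtration of the class of all Y with Hom(\<Sigma>^-n H, Y) = 0 for large n. Each
  level is closed under coproducts, as H is compact; the union of the levels is thick.\<close>

definition right_orth :: "int \<Rightarrow> 'o set" where
  "right_orth m = {Y \<in> Obj C. \<forall>n \<ge> m. orth C (shift C (- n) H) Y}"

lemma right_orth_shift: "\<lbrakk>Y \<in> right_orth m; i + m \<le> m'\<rbrakk> \<Longrightarrow> shift C (- i) Y \<in> right_orth m'"
proof -
  assume Y: "Y \<in> right_orth m" "i + m \<le> m'"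
  then have YO: "Y \<in> Obj C"
    by (simp add: right_orth_def)
  have "orth C (shift C (- n) H) (shift C (- i) Y)" if "n \<ge> m'" for n
  proof -
    have "m \<le> n - i"
      using Y(2) that by simp
    then have "orth C (shift C (- (n - i)) H) Y"
      using Y(1) unfolding right_orth_def by blast
    moreover have "shift C i (shift C (- n) H) = shift C (- (n - i)) H"
      using H(1) by (simp add: shift_shift)
    ultimately show ?thesis
      using orth_shift_left[OF shift_Obj[OF H(1), of "- n"] YO, of i] by simp
  qed
  then show ?thesis
    using shift_Obj[OF YO] by (simp add: right_orth_def)
qed

lemma right_orth_exact: "\<lbrakk>exact_triangle C X Y Z; X \<in> right_orth m; Z \<in> right_orth m\<rbrakk> \<Longrightarrow> Y \<in> right_orth m"
  unfolding right_orth_def using exact_Obj(2) orth_exact_right by blast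

lemma right_orth_retract: "\<lbrakk>retract C X Y; X \<in> Obj C; Y \<in> right_orth m\<rbrakk> \<Longrightarrow> X \<in> right_orth m"
  unfolding right_orth_def using orth_retract_right by blast

lemma right_orth_coproduct: "closed_under_coproducts \<kappa> C (right_orth m)"
  unfolding closed_under_coproducts_def
proof (intro allI impI, elim conjE)
  fix I :: "'k set" and X P \<iota>
  assume I: "|I| <o \<kappa>" "\<forall>i \<in> I. X i \<in> right_orth m" and cop: "is_coproduct C I X P \<iota>"
  have XO: "X i \<in> Obj C" if "i \<in> I" for i
    using I(2) that by (simp add: right_orth_def)
  have PO: "P \<in> Obj C"
    by (rule coproduct_Obj[OF cop])
  have "orth C (shift C (- n) H) P" if n: "n \<ge> m" for n
  proof (rule orthI[OF shift_Obj[OF H(1)] PO])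
    fix f assume f: "f \<in> Mor C (shift C (- n) H) P"
    have "f \<in> finite_maps C I X P \<iota> (shift C (- n) H)"
      by (rule compact_finite_maps[OF compact_shift[OF H(2)] I(1) XO cop f])
    then show "f = zero_arr C (shift C (- n) H) P"
    proof induction
      case (step g i f)
      have "f = zero_arr C (shift C (- n) H) (X i)"
        using I(2) step(2,3) n orthD by (auto simp: right_orth_def)
      moreover have "\<iota> i \<cdot> zero_arr C (shift C (- n) H) (X i) = zero_arr C (shift C (- n) H) P"
        using coproduct_Mor[OF cop step(2)] shift_Obj[OF H(1)] by (simp add: Mor_def add_simps)
      ultimately show ?case
        using step.IH plus_zero[OF zero_Mor[OF shift_Obj[OF H(1)] PO]] by simp
    qed simp
  qed
  then show "P \<in> right_orth m"
    using PO by (simp add: right_orth_def)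
qed

text \<open>The filtration is used twice. Its union is thick and contains H, so the generator G of
  \<open>preferred_generator\<close> lies in some level m. That level is closed under coproducts and
  contains \<Sigma>^i G for all i \<ge> 0, so it contains all of \<open>le (- A)\<close>.\<close>

lemma generator_orth: "\<exists>m. \<forall>X \<in> le m. orth C H X"
proof -
  obtain G A where G: "compact_generator \<kappa> C G" "G \<in> le A" and S: "\<forall>S. cocomplete_closed \<kappa> C S \<and> (\<forall>i \<ge> 0. shift C i G \<in> S) \<longrightarrow> le (- A) \<subseteq> S"
    by (rule preferred_generator)
  let ?U = "\<Union>m. right_orth m"
  have "thick C ?U"
  proof (rule thick_increasing_union)
    show "\<exists>m'. shift C n X \<in> right_orth m'" if "X \<in> right_orth m" for X m n
      using right_orth_shift[OF that, of "- n"] by auto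
  qed (use right_orth_exact right_orth_retract in \<open>blast | auto simp: right_orth_def\<close>)+
  moreover have "H \<in> right_orth N"
    using H gen_orth by (simp add: right_orth_def)
  then have "H \<in> ?U"
    by blast
  moreover have "compact_object \<kappa> C G"
    using G(1) by (simp add: compact_generator_def)
  ultimately have "G \<in> ?U"
    using compact_thick[OF gen] by blast
  then obtain m where m: "G \<in> right_orth m"
    by blast
  have "cocomplete_closed \<kappa> C (right_orth m)"
  proof (rule cocomplete_closedI[OF _ right_orth_coproduct])
    show "right_orth m \<subseteq> Obj C"
      by (auto simp: right_orth_def)
  qed (use right_orth_exact right_orth_retract in blast)+
  moreover have "\<forall>i \<ge> 0. shift C i G \<in> right_orth m"
    using right_orth_shift[OF m, of "- i" m for i] by simp
  ultimately have sub: "le (- A) \<subseteq> right_orth m"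
    using S by blast
  \<comment> \<open>Here \<Sigma>^-m X lies in \<open>le (- A)\<close>, and its orthogonality to
    \<Sigma>^-m H is shifted back by m.\<close>
  have "orth C H X" if X: "X \<in> le (- A - m)" for X
  proof -
    have "shift C (- m) X \<in> le (- A)"
      using X le_shift[OF le_Obj[OF X]] by simp
    then have "orth C (shift C (- m) H) (shift C (- m) X)"
      using sub by (auto simp: right_orth_def)
    then show ?thesis
      using orth_shift H(1) le_Obj[OF X] by blast
  qed
  then show ?thesis
    by blast
qed

lemma compact_orth:
  assumes "compact_object \<kappa> C K"
  shows "\<exists>m. \<forall>X \<in> le m. orth C K X"
proof -
  \<comment> \<open>The sign makes the family increasing in m, as
    \<open>thick_increasing_union\<close> expects.\<close>
  let ?S = "\<lambda>m. {K \<in> Obj C. \<forall>X \<in> le (- m). orth C K X}"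
  have "thick C (\<Union>m. ?S m)"
  proof (rule thick_increasing_union)
    show "\<exists>m'. shift C n K \<in> ?S m'" if K: "K \<in> ?S m" for K m n
    proof -
      have "orth C (shift C n K) X" if X: "X \<in> le (- (m + n))" for X
        using K le_shift[OF le_Obj[OF X], of "- n" "- m"] X orth_shift_left[of K X n] le_Obj[OF X] by simp
      then have "shift C n K \<in> ?S (m + n)"
        using K shift_Obj by blast
      then show ?thesis
        by blast
    qed
    show "?S m \<subseteq> ?S n" if "m \<le> n" for m n
    proof -
      have "le (- n) \<subseteq> le (- m)"
        using le_mono that by (meson neg_le_iff_le subsetI)
      then show ?thesis
        by blast
    qed
    show "Y \<in> ?S m" if tr: "exact_triangle C X Y Z" "X \<in> ?S m" "Z \<in> ?S m" for X Y Z m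
      using orth_exact_left[OF tr(1)] exact_Obj(2)[OF tr(1)] tr(2,3) by blast
  qed (use orth_retract_left in blast)+
  moreover obtain m where "\<forall>X \<in> le m. orth C H X"
    using generator_orth by blast
  then have "H \<in> ?S (- m)"
    using H(1) by simp
  then have "H \<in> (\<Union>m. ?S m)"
    by blast
  ultimately have "K \<in> (\<Union>m. ?S m)"
    by (rule compact_thick[OF gen assms])
  then show ?thesis
    by blast
qed

text \<open>Let K approximate b with cone b', and let E approximate a with cone a', so closely that
  K has no maps to \<Sigma>a'. The preimage X1 of K in X, taken modulo E, is an extension of K by
  a'; it splits, so there is a compact extension E1 of K by E inside X1, and X modulo E1 is an
  extension of b' by a'. The degree to which a is approximated depends on K, whereas b is
  approximated only to degree r; \<open>minus_c_retract\<close> relies on this asymmetry.\<close>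

lemma approx_extension:
  assumes X: "exact_triangle C a X b" and a: "a \<in> minus_c_part \<kappa> C t" and b: "approx r b"
  shows "approx r X"
proof -
  obtain K b' where K: "compact_object \<kappa> C K" "b' \<in> le (- r)" "exact_triangle C K b b'"
    using approxE[OF b] .
  obtain m where m: "\<And>X. X \<in> le m \<Longrightarrow> orth C K X"
    using compact_orth[OF K(1)] by blast
  \<comment> \<open>Depth r is what the conclusion demands of a'; depth -m puts \<Sigma>a' into
    \<open>le m\<close>, where K is orthogonal to it.\<close>
  obtain E a' where E: "compact_object \<kappa> C E" "a' \<in> le (- (max r (- m)))" "exact_triangle C E a a'"
    using approxE a minus_c_iff by metis
  have a': "a' \<in> le (- r)" "ob \<Sigma> a' \<in> le m"
  proof -
    show "a' \<in> le (- r)"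
      by (rule le_mono[OF E(2)]) simp
    have "a' \<in> le (m + 1)"
      by (rule le_mono[OF E(2)]) simp
    then show "ob \<Sigma> a' \<in> le m"
      using le_shift[of a' 1 m] le_Obj by (simp add: shift_1)
  qed
  obtain X1 where X1: "exact_triangle C a X1 K" "exact_triangle C X1 X b'"
    using star_assoc1[OF X K(3)] .
  obtain Q where Q: "exact_triangle C E X1 Q" "exact_triangle C a' Q K"
    using star_assoc2[OF X1(1) E(3)] .
  have Q': "exact_triangle C K Q a'"
    by (rule exact_swap[OF Q(2) m[OF a'(2)]])
  obtain E1 where E1: "exact_triangle C E E1 K" "exact_triangle C E1 X1 a'"
    using star_assoc1[OF Q(1) Q'] .
  obtain Q1 where Q1: "exact_triangle C E1 X Q1" "exact_triangle C a' Q1 b'"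
    using star_assoc2[OF X1(2) E1(2)] .
  show ?thesis
    by (rule approxI[OF compact_extension[OF E1(1) E(1) K(1)] le_exact[OF Q1(2) a'(1) K(2)] Q1(1)])
qed

lemma approx_shift:
  assumes "approx (r - n) X"
  shows "approx r (shift C n X)"
proof -
  obtain E E' where E: "compact_object \<kappa> C E" "E' \<in> le (- (r - n))" "exact_triangle C E X E'"
    using approxE[OF assms] .
  have "shift C n E' \<in> le (- r)"
    using E(2) le_shift[OF le_Obj[OF E(2)], of n "- r"] by simp
  then show ?thesis
    using approxI[OF compact_shift[OF E(1)] _ exact_shift[OF E(3)]] by blast
qed

lemma minus_c_extension:
  assumes "exact_triangle C X Y Z" "X \<in> minus_c_part \<kappa> C t" "Z \<in> minus_c_part \<kappa> C t"
  shows "Y \<in> minus_c_part \<kappa> C t"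
  using approx_extension[OF assms(1,2)] assms(3) exact_Obj(2)[OF assms(1)] by (simp add: minus_c_iff)

text \<open>
  For \<open>W = X \<oplus> Y\<close> the triangles \<open>W \<rightarrow> X \<rightarrow> \<Sigma>Y\<close> and \<open>W \<rightarrow> Y \<rightarrow> \<Sigma>X\<close> improve an approximation of either
  summand to a better one of the other.
\<close>

lemma minus_c_retract:
  assumes r: "retract C X W" "X \<in> Obj C" and W: "W \<in> minus_c_part \<kappa> C t"
  shows "X \<in> minus_c_part \<kappa> C t"
proof -
  obtain Y where Y: "exact_triangle C Y W X" "exact_triangle C X W Y"
    using retract_complement[OF r(1)] .
  have "X \<in> minus_part C t"
    using thick_retract[OF thick_minus r] minus_c_minus[OF W] by blast
  moreover from this have "Y \<in> minus_part C t"
    using thick_fibre[OF thick_minus Y(1)] minus_c_minus[OF W] by blast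
  ultimately obtain a b where "X \<in> le a" "Y \<in> le b"
    using minus_part_iff by blast
  then have n: "X \<in> le (max a b)" "Y \<in> le (max a b)"
    by (auto elim: le_mono)
  \<comment> \<open>At k = 0 the zero object approximates both summands, which lie in
    \<open>le (max a b)\<close>. Each suspension gains one degree, and X and Y are improved from one
    another simultaneously.\<close>
  have XY: "approx (int k - max a b) X \<and> approx (int k - max a b) Y" for k
  proof (induction k)
    case 0
    then show ?case
      using approx_le n by simp
  next
    case (Suc k)
    then have "approx (int (Suc k) - max a b) (ob \<Sigma> X)" "approx (int (Suc k) - max a b) (ob \<Sigma> Y)"
      using approx_shift[of "int (Suc k) - max a b" 1] by (simp_all add: shift_1 algebra_simps)
    then show ?case
      using approx_extension[OF exact_rot[OF Y(1)] W] approx_extension[OF exact_rot[OF Y(2)] W] by blast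
  qed
  have "approx r X" for r
  proof (rule approx_antimono)
    show "approx (int (nat (r + max a b)) - max a b) X"
      using XY by blast
  qed simp
  then show ?thesis
    using r(2) minus_c_iff by blast
qed

lemma minus_c_thick: "thick C (minus_c_part \<kappa> C t)"
proof (rule thickI)
  show "shift C n X \<in> minus_c_part \<kappa> C t" if "X \<in> minus_c_part \<kappa> C t" for X n
    using that approx_shift shift_Obj by (simp add: minus_c_iff)
qed (use minus_c_iff minus_c_extension minus_c_retract in blast)+

end

section \<open>Exact functors and t-structures\<close>

context triangulated_category
begin

text \<open>\<open>shift\<close> acts on objects only, so the isomorphism is encoded as a triangle
  with zero third vertex, which can be shifted.\<close>

lemma isomorphic_shift:
  assumes "isomorphic C X Y"
  shows "isomorphic C (shift C n X) (shift C n Y)"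
proof -
  obtain Z where Z: "zero_object C Z"
    using zero_object_exists by blast
  have "exact_triangle C X Y Z"
    using exact_iso[OF exact_zero_right[OF _ Z] isomorphic_refl assms isomorphic_refl] isomorphic_Obj[OF assms]
      zero_object_Obj[OF Z] by blast
  then show ?thesis
    using exact_zero_isomorphic[OF exact_shift zero_shift[OF Z]] by blast
qed

end

locale exact_between = C: triangulated_category C + D: triangulated_category D
  for C :: "('o1, 'm1, 'z1) triangulated_category_scheme" and D :: "('o2, 'm2, 'z2) triangulated_category_scheme" +
  fixes F
  assumes exact: "exact_functor C D F"
begin

lemma F: "is_functor C D F"
  using exact by (simp add: exact_functor_def additive_functor_def)

lemma F_exact:
  assumes "exact_triangle C X Y Z"
  shows "exact_triangle D (ob F X) (ob F Y) (ob F Z)"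
proof -
  obtain f g h where t: "tri C f g h X Y Z"
    using assms by (auto simp: exact_triangle_tri)
  note m = C.tri_Mor[OF t]
  obtain \<phi> where \<phi>: "natural_transformation C D (F \<circ>\<^sub>F susp C) (susp D \<circ>\<^sub>F F) \<phi>"
    "\<forall>f g h. (f, g, h) \<in> Tri C \<longrightarrow> (ar F f, ar F g, \<phi> (Dom C f) \<cdot>\<^bsub>D\<^esub> ar F h) \<in> Tri D"
    using exact unfolding exact_functor_def by blast
  have X: "X \<in> Obj C" "Dom C f = X"
    using C.tri_Obj[OF t] m(1) by (auto simp: Mor_def)
  have "\<phi> X \<in> Mor D (ob F (ob (susp C) X)) (ob (susp D) (ob F X))"
    using \<phi>(1) X(1) by (simp add: natural_transformation_def comp_functor_def)
  then have "triangle D (ar F f) (ar F g) (\<phi> X \<cdot>\<^bsub>D\<^esub> ar F h) (ob F X) (ob F Y) (ob F Z)"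
    using functor_Mor[OF F m(1)] functor_Mor[OF F m(2)] D.comp_Mor[OF functor_Mor[OF F m(3)]]
    by (simp add: triangle_def)
  moreover have "(ar F f, ar F g, \<phi> X \<cdot>\<^bsub>D\<^esub> ar F h) \<in> Tri D"
    using \<phi>(2) t X(2) by (auto simp: tri_def)
  ultimately show ?thesis
    unfolding exact_triangle_def by blast
qed

lemma F_susp: "X \<in> Obj C \<Longrightarrow> isomorphic D (ob F (ob (susp C) X)) (ob (susp D) (ob F X))"
  using exact unfolding exact_functor_def isomorphic_def by blast

lemma F_shift:
  assumes X: "X \<in> Obj C"
  shows "isomorphic D (ob F (shift C n X)) (shift D n (ob F X))"
proof (induction n rule: int_induct[of _ 0])
  case base
  then show ?case
    using D.isomorphic_refl functor_Obj[OF F X] by (simp add: C.shift_0 D.shift_0)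
next
  case (step1 i)
  then show ?case
    using D.isomorphic_trans[OF F_susp[OF C.shift_Obj[OF X]] D.isomorphic_susp] functor_Obj[OF F X] X
    by (simp add: C.shift_Suc D.shift_Suc)
next
  case (step2 i)
  let ?X = "shift C (i - 1) X"
  have X': "?X \<in> Obj C"
    by (rule C.shift_Obj[OF X])
  have FX: "ob F X \<in> Obj D"
    by (rule functor_Obj[OF F X])
  have "isomorphic D (ob (susp D) (ob F ?X)) (ob F (shift C i X))"
    using D.isomorphic_sym[OF F_susp[OF X']] X by (simp add: C.susp_shift)
  then have "isomorphic D (shift D 1 (ob F ?X)) (shift D i (ob F X))"
    using D.isomorphic_trans step2 by (metis D.shift_1)
  then have "isomorphic D (shift D (-1) (shift D 1 (ob F ?X))) (shift D (-1) (shift D i (ob F X)))"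
    by (rule D.isomorphic_shift)
  then show ?case
    using functor_Obj[OF F X'] FX by (simp add: D.shift_shift D.shift_0)
qed

lemma thick_vimage:
  assumes "thick D \<A>"
  shows "thick C {X \<in> Obj C. ob F X \<in> \<A>}"
proof (rule C.thickI)
  show "shift C n X \<in> {X \<in> Obj C. ob F X \<in> \<A>}" if X: "X \<in> {X \<in> Obj C. ob F X \<in> \<A>}" for X n
  proof -
    have "shift D n (ob F X) \<in> \<A>"
      using D.thick_shift[OF assms] X by simp
    moreover have "retract D (ob F (shift C n X)) (shift D n (ob F X))"
      using D.isomorphic_retract[OF F_shift] X by simp
    ultimately have "ob F (shift C n X) \<in> \<A>"
      using D.thick_retract[OF assms] functor_Obj[OF F C.shift_Obj] X by simp
    then show ?thesis
      using C.shift_Obj X by simp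
  qed
  show "Y \<in> {X \<in> Obj C. ob F X \<in> \<A>}"
    if "exact_triangle C X Y Z" "X \<in> {X \<in> Obj C. ob F X \<in> \<A>}" "Z \<in> {X \<in> Obj C. ob F X \<in> \<A>}" for X Y Z
    using D.thick_exact[OF assms F_exact[OF that(1)]] that(2,3) C.exact_Obj(2)[OF that(1)] by simp
  show "X \<in> {X \<in> Obj C. ob F X \<in> \<A>}"
    if "retract C X Y" "X \<in> Obj C" "Y \<in> {X \<in> Obj C. ob F X \<in> \<A>}" for X Y
    using D.thick_retract[OF assms functor_retract[OF F C.category_axioms that(1)] functor_Obj[OF F that(2)]] that by simp
qed blast

end

locale right_bounded_functor = exact_between C D F + C: preferred C t \<kappa> + D: preferred D t' \<kappa>
  for C :: "('o1, 'm1, 'z1) triangulated_category_scheme" and D :: "('o2, 'm2, 'z2) triangulated_category_scheme"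
    and F t t' and \<kappa> :: "'k rel" +
  assumes F_coproducts: "preserves_coproducts \<kappa> C D F"
    and F_compact: "\<And>K. compact_object \<kappa> C K \<Longrightarrow> ob F K \<in> minus_part D t'"
begin

text \<open>Let m bound FG. The objects that F sends into \<open>le m\<close> form a
  \<open>cocomplete_closed\<close> class containing G and its suspensions, hence
  \<open>le (- A)\<close>. As F commutes with shifts, the offset m + A is the same in every
  degree.\<close>

lemma F_le: "\<exists>n. \<forall>k. \<forall>X \<in> le_part C t k. ob F X \<in> le_part D t' (k + n)"
proof -
  obtain G A where G: "compact_generator \<kappa> C G" "G \<in> C.le A"
    and S: "\<forall>S. cocomplete_closed \<kappa> C S \<and> (\<forall>i \<ge> 0. shift C i G \<in> S) \<longrightarrow> C.le (- A) \<subseteq> S"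
    by (rule C.preferred_generator)
  have GO: "G \<in> Obj C"
    by (rule C.le_Obj[OF G(2)])
  obtain m where m: "ob F G \<in> D.le m"
    using F_compact[of G] G(1) D.minus_part_iff by (auto simp: compact_generator_def)
  let ?S = "{X \<in> Obj C. ob F X \<in> D.le m}"
  have iso: "Y \<in> D.le n" if "isomorphic D Y X" "X \<in> D.le n" for X Y n
    by (rule D.le_retract[OF D.isomorphic_retract[OF that(1)] D.isomorphic_Obj(1)[OF that(1)] that(2)])
  have "cocomplete_closed \<kappa> C ?S"
  proof (rule cocomplete_closedI)
    show "closed_under_coproducts \<kappa> C ?S"
      unfolding closed_under_coproducts_def
    proof (intro allI impI, elim conjE)
      fix I :: "'k set" and X P \<iota>
      assume I: "|I| <o \<kappa>" "\<forall>i \<in> I. X i \<in> ?S" and cop: "is_coproduct C I X P \<iota>"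
      have "is_coproduct D I (\<lambda>i. ob F (X i)) (ob F P) (\<lambda>i. ar F (\<iota> i))"
        using F_coproducts I(1) cop unfolding preserves_coproducts_def by blast
      then have "ob F P \<in> D.le m"
        by (rule D.le_coproduct) (use I(2) in blast)
      then show "P \<in> ?S"
        using C.coproduct_Obj[OF cop] by blast
    qed
    show "Y \<in> ?S" if "exact_triangle C X Y Z" "X \<in> ?S" "Z \<in> ?S" for X Y Z
      using D.le_exact[OF F_exact[OF that(1)]] that(2,3) C.exact_Obj(2)[OF that(1)] by simp
    show "X \<in> ?S" if "retract C X Y" "X \<in> Obj C" "Y \<in> ?S" for X Y
      using D.le_retract[OF functor_retract[OF F C.category_axioms that(1)] functor_Obj[OF F that(2)]] that by simp
  qed blast
  moreover have "\<forall>i \<ge> 0. shift C i G \<in> ?S"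
  proof (intro allI impI)
    fix i :: int assume i: "i \<ge> 0"
    have "ob F G \<in> D.le (m + i)"
      by (rule D.le_mono[OF m]) (use i in simp)
    then have "shift D i (ob F G) \<in> D.le m"
      using D.le_shift functor_Obj[OF F GO] by blast
    then show "shift C i G \<in> ?S"
      using iso[OF F_shift[OF GO]] C.shift_Obj[OF GO] by blast
  qed
  ultimately have sub: "C.le (- A) \<subseteq> ?S"
    using S by blast
  have "ob F X \<in> D.le (k + (m + A))" if X: "X \<in> C.le k" for X k
  proof -
    have XO: "X \<in> Obj C"
      by (rule C.le_Obj[OF X])
    have "shift C (k + A) X \<in> C.le (- A)"
      using C.le_shift[OF XO] X by simp
    then have "ob F (shift C (k + A) X) \<in> D.le m"
      using sub by blast
    then have "shift D (k + A) (ob F X) \<in> D.le m"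
      using iso[OF D.isomorphic_sym[OF F_shift[OF XO]]] by blast
    then show ?thesis
      using D.le_shift[OF functor_Obj[OF F XO]] by (simp add: algebra_simps)
  qed
  then show ?thesis
    by blast
qed

text \<open>The first assumption isolates what must be known of the images FK of compact objects:
  either FK is compact, or it lies in \<open>minus_c_part\<close> and is approximated in
  turn.\<close>

lemma F_minus_c_approx:
  assumes "\<And>K Y E r. \<lbrakk>compact_object \<kappa> C K; exact_triangle D (ob F K) Y E; E \<in> D.le (- r)\<rbrakk> \<Longrightarrow> D.approx r Y"
    and X: "X \<in> minus_c_part \<kappa> C t"
  shows "ob F X \<in> minus_c_part \<kappa> D t'"
proof -
  obtain n where n: "\<forall>k. \<forall>X \<in> C.le k. ob F X \<in> D.le (k + n)"
    using F_le by blast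
  have "D.approx r (ob F X)" for r
  proof -
    \<comment> \<open>Starting n degrees deeper compensates for the offset by which F moves
      aisles.\<close>
    obtain E E' where E: "compact_object \<kappa> C E" "E' \<in> C.le (- (r + n))" "exact_triangle C E X E'"
      using X C.minus_c_iff C.approxE by metis
    have "ob F E' \<in> D.le (- (r + n) + n)"
      using n E(2) by blast
    then show ?thesis
      by (intro assms(1)[OF E(1) F_exact[OF E(3)]]) simp
  qed
  then show ?thesis
    using X C.minus_c_iff D.minus_c_iff functor_Obj[OF F] by blast
qed

lemma F_minus_c_compact:
  assumes "\<And>K. compact_object \<kappa> C K \<Longrightarrow> compact_object \<kappa> D (ob F K)" "X \<in> minus_c_part \<kappa> C t"
  shows "ob F X \<in> minus_c_part \<kappa> D t'"
  using D.approxI assms(1) by (blast intro: F_minus_c_approx[OF _ assms(2)])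

lemma F_minus_c:
  assumes "bounded_preferred D t' \<kappa> H N"
    and "\<And>K. compact_object \<kappa> C K \<Longrightarrow> ob F K \<in> minus_c_part \<kappa> D t'" "X \<in> minus_c_part \<kappa> C t"
  shows "ob F X \<in> minus_c_part \<kappa> D t'"
proof -
  interpret D: bounded_preferred D t' \<kappa> H N
    by (rule assms(1))
  show ?thesis
    by (rule F_minus_c_approx[OF D.approx_extension[OF _ assms(2) D.approx_le] assms(3)])
qed

text \<open>Hom(X, RY) vanishes exactly when Hom(FX, Y) does, and F moves aisles by a fixed offset
  n, so the lower bound m of Y becomes m - n.\<close>

lemma right_adjoint_plus:
  assumes "adjoint_pair C D F R \<eta> \<epsilon>" and Y: "Y \<in> plus_part D t'"
  shows "ob R Y \<in> plus_part C t"
proof -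
  interpret adjoint_pair C D F R \<eta> \<epsilon>
    by (rule assms(1))
  obtain n where n: "\<forall>k. \<forall>X \<in> C.le k. ob F X \<in> D.le (k + n)"
    using F_le by blast
  obtain m where m: "Y \<in> D.ge m"
    using Y D.plus_part_iff by blast
  have YO: "Y \<in> Obj D"
    by (rule D.ge_Obj[OF m])
  have "ob R Y \<in> C.ge (m - n)"
  proof (rule C.ge_orthI[OF functor_Obj[OF R YO]])
    fix X assume X: "X \<in> C.le (m - n - 1)"
    have "ob F X \<in> D.le (m - n - 1 + n)"
      using n X by blast
    then have "orth D (ob F X) Y"
      by (rule D.orth_le_ge[OF _ m]) simp
    then show "orth C X (ob R Y)"
      using orth_adjoint C.le_Obj[OF X] YO by blast
  qed
  then show ?thesis
    using C.plus_part_iff by blast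
qed

end

text \<open>Condition (1) of weak approximability says that H lies in \<open>le A\<close> and that
  \<Sigma>^-A H is orthogonal to \<open>le 0\<close>. For n \<ge> 2A the object \<Sigma>^(n-A) H
  lies in \<open>le 0\<close>, and maps \<Sigma>^-A H -> \<Sigma>^(n-A) H are shifts of maps
  \<Sigma>^-n H -> H.\<close>

lemma weakly_approximable_orth:
  assumes "triangulated_category C" "weakly_approximable \<kappa> C"
  obtains H N where "compact_generator \<kappa> C H" "\<forall>n \<ge> N. orth C (shift C (- n) H) H"
proof -
  interpret triangulated_category C
    by (rule assms(1))
  obtain H t A where H: "compact_generator \<kappa> C H" and t: "is_t_structure C t" and A: "shift C A H \<in> le_part C t 0"
    "\<forall>X \<in> le_part C t 0. Mor C (shift C (- A) H) X = {zero_arr C (shift C (- A) H) X}"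
    using assms(2) unfolding weakly_approximable_def by blast
  interpret t_structured C t
    by unfold_locales (rule t)
  have HO: "H \<in> Obj C"
    using H compact_Obj by (auto simp: compact_generator_def)
  have "orth C (shift C (- n) H) H" if n: "n \<ge> 2 * A" for n
  proof -
    have "H \<in> le (n - A)"
      by (rule le_mono[of H A]) (use A(1) le_shift[OF HO, of A 0] n in auto)
    then have "shift C (n - A) H \<in> le 0"
      using le_shift[OF HO] by simp
    then have "orth C (shift C (- A) H) (shift C (n - A) H)"
      using A(2) by (simp add: orth_def)
    then have "orth C (shift C (- (n - A)) (shift C (- A) H)) H"
      using orth_shift_left[OF shift_Obj[OF HO, of "- A"] HO, of "- (n - A)"] by simp
    then show ?thesis
      using HO by (simp add: shift_shift)
  qed
  then show ?thesis
    using that H by blast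
qed

section \<open>The recollement\<close>

lemma preferredI:
  assumes "inaccessible \<kappa>" "triangulated_with_coproducts \<kappa> C" "preferred_t_structure \<kappa> C t"
  shows "preferred C t \<kappa>"
  using assms
  by (simp add: preferred_def t_structured_def t_structured_axioms_def preferred_axioms_def
      triangulated_with_coproducts_def preferred_t_structure_def)

lemma right_bounded_functorI:
  assumes "preferred C t \<kappa>" "preferred D t' \<kappa>" "exact_functor C D F" "preserves_coproducts \<kappa> C D F"
    "\<And>K. compact_object \<kappa> C K \<Longrightarrow> ob F K \<in> minus_part D t'"
  shows "right_bounded_functor C D F t t' \<kappa>"
  using assms
  by (simp add: right_bounded_functor_def right_bounded_functor_axioms_def exact_between_def exact_between_axioms_def
      preferred_def t_structured_def)

lemma adjoint_pairI:
  assumes "triangulated_category C" "triangulated_category D" "adjunction C D L R \<eta> \<epsilon>"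
    "exact_functor C D L" "exact_functor D C R"
  shows "adjoint_pair C D L R \<eta> \<epsilon>"
  using assms
  by (simp add: adjoint_pair_def adjoint_pair_axioms_def triangulated_category_def exact_functor_def)

text \<open>The identity and the zero arrow of X have the same image under a faithful F.\<close>

lemma fully_faithful_zero_object:
  assumes C: "additive_category C" and D: "additive_category D"
    and F: "additive_functor C D F" "fully_faithful C D F" and X: "X \<in> Obj C" "zero_object D (ob F X)"
  shows "zero_object C X"
proof -
  interpret C: additive_category C
    by (rule C)
  interpret D: additive_category D
    by (rule D)
  have "ar F (ident C X) = ar F (zero_arr C X X)"
    using F(1) X functor_ident[of C D F X] C.additive_functor_zero[OF F(1) D X(1,1)] D.zero_object_ident[OF X(2)]
    by (simp add: additive_functor_def)
  moreover have "inj_on (ar F) (Mor C X X)"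
    using F(2) X(1) by (simp add: fully_faithful_def bij_betw_def)
  ultimately have "ident C X = zero_arr C X X"
    using C.ident_Mor[OF X(1)] C.zero_Mor[OF X(1,1)] by (simp add: inj_on_eq_iff)
  then show ?thesis
    by (rule C.zero_objectI[OF X(1)])
qed

theorem proposition3p5:
  fixes \<kappa> :: "'k rel"
    and DF :: "('of, 'mf) triangulated_category"
    and D :: "('o, 'm) triangulated_category"
    and DU :: "('ou, 'mu) triangulated_category"
    and i_up :: "('o, 'm, 'of, 'mf) functor_data"
    and i_low :: "('of, 'mf, 'o, 'm) functor_data"
    and i_shr :: "('o, 'm, 'of, 'mf) functor_data"
    and j_shr :: "('ou, 'mu, 'o, 'm) functor_data"
    and j_up :: "('o, 'm, 'ou, 'mu) functor_data"
    and j_low :: "('ou, 'mu, 'o, 'm) functor_data"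
    and G :: 'o
    and tF :: "'of t_structure" and t :: "'o t_structure" and tU :: "'ou t_structure"
  assumes "inaccessible \<kappa>"
    and "triangulated_with_coproducts \<kappa> DF"
    and "triangulated_with_coproducts \<kappa> D"
    and "triangulated_with_coproducts \<kappa> DU"
    and "recollement DF D DU i_up i_low i_shr j_shr j_up j_low"
    and "weakly_approximable \<kappa> DU"
    and "compact_generator \<kappa> D G"
    and "\<exists>N. \<forall>n \<ge> N. Mor D (shift D (- n) G) G = {zero_arr D (shift D (- n) G) G}"
    and "preferred_t_structure \<kappa> DF tF"
    and "preferred_t_structure \<kappa> D t"
    and "preferred_t_structure \<kappa> DU tU"
    and "ob j_up G \<in> minus_c_part \<kappa> DU tU"
  shows "minus_c_part \<kappa> D t =
           {X \<in> Obj D. ob i_up X \<in> minus_c_part \<kappa> DF tF \<and> ob j_up X \<in> minus_c_part \<kappa> DU tU} \<and>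
         bounded_c_part \<kappa> D t =
           {X \<in> Obj D. ob i_up X \<in> minus_c_part \<kappa> DF tF \<and> ob j_up X \<in> bounded_c_part \<kappa> DU tU \<and>
                       ob i_shr X \<in> plus_part DF tF}"
proof -
  have tc: "triangulated_category DF" "triangulated_category D" "triangulated_category DU"
    using assms(2-4) by (auto simp: triangulated_with_coproducts_def)
  \<comment> \<open>The Hom bound in D_U comes from a generator that has no relation to G;
    \<open>ob j_up G\<close> is not assumed to be compact.\<close>
  obtain H N where H: "compact_generator \<kappa> DU H" "\<forall>n \<ge> N. orth DU (shift DU (- n) H) H"
    by (rule weakly_approximable_orth[OF tc(3) assms(6)])
  obtain M where M: "\<forall>n \<ge> M. orth D (shift D (- n) G) G"
    using assms(8) unfolding orth_def by blast
  note prefF = preferredI[OF assms(1,2,9)] and prefD = preferredI[OF assms(1,3,10)]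
    and prefU = preferredI[OF assms(1,4,11)]
  interpret F: preferred DF tF \<kappa>
    by (rule prefF)
  interpret D: bounded_preferred D t \<kappa> G M
    by (rule bounded_preferred.intro[OF prefD bounded_preferred_axioms.intro[OF assms(7)]]) (use M in blast)
  interpret U: bounded_preferred DU tU \<kappa> H N
    by (rule bounded_preferred.intro[OF prefU bounded_preferred_axioms.intro[OF H(1)]]) (use H(2) in blast)
  have ex: "exact_functor D DF i_up" "exact_functor DF D i_low" "exact_functor D DF i_shr"
    "exact_functor DU D j_shr" "exact_functor D DU j_up" "exact_functor DU D j_low"
    and ff: "fully_faithful DF D i_low"
    using assms(5) by (auto simp: recollement_def)
  obtain \<eta>1 \<epsilon>1 \<eta>2 \<epsilon>2 \<eta>3 \<epsilon>3 \<eta>4 \<epsilon>4 \<delta> \<delta>' where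
    adj: "adjunction D DF i_up i_low \<eta>1 \<epsilon>1" "adjunction DF D i_low i_shr \<eta>2 \<epsilon>2"
      "adjunction DU D j_shr j_up \<eta>3 \<epsilon>3" "adjunction D DU j_up j_low \<eta>4 \<epsilon>4"
    and \<delta>: "natural_transformation D D (i_low \<circ>\<^sub>F i_up) (susp D \<circ>\<^sub>F (j_shr \<circ>\<^sub>F j_up)) \<delta>"
      "\<forall>X \<in> Obj D. (\<epsilon>3 X, \<eta>1 X, \<delta> X) \<in> Tri D"
    and \<delta>': "natural_transformation D D (j_low \<circ>\<^sub>F j_up) (susp D \<circ>\<^sub>F (i_low \<circ>\<^sub>F i_shr)) \<delta>'"
      "\<forall>X \<in> Obj D. (\<epsilon>2 X, \<eta>4 X, \<delta>' X) \<in> Tri D"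
    using assms(5) unfolding recollement_def by blast
  note ap1 = adjoint_pairI[OF tc(2,1) adj(1) ex(1,2)] and ap2 = adjoint_pairI[OF tc(1,2) adj(2) ex(2,3)]
    and ap3 = adjoint_pairI[OF tc(3,2) adj(3) ex(4,5)] and ap4 = adjoint_pairI[OF tc(2,3) adj(4) ex(5,6)]
  have tri1: "exact_triangle D (ob j_shr (ob j_up X)) X (ob i_low (ob i_up X))" if X: "X \<in> Obj D" for X
  proof -
    have "triangle D (\<epsilon>3 X) (\<eta>1 X) (\<delta> X) (ob j_shr (ob j_up X)) X (ob i_low (ob i_up X))"
      using adjoint_pair.counit_Mor[OF ap3 X] adjoint_pair.unit_Mor[OF ap1 X] \<delta>(1) X
      by (simp add: triangle_def natural_transformation_def comp_functor_def)
    then show ?thesis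
      using \<delta>(2) X unfolding exact_triangle_def by blast
  qed
  have tri2: "exact_triangle D (ob i_low (ob i_shr X)) X (ob j_low (ob j_up X))" if X: "X \<in> Obj D" for X
  proof -
    have "triangle D (\<epsilon>2 X) (\<eta>4 X) (\<delta>' X) (ob i_low (ob i_shr X)) X (ob j_low (ob j_up X))"
      using adjoint_pair.counit_Mor[OF ap2 X] adjoint_pair.unit_Mor[OF ap4 X] \<delta>'(1) X
      by (simp add: triangle_def natural_transformation_def comp_functor_def)
    then show ?thesis
      using \<delta>'(2) X unfolding exact_triangle_def by blast
  qed
  note pc = adjoint_pair.left_adjoint_preserves_coproducts
  \<comment> \<open>\<open>i_low\<close>, the right adjoint of \<open>i_up\<close>, preserves
    coproducts because it is also the left adjoint of \<open>i_shr\<close>. In the same way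
    \<open>j_up\<close> is right adjoint to \<open>j_shr\<close> and left adjoint to
    \<open>j_low\<close>.\<close>
  have cpt_i: "compact_object \<kappa> DF (ob i_up K)" if "compact_object \<kappa> D K" for K
    by (rule adjoint_pair.left_adjoint_compact[OF ap1 pc[OF ap2] that])
  have cpt_j: "compact_object \<kappa> D (ob j_shr K)" if "compact_object \<kappa> DU K" for K
    by (rule adjoint_pair.left_adjoint_compact[OF ap3 pc[OF ap4] that])
  have i_up: "right_bounded_functor D DF i_up t tF \<kappa>"
    by (rule right_bounded_functorI[OF prefD prefF ex(1) pc[OF ap1] F.compact_minus[OF cpt_i]])
  have j_shr: "right_bounded_functor DU D j_shr tU t \<kappa>"
    by (rule right_bounded_functorI[OF prefU prefD ex(4) pc[OF ap3] D.compact_minus[OF cpt_j]])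
  \<comment> \<open>No Hom bound is assumed for D_F; preservation of compact objects by
    \<open>i_up\<close> takes its place.\<close>
  have i_up_c: "ob i_up X \<in> minus_c_part \<kappa> DF tF" if "X \<in> minus_c_part \<kappa> D t" for X
    by (rule right_bounded_functor.F_minus_c_compact[OF i_up cpt_i that])
  have j_shr_c: "ob j_shr X \<in> minus_c_part \<kappa> D t" if "X \<in> minus_c_part \<kappa> DU tU" for X
    by (rule right_bounded_functor.F_minus_c_compact[OF j_shr cpt_j that])
  \<comment> \<open>Checking one compact generator is enough, since the inverse image of a thick
    class under an exact functor is thick.\<close>
  have cpt_ju: "ob j_up K \<in> minus_c_part \<kappa> DU tU" if K: "compact_object \<kappa> D K" for K
  proof -
    have "exact_between D DU j_up"
      using tc ex by (simp add: exact_between_def exact_between_axioms_def)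
    then have "thick D {X \<in> Obj D. ob j_up X \<in> minus_c_part \<kappa> DU tU}"
      by (rule exact_between.thick_vimage[OF _ U.minus_c_thick])
    then show ?thesis
      using D.compact_thick[OF assms(7) K] D.H(1) assms(12) by blast
  qed
  have j_up: "right_bounded_functor D DU j_up t tU \<kappa>"
    by (rule right_bounded_functorI[OF prefD prefU ex(5) pc[OF ap4] U.minus_c_minus[OF cpt_ju]])
  have j_up_c: "ob j_up X \<in> minus_c_part \<kappa> DU tU" if "X \<in> minus_c_part \<kappa> D t" for X
    by (rule right_bounded_functor.F_minus_c[OF j_up U.bounded_preferred_axioms cpt_ju that])
  \<comment> \<open>This object is the cone of a map between members of the thick class;
    \<open>j_shr\<close> carries the hypothesis on \<open>ob j_up G\<close> from D_U to D.\<close>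
  have iG: "ob i_low (ob i_up G) \<in> minus_c_part \<kappa> D t"
    using D.thick_cone[OF D.minus_c_thick tri1[OF D.H(1)]] j_shr_c[OF assms(12)] D.compact_minus_c[OF D.H(2)]
    by blast
  \<comment> \<open>By adjunction, maps from the shifts of \<open>ob i_up G\<close> to Y are maps
    from the shifts of G to \<open>ob i_low Y\<close>. So the latter object is zero, and
    \<open>i_low\<close> is faithful.\<close>
  have gen: "compact_generator \<kappa> DF (ob i_up G)"
    unfolding compact_generator_def
  proof (intro conjI ballI impI cpt_i D.H(2))
    fix Y assume Y: "Y \<in> Obj DF"
      and o: "\<forall>n. Mor DF (shift DF n (ob i_up G)) Y = {zero_arr DF (shift DF n (ob i_up G)) Y}"
    have iY: "ob i_low Y \<in> Obj D"
      using ex(2) Y by (simp add: exact_functor_def additive_functor_def is_functor_def)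
    have "orth D (shift D n G) (ob i_low Y)" for n
    proof -
      have "orth DF (shift DF n (ob i_up G)) Y"
        using o by (simp add: orth_def)
      moreover have "isomorphic DF (ob i_up (shift D n G)) (shift DF n (ob i_up G))"
        by (rule exact_between.F_shift[OF right_bounded_functor.axioms(1)[OF i_up] D.H(1)])
      ultimately have "orth DF (ob i_up (shift D n G)) Y"
        using F.orth_retract_left F.isomorphic_retract by blast
      then show ?thesis
        using adjoint_pair.orth_adjoint[OF ap1 D.shift_Obj[OF D.H(1)] Y] by blast
    qed
    then have "zero_object D (ob i_low Y)"
      using assms(7) iY unfolding compact_generator_def orth_def by blast
    then show "zero_object DF Y"
      using fully_faithful_zero_object[OF F.additive_category_axioms D.additive_category_axioms _ ff Y] ex(2)
      by (simp add: exact_functor_def)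
  qed
  have cpt_il: "ob i_low K \<in> minus_c_part \<kappa> D t" if K: "compact_object \<kappa> DF K" for K
  proof -
    have "exact_between DF D i_low"
      using tc ex by (simp add: exact_between_def exact_between_axioms_def)
    then have "thick DF {X \<in> Obj DF. ob i_low X \<in> minus_c_part \<kappa> D t}"
      by (rule exact_between.thick_vimage[OF _ D.minus_c_thick])
    moreover have "ob i_up G \<in> Obj DF"
      by (rule compact_Obj[OF cpt_i[OF D.H(2)]])
    ultimately show ?thesis
      using F.compact_thick[OF gen K] iG by blast
  qed
  have i_low: "right_bounded_functor DF D i_low tF t \<kappa>"
    by (rule right_bounded_functorI[OF prefF prefD ex(2) pc[OF ap2] D.minus_c_minus[OF cpt_il]])
  have i_low_c: "ob i_low Y \<in> minus_c_part \<kappa> D t" if "Y \<in> minus_c_part \<kappa> DF tF" for Y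
    by (rule right_bounded_functor.F_minus_c[OF i_low D.bounded_preferred_axioms cpt_il that])
  have minus: "X \<in> minus_c_part \<kappa> D t \<longleftrightarrow>
      ob i_up X \<in> minus_c_part \<kappa> DF tF \<and> ob j_up X \<in> minus_c_part \<kappa> DU tU" if X: "X \<in> Obj D" for X
    using i_up_c j_up_c D.minus_c_extension[OF tri1[OF X]] j_shr_c i_low_c by blast
  \<comment> \<open>Each of \<open>j_up\<close>, \<open>i_shr\<close>, \<open>i_low\<close> and
    \<open>j_low\<close> is right adjoint to a functor already known to be bounded on aisles, so
    \<open>right_adjoint_plus\<close> applies to all four.\<close>
  have plus: "X \<in> plus_part D t \<longleftrightarrow> ob j_up X \<in> plus_part DU tU \<and> ob i_shr X \<in> plus_part DF tF"
    if X: "X \<in> Obj D" for X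
  proof
    show "ob j_up X \<in> plus_part DU tU \<and> ob i_shr X \<in> plus_part DF tF" if "X \<in> plus_part D t"
      using right_bounded_functor.right_adjoint_plus[OF j_shr ap3 that]
        right_bounded_functor.right_adjoint_plus[OF i_low ap2 that] by blast
    show "X \<in> plus_part D t" if "ob j_up X \<in> plus_part DU tU \<and> ob i_shr X \<in> plus_part DF tF"
      using D.plus_exact[OF tri2[OF X] right_bounded_functor.right_adjoint_plus[OF i_up ap1]
          right_bounded_functor.right_adjoint_plus[OF j_up ap4]] that by blast
  qed
  have Obj: "X \<in> Obj D" if "X \<in> minus_c_part \<kappa> D t" for X
    using that D.minus_c_iff by blast
  have "minus_c_part \<kappa> D t =
      {X \<in> Obj D. ob i_up X \<in> minus_c_part \<kappa> DF tF \<and> ob j_up X \<in> minus_c_part \<kappa> DU tU}"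
    using minus Obj by blast
  moreover have "bounded_c_part \<kappa> D t =
      {X \<in> Obj D. ob i_up X \<in> minus_c_part \<kappa> DF tF \<and> ob j_up X \<in> bounded_c_part \<kappa> DU tU \<and>
         ob i_shr X \<in> plus_part DF tF}"
    unfolding set_eq_iff mem_Collect_eq D.bounded_c_iff U.bounded_c_iff using minus plus Obj by blast
  ultimately show ?thesis
    by (rule conjI)
qed

end
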